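(* Let $G=\langle x_1,\dots,x_n\mid r_1,\dots,r_m\rangle$ be a group given by a finite presentation and let $A=\{x_1^{\pm1},\dots,x_n^{\pm1}\}$. There is a single partial algorithm (uniform in $H$) which, taking as input a finite list of words $v_1,\dots,v_t\in A^{*}$ and letting $H=\langle\overline{v_1},\dots,\overline{v_t}\rangle\le G$ be the subgroup they generate, behaves as follows: (a) if $H$ is rational with respect to some automatic structure on $G$, the algorithm eventually stops and outputs an automatic structure with uniqueness $(L=L(M),A,M_{=},M_{x_1},\dots,M_{x_n^{-1}})$ for $G$ together with a finite state automaton $M_H$ such that $L(M_H)=\pi^{-1}(H)\cap L$; (b) if there is no automatic structure for $G$ with respect to which $H$ is rational, the algorithm runs forever.
   Context: For a group $G$ with a finite generating set $A$ closed under taking inverses, $A^{*}$ denotes the free monoid on $A$, $\pi\colon A^{*}\to G$ the natural monoid homomorphism, and $\overline{w}=\pi(w)$ for $w\in A^{*}$. $L(M)$ denotes the language accepted by a finite state automaton $M$. An automatic structure for $G$ over a finite generating set $A$ closed under inverses is a tuple $(L=L(M),A,M_{=},(M_a)_{a\in A})$ where $M$ is a finite state automaton over $A$ accepting the regular language $L\subseteq A^{*}$ with $\pi(L)=G$, $M_{=}$ is a finite state automaton accepting (in the usual padded, synchronous two-tape sense) exactly the pairs $(w,u)\in L\times L$ with $\overline{w}=\overline{u}$, and for each $a\in A$, $M_a$ is a finite state automaton accepting (in the same sense) exactly the pairs $(w,u)\in L\times L$ with $\overline{wa}=\overline{u}$. It is an automatic structure with uniqueness if for every $g\in G$ there is exactly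 one $w\in L$ with $\overline{w}=g$. A subgroup $H\le G$ is rational with respect to an automatic structure with language $L$ ($L$-rational) if its full preimage in $L$, $L\cap\pi^{-1}(H)$, is a regular language. *)

theory Defs
  imports "HOL-Algebra.Generated_Groups" "HOL-Library.Nat_Bijection"
begin

section \<open>Groups given by finite presentations\<close>

text \<open>\<open>Gen i\<close> and \<open>GenInv i\<close> are the formal symbols for the generator number \<open>i\<close> and its
  inverse; generators are numbered from 0.\<close>

datatype letter = Gen nat | GenInv nat

type_synonym word = "letter list"

fun inv_letter :: "letter \<Rightarrow> letter" where
  "inv_letter (Gen i) = GenInv i"
| "inv_letter (GenInv i) = Gen i"

definition alphabet :: "nat \<Rightarrow> letter set" where
  "alphabet n = Gen ` {..<n} \<union> GenInv ` {..<n}"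

inductive_set word_cong :: "nat \<Rightarrow> word set \<Rightarrow> (word \<times> word) set"
  for n :: nat and R :: "word set" where
  refl: "w \<in> lists (alphabet n) \<Longrightarrow> (w, w) \<in> word_cong n R"
| sym: "(u, w) \<in> word_cong n R \<Longrightarrow> (w, u) \<in> word_cong n R"
| trans: "(u, v) \<in> word_cong n R \<Longrightarrow> (v, w) \<in> word_cong n R \<Longrightarrow> (u, w) \<in> word_cong n R"
| cancel: "u \<in> lists (alphabet n) \<Longrightarrow> v \<in> lists (alphabet n) \<Longrightarrow> a \<in> alphabet n \<Longrightarrow>
    (u @ [a, inv_letter a] @ v, u @ v) \<in> word_cong n R"
| relator: "u \<in> lists (alphabet n) \<Longrightarrow> v \<in> lists (alphabet n) \<Longrightarrow> r \<in> R \<Longrightarrow>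
    (u @ r @ v, u @ v) \<in> word_cong n R"

definition word_class :: "nat \<Rightarrow> word set \<Rightarrow> word \<Rightarrow> word set" where
  "word_class n R w = word_cong n R `` {w}"

definition presented_group :: "nat \<Rightarrow> word set \<Rightarrow> word set monoid" where
  "presented_group n R =
    \<lparr>carrier = lists (alphabet n) // word_cong n R,
     monoid.mult = (\<lambda>S T. word_cong n R `` {u @ v | u v. u \<in> S \<and> v \<in> T}),
     one = word_class n R []\<rparr>"

definition letter_class :: "nat \<Rightarrow> word set \<Rightarrow> letter \<Rightarrow> word set" where
  "letter_class n R a = word_class n R [a]"


section \<open>Finite state automata\<close>

text \<open>A deterministic automaton as finite data.  The states are natural numbers; a missing entry in
  the transition table stands for a transition into a rejecting dead state.\<close>

record 'a fsa =
  initial :: nat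
  final :: "nat list"
  table :: "((nat \<times> 'a) \<times> nat) list"

fun run :: "'a fsa \<Rightarrow> nat \<Rightarrow> 'a list \<Rightarrow> nat option" where
  "run M s [] = Some s"
| "run M s (a # w) = (case map_of (table M) (s, a) of None \<Rightarrow> None | Some t \<Rightarrow> run M t w)"

definition lang :: "'a fsa \<Rightarrow> 'a list set" where
  "lang M = {w. \<exists>s \<in> set (final M). run M (initial M) w = Some s}"

definition regular :: "'a list set \<Rightarrow> bool" where
  "regular K \<longleftrightarrow> (\<exists>M. lang M = K)"

text \<open>Two-tape automata read \<open>pad w u\<close>; the padding symbol is \<^term>\<open>None\<close>.\<close>

type_synonym 'a padded = "'a option \<times> 'a option"

fun pad :: "'a list \<Rightarrow> 'a list \<Rightarrow> 'a padded list" where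
  "pad [] [] = []"
| "pad (a # w) [] = (Some a, None) # pad w []"
| "pad [] (b # u) = (None, Some b) # pad [] u"
| "pad (a # w) (b # u) = (Some a, Some b) # pad w u"


section \<open>Automatic structures and rational subgroups\<close>

text \<open>A finite generating set is a finite alphabet \<open>A\<close> with a map \<open>\<mu>\<close> into the group, so that
  distinct letters (such as those of \<^term>\<open>alphabet n\<close>) may name the same group element.\<close>

definition eval_word :: "('g, 'm) monoid_scheme \<Rightarrow> ('a \<Rightarrow> 'g) \<Rightarrow> 'a list \<Rightarrow> 'g" where
  "eval_word G \<mu> w = foldr (\<lambda>a g. \<mu> a \<otimes>\<^bsub>G\<^esub> g) w \<one>\<^bsub>G\<^esub>"

definition generating_alphabet :: "('g, 'm) monoid_scheme \<Rightarrow> 'a set \<Rightarrow> ('a \<Rightarrow> 'g) \<Rightarrow> bool" where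
  "generating_alphabet G A \<mu> \<longleftrightarrow>
     finite A \<and> \<mu> ` A \<subseteq> carrier G \<and>
     (\<forall>a\<in>A. \<exists>b\<in>A. \<mu> b = inv\<^bsub>G\<^esub> (\<mu> a)) \<and>
     generate G (\<mu> ` A) = carrier G"

definition automatic_structure ::
  "('g, 'm) monoid_scheme \<Rightarrow> 'a set \<Rightarrow> ('a \<Rightarrow> 'g) \<Rightarrow>
   'a fsa \<Rightarrow> 'a padded fsa \<Rightarrow> ('a \<Rightarrow> 'a padded fsa) \<Rightarrow> bool" where
  "automatic_structure G A \<mu> M M_eq M_mult \<longleftrightarrow>
     group G \<and> generating_alphabet G A \<mu> \<and>
     lang M \<subseteq> lists A \<and>
     eval_word G \<mu> ` lang M = carrier G \<and>
     lang M_eq = {pad w u | w u. w \<in> lang M \<and> u \<in> lang M \<and> eval_word G \<mu> w = eval_word G \<mu> u} \<and>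
     (\<forall>a\<in>A. lang (M_mult a) =
        {pad w u | w u. w \<in> lang M \<and> u \<in> lang M \<and> eval_word G \<mu> (w @ [a]) = eval_word G \<mu> u})"

definition automatic_structure_with_uniqueness ::
  "('g, 'm) monoid_scheme \<Rightarrow> 'a set \<Rightarrow> ('a \<Rightarrow> 'g) \<Rightarrow>
   'a fsa \<Rightarrow> 'a padded fsa \<Rightarrow> ('a \<Rightarrow> 'a padded fsa) \<Rightarrow> bool" where
  "automatic_structure_with_uniqueness G A \<mu> M M_eq M_mult \<longleftrightarrow>
     automatic_structure G A \<mu> M M_eq M_mult \<and>
     (\<forall>g\<in>carrier G. \<exists>!w. w \<in> lang M \<and> eval_word G \<mu> w = g)"

definition preimage_in ::
  "('g, 'm) monoid_scheme \<Rightarrow> ('a \<Rightarrow> 'g) \<Rightarrow> 'a list set \<Rightarrow> 'g set \<Rightarrow> 'a list set" where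
  "preimage_in G \<mu> L H = {w \<in> L. eval_word G \<mu> w \<in> H}"

text \<open>Rational with respect to some automatic structure, over any finite generating set.  Taking
  finite alphabets of natural numbers is no restriction, as every finite alphabet can be renamed.\<close>

definition rational_for_some_structure :: "('g, 'm) monoid_scheme \<Rightarrow> 'g set \<Rightarrow> bool" where
  "rational_for_some_structure G H \<longleftrightarrow>
     subgroup H G \<and>
     (\<exists>(A :: nat set) \<mu> M M_eq M_mult.
        automatic_structure G A \<mu> M M_eq M_mult \<and> regular (preimage_in G \<mu> (lang M) H))"


section \<open>Partial algorithms\<close>

definition mu_search :: "(nat \<Rightarrow> nat option) \<Rightarrow> nat option" where
  "mu_search g =
     (if \<exists>n. g n = Some 0 \<and> (\<forall>m<n. \<exists>k>0. g m = Some k) then Some (LEAST n. g n = Some 0) else None)"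

text \<open>The unary partial recursive functions, with \<^const>\<open>None\<close> for divergence.  Several arguments
  are packed into one by the Cantor pairing function \<^const>\<open>prod_encode\<close>.\<close>

inductive partial_recursive :: "(nat \<Rightarrow> nat option) \<Rightarrow> bool" where
  zero: "partial_recursive (\<lambda>_. Some 0)"
| succ: "partial_recursive (\<lambda>x. Some (Suc x))"
| left: "partial_recursive (\<lambda>x. Some (fst (prod_decode x)))"
| right: "partial_recursive (\<lambda>x. Some (snd (prod_decode x)))"
| pair: "partial_recursive f \<Longrightarrow> partial_recursive g \<Longrightarrow>
    partial_recursive
      (\<lambda>x. Option.bind (f x) (\<lambda>y. Option.bind (g x) (\<lambda>z. Some (prod_encode (y, z)))))"
| comp: "partial_recursive f \<Longrightarrow> partial_recursive g \<Longrightarrow>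
    partial_recursive (\<lambda>x. Option.bind (g x) f)"
| prec: "partial_recursive f \<Longrightarrow> partial_recursive g \<Longrightarrow>
    partial_recursive (\<lambda>x. case prod_decode x of (a, n) \<Rightarrow>
      rec_nat (f a) (\<lambda>m r. Option.bind r (\<lambda>y. g (prod_encode (a, prod_encode (m, y))))) n)"
| mu: "partial_recursive f \<Longrightarrow> partial_recursive (\<lambda>x. mu_search (\<lambda>n. f (prod_encode (x, n))))"


section \<open>Coding of inputs and outputs\<close>

fun letter_code :: "letter \<Rightarrow> nat" where
  "letter_code (Gen i) = 2 * i"
| "letter_code (GenInv i) = 2 * i + 1"

definition words_code :: "word list \<Rightarrow> nat" where
  "words_code vs = list_encode (map (\<lambda>v. list_encode (map letter_code v)) vs)"

fun padded_code :: "letter padded \<Rightarrow> nat" where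
  "padded_code (x, y) =
     prod_encode (case_option 0 (\<lambda>a. Suc (letter_code a)) x,
                  case_option 0 (\<lambda>a. Suc (letter_code a)) y)"

definition fsa_code :: "('a \<Rightarrow> nat) \<Rightarrow> 'a fsa \<Rightarrow> nat" where
  "fsa_code c M =
     prod_encode (initial M, prod_encode (list_encode (final M),
       list_encode (map (\<lambda>((s, a), t). prod_encode (prod_encode (s, c a), t)) (table M))))"

definition output_code ::
  "letter fsa \<Rightarrow> letter padded fsa \<Rightarrow> letter padded fsa list \<Rightarrow> letter fsa \<Rightarrow> nat" where
  "output_code M M_eq Ms M_H =
     list_encode ([fsa_code letter_code M, fsa_code padded_code M_eq] @
       map (fsa_code padded_code) Ms @ [fsa_code letter_code M_H])"


section \<open>Basic facts\<close>

lemma inv_letter_alphabet [simp]: "inv_letter a \<in> alphabet n \<longleftrightarrow> a \<in> alphabet n"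
  by (cases a) (auto simp: alphabet_def)

lemma inv_letter_inv_letter [simp]: "inv_letter (inv_letter a) = a"
  by (cases a) auto

lemma word_cong_words:
  assumes "R \<subseteq> lists (alphabet n)" "(u, v) \<in> word_cong n R"
  shows "u \<in> lists (alphabet n) \<and> v \<in> lists (alphabet n)"
  using assms(2)
proof induction
  case (relator u v r)
  then have "r \<in> lists (alphabet n)" using assms(1) by blast
  with relator show ?case by auto
qed auto

lemma word_cong_equiv:
  assumes "R \<subseteq> lists (alphabet n)"
  shows "equiv (lists (alphabet n)) (word_cong n R)"
proof (rule equivI)
  show "word_cong n R \<subseteq> lists (alphabet n) \<times> lists (alphabet n)"
    using word_cong_words[OF assms] by fastforce
  show "refl_on (lists (alphabet n)) (word_cong n R)"
    by (rule refl_onI) (rule word_cong.refl)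
  show "sym (word_cong n R)"
    by (rule symI) (rule word_cong.sym)
  show "trans (word_cong n R)"
    by (rule transI) (rule word_cong.trans)
qed

lemma word_cong_context:
  assumes "(u, v) \<in> word_cong n R" "p \<in> lists (alphabet n)" "q \<in> lists (alphabet n)"
  shows "(p @ u @ q, p @ v @ q) \<in> word_cong n R"
  using assms
proof induction
  case (refl w)
  then show ?case by (auto intro!: word_cong.refl)
next
  case (trans u v w)
  then show ?case by (blast intro: word_cong.trans)
next
  case (cancel u v a)
  then show ?case using word_cong.cancel[of "p @ u" n "v @ q" a R] by simp
next
  case (relator u v r)
  then show ?case using word_cong.relator[of "p @ u" n "v @ q" r R] by simp
qed (blast intro: word_cong.sym)

lemma word_cong_append:
  assumes R: "R \<subseteq> lists (alphabet n)"
    and uv: "(u, u') \<in> word_cong n R" "(v, v') \<in> word_cong n R"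
  shows "(u @ v, u' @ v') \<in> word_cong n R"
proof -
  have "(u @ v, u' @ v) \<in> word_cong n R"
    using word_cong_context[OF uv(1), of "[]" v] word_cong_words[OF R uv(2)] by simp
  moreover have "(u' @ v, u' @ v') \<in> word_cong n R"
    using word_cong_context[OF uv(2), of u' "[]"] word_cong_words[OF R uv(1)] by simp
  ultimately show ?thesis by (rule word_cong.trans)
qed

lemma word_class_eq_iff:
  assumes "R \<subseteq> lists (alphabet n)" "u \<in> lists (alphabet n)" "v \<in> lists (alphabet n)"
  shows "word_class n R u = word_class n R v \<longleftrightarrow> (u, v) \<in> word_cong n R"
  unfolding word_class_def using eq_equiv_class_iff[OF word_cong_equiv[OF assms(1)]] assms by simp

lemma carrier_presented_group:
  "carrier (presented_group n R) = word_class n R ` lists (alphabet n)"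
  by (auto simp: presented_group_def quotient_def word_class_def)

lemma one_presented_group: "\<one>\<^bsub>presented_group n R\<^esub> = word_class n R []"
  by (simp add: presented_group_def)

lemma mult_presented_group:
  assumes R: "R \<subseteq> lists (alphabet n)" and u: "u \<in> lists (alphabet n)" and v: "v \<in> lists (alphabet n)"
  shows "word_class n R u \<otimes>\<^bsub>presented_group n R\<^esub> word_class n R v = word_class n R (u @ v)"
proof -
  have 1: "(u @ v, w) \<in> word_cong n R"
    if "(u, x) \<in> word_cong n R" "(v, y) \<in> word_cong n R" "(x @ y, w) \<in> word_cong n R" for x y w
    using word_cong_append[OF R that(1,2)] that(3) by (rule word_cong.trans)
  have 2: "(u, u) \<in> word_cong n R" "(v, v) \<in> word_cong n R"
    using u v by (auto intro: word_cong.refl)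
  show ?thesis
    unfolding presented_group_def word_class_def using 1 2 by (auto simp: Image_def)
qed

lemma word_cong_inverse:
  assumes "w \<in> lists (alphabet n)"
  shows "(rev (map inv_letter w) @ w, []) \<in> word_cong n R"
  using assms
proof (induction w)
  case Nil
  then show ?case by (simp add: word_cong.refl)
next
  case (Cons a w)
  have "rev (map inv_letter w) \<in> lists (alphabet n)"
    using Cons.hyps by (auto simp: in_lists_conv_set)
  then have "(rev (map inv_letter w) @ [inv_letter a, inv_letter (inv_letter a)] @ w,
      rev (map inv_letter w) @ w) \<in> word_cong n R"
    using Cons.hyps by (intro word_cong.cancel) auto
  then show ?case using Cons by (auto intro: word_cong.trans)
qed

lemma group_presented_group:
  assumes R: "R \<subseteq> lists (alphabet n)"
  shows "group (presented_group n R)"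
proof (rule groupI)
  fix x assume "x \<in> carrier (presented_group n R)"
  then obtain w where w: "w \<in> lists (alphabet n)" "x = word_class n R w"
    by (auto simp: carrier_presented_group)
  have w': "rev (map inv_letter w) \<in> lists (alphabet n)"
    using w by (auto simp: in_lists_conv_set)
  show "\<exists>y\<in>carrier (presented_group n R).
      y \<otimes>\<^bsub>presented_group n R\<^esub> x = \<one>\<^bsub>presented_group n R\<^esub>"
  proof
    show "word_class n R (rev (map inv_letter w)) \<otimes>\<^bsub>presented_group n R\<^esub> x
        = \<one>\<^bsub>presented_group n R\<^esub>"
      using word_cong_inverse[OF w(1), of R] R w w'
      by (simp add: mult_presented_group one_presented_group word_class_eq_iff)
  qed (use w' in \<open>simp add: carrier_presented_group\<close>)
next
  fix x y assume "x \<in> carrier (presented_group n R)" "y \<in> carrier (presented_group n R)"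
  then obtain u v where uv: "u \<in> lists (alphabet n)" "v \<in> lists (alphabet n)"
    "x = word_class n R u" "y = word_class n R v"
    by (auto simp: carrier_presented_group)
  then show "x \<otimes>\<^bsub>presented_group n R\<^esub> y \<in> carrier (presented_group n R)"
    by (simp add: carrier_presented_group mult_presented_group[OF R])
  fix z assume "z \<in> carrier (presented_group n R)"
  then obtain w where "w \<in> lists (alphabet n)" "z = word_class n R w"
    by (auto simp: carrier_presented_group)
  with uv show "x \<otimes>\<^bsub>presented_group n R\<^esub> y \<otimes>\<^bsub>presented_group n R\<^esub> z =
      x \<otimes>\<^bsub>presented_group n R\<^esub> (y \<otimes>\<^bsub>presented_group n R\<^esub> z)"
    by (simp add: mult_presented_group[OF R])
qed (auto simp: carrier_presented_group mult_presented_group[OF R] one_presented_group in_lists_conv_set)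

lemma eval_word_presented_group:
  assumes R: "R \<subseteq> lists (alphabet n)" and w: "w \<in> lists (alphabet n)"
  shows "eval_word (presented_group n R) (letter_class n R) w = word_class n R w"
  using w
proof (induction w)
  case Nil
  then show ?case by (simp add: eval_word_def one_presented_group)
next
  case (Cons a w)
  then show ?case
    using mult_presented_group[OF R, of "[a]" w] by (simp add: eval_word_def letter_class_def)
qed

lemma inj_letter_code: "inj letter_code"
proof (rule injI)
  fix a b assume "letter_code a = letter_code b"
  then show "a = b" by (cases a; cases b) (auto, presburger+)
qed

lemma inj_words_code: "inj words_code"
proof -
  have "inj (\<lambda>v. list_encode (map letter_code v))"
    by (intro injI) (simp add: list_encode_eq inj_map_eq_map[OF inj_letter_code])
  then show ?thesis
    by (intro injI) (simp add: words_code_def list_encode_eq inj_map_eq_map)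
qed

lemma inj_padded_code: "inj padded_code"
  by (intro injI) (auto split: option.splits simp: inj_eq[OF inj_letter_code])

lemma inj_fsa_code:
  assumes "inj c"
  shows "inj (fsa_code c)"
proof -
  have "inj (\<lambda>((s, a), t). prod_encode (prod_encode (s, c a), t))"
    using assms by (auto simp: inj_def)
  from inj_map_eq_map[OF this] show ?thesis
    by (intro injI) (auto simp: fsa_code_def list_encode_eq intro: fsa.equality)
qed

lemma output_code_inject:
  "output_code M M_eq Ms M_H = output_code M' M_eq' Ms' M_H' \<longleftrightarrow>
     M = M' \<and> M_eq = M_eq' \<and> Ms = Ms' \<and> M_H = M_H'"
  by (auto simp: output_code_def list_encode_eq inj_eq[OF inj_fsa_code[OF inj_letter_code]]
      inj_eq[OF inj_fsa_code[OF inj_padded_code]]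
      inj_map_eq_map[OF inj_fsa_code[OF inj_padded_code]])

end

theory Submission
  imports Defs
begin

text \<open>
  The algorithm is a search.  It enumerates candidates, each consisting of an automaton for a language
  \<open>L\<close>, two-tape automata, an automaton for the subgroup and a constant \<open>k\<close>, and stops at the first one
  that it can recognize as correct.  Two things have to be shown: that correctness is semidecidable,
  uniformly in the generators of the subgroup \<open>H\<close> (\<open>semidecidable_good_candidate\<close>,
  \<open>good_candidate_sound\<close>), and that some candidate is correct as soon as \<open>H\<close> is rational for some
  automatic structure over whatever alphabet (\<open>rational_good_candidate\<close>).

  The group is fixed, so the algorithm may depend on it.  If the group has no automatic structure,
  the algorithm diverges on every input.  Otherwise one structure can be built into the algorithm, and
  it solves the word problem (\<open>word_problem_decidable\<close>); the test may therefore use equality of group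
  elements in both directions.

  \<^bold>\<open>Recognizing a correct language.\<close>  That \<open>L\<close> has exactly one word for each group element is a statement
  about all pairs of words, but for a finitely presented group it follows, for nonempty \<open>L\<close>, from two local conditions:
  every \<open>w \<in> L\<close> and letter \<open>a\<close> have a \<open>u \<in> L\<close> with \<open>u = wa\<close> in the group that stays within distance \<open>k\<close>
  of \<open>w\<close> at all times, and two different words of \<open>L\<close> that stay within distance \<open>r\<close> of each other never
  represent the same element.  Here \<open>r\<close> is computed from \<open>k\<close>, the relators and the size of the automaton.
  Indeed, moving from \<open>w\<close> to \<open>u\<close> defines an action of the group on \<open>L\<close>, because a relator moves a word to
  one that is close to it and equal to it in the group (\<open>moves_cong\<close>); and the action is transitive, because
  a word of \<open>L\<close> is reached by moving through short completions of its prefixes (\<open>moves_reach\<close>).  So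
  \<open>L\<close> is in bijection with the group (\<open>unique_representatives\<close>, \<open>every_element_represented\<close>).

  \<^bold>\<open>Recognizing the subgroup.\<close>  Once \<open>L\<close> is correct, \<open>L \<inter> H\<close> is contained in the language of the
  subgroup automaton if that language contains the word for the identity and is invariant under
  multiplication by the generators of \<open>H\<close>, which is again a condition on pairs of nearby words.  For the
  converse inclusion it suffices that the finitely many short accepted words lie in \<open>H\<close>
  (\<open>language_in_subgroup\<close>), and membership in \<open>H\<close> is semidecidable.

  \<^bold>\<open>Finitely many words suffice.\<close>  Each condition on pairs of nearby words depends only on data with
  finitely many values: states, the shape of the padding, and the difference of the two words in a ball
  (\<open>track\<close>).  By the pigeonhole principle all values already occur for pairs of bounded length, so a
  condition is checked by testing short words (\<open>tracked_all\<close>, \<open>partner_for_all\<close>).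

  \<^bold>\<open>Existence.\<close>  Given an automatic structure over an arbitrary alphabet, the shortlex least words form a
  regular language with unique representatives, and words whose elements differ by a fixed group element
  have finitely many word differences (\<open>finite_differences\<close>).  Translating letters into words over the given
  generators keeps the language regular; it keeps the differences finite because the translation
  is arranged to run at constant speed (\<open>take_translate\<close>).  Preimages of subgroups stay regular all along, so
  a standard structure for which \<open>H\<close> is still rational exists (\<open>standard_structure\<close>), and it passes
  the test (\<open>standard_passes\<close>).
\<close>

section \<open>Computable functions on coded types\<close>

definition total_recursive :: "(nat \<Rightarrow> nat) \<Rightarrow> bool" where
  "total_recursive f \<longleftrightarrow> partial_recursive (\<lambda>x. Some (f x))"

lemma total_recursive_comp:
  assumes "total_recursive f" "total_recursive g"
  shows "total_recursive (\<lambda>x. f (g x))"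
  using partial_recursive.comp[OF assms[unfolded total_recursive_def]]
  by (simp add: total_recursive_def)

lemma total_recursive_pair:
  assumes "total_recursive f" "total_recursive g"
  shows "total_recursive (\<lambda>x. prod_encode (f x, g x))"
  using partial_recursive.pair[OF assms[unfolded total_recursive_def]]
  by (simp add: total_recursive_def)

lemma total_recursive_fst: "total_recursive (\<lambda>x. fst (prod_decode x))"
  by (simp add: total_recursive_def partial_recursive.left)

lemma total_recursive_snd: "total_recursive (\<lambda>x. snd (prod_decode x))"
  by (simp add: total_recursive_def partial_recursive.right)

lemma total_recursive_Suc: "total_recursive Suc"
  by (simp add: total_recursive_def partial_recursive.succ)

lemma total_recursive_id: "total_recursive (\<lambda>x. x)"
  using total_recursive_pair[OF total_recursive_fst total_recursive_snd] by simp

lemma total_recursive_const: "total_recursive (\<lambda>x. c)"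
proof (induction c)
  case 0
  then show ?case by (simp add: total_recursive_def partial_recursive.zero)
next
  case (Suc c)
  then show ?case by (rule total_recursive_comp[OF total_recursive_Suc])
qed

lemma total_recursive_prec:
  assumes "total_recursive f" "total_recursive g"
  shows "total_recursive (\<lambda>x. rec_nat (f (fst (prod_decode x)))
    (\<lambda>m y. g (prod_encode (fst (prod_decode x), prod_encode (m, y)))) (snd (prod_decode x)))"
proof -
  have "rec_nat (Some (f a)) (\<lambda>m r. Option.bind r (\<lambda>y. Some (g (prod_encode (a, prod_encode (m, y)))))) n
     = Some (rec_nat (f a) (\<lambda>m y. g (prod_encode (a, prod_encode (m, y)))) n)" for a n
    by (induction n) auto
  then show ?thesis
    using partial_recursive.prec[OF assms[unfolded total_recursive_def]]
    by (simp add: total_recursive_def case_prod_beta)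
qed

text \<open>A type whose elements are numbered bijectively.  Because the numbering is onto, every number
  is a code and no program ever has to test its input for being one.\<close>

class coded =
  fixes enc :: "'a \<Rightarrow> nat"
  assumes bij_enc: "bij enc"
begin

definition dec :: "nat \<Rightarrow> 'a" where "dec = inv_into UNIV enc"

lemma dec_enc [simp]: "dec (enc x) = x"
  by (simp add: dec_def bij_is_inj[OF bij_enc])

lemma enc_dec [simp]: "enc (dec n) = n"
  by (simp add: dec_def bij_is_surj[OF bij_enc] surj_f_inv_f)

lemma enc_eq_iff [simp]: "enc x = enc y \<longleftrightarrow> x = y"
  using bij_is_inj[OF bij_enc] by (auto dest: injD)

end

instantiation nat :: coded
begin
definition enc_nat :: "nat \<Rightarrow> nat" where [simp]: "enc_nat n = n"
instance by standard (auto simp: bij_def inj_def surj_def)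
end

lemma dec_nat [simp]: "dec (n :: nat) = n"
  using dec_enc[of n] by (simp del: dec_enc)

instantiation prod :: (coded, coded) coded
begin
definition enc_prod :: "'a \<times> 'b \<Rightarrow> nat" where
  "enc_prod p = prod_encode (enc (fst p), enc (snd p))"
instance
proof
  have "inj (enc :: 'a \<times> 'b \<Rightarrow> nat)"
    by (auto simp: inj_def enc_prod_def prod_eq_iff)
  moreover have "\<exists>p :: 'a \<times> 'b. y = enc p" for y
    by (rule exI[of _ "(dec (fst (prod_decode y)), dec (snd (prod_decode y)))"])
       (simp add: enc_prod_def)
  ultimately show "bij (enc :: 'a \<times> 'b \<Rightarrow> nat)" by (auto simp: bij_def surj_def)
qed
end

instantiation list :: (coded) coded
begin
definition enc_list :: "'a list \<Rightarrow> nat" where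
  "enc_list xs = list_encode (map enc xs)"
instance
proof
  have "inj (enc :: 'a list \<Rightarrow> nat)"
    by (auto simp: inj_def enc_list_def list_encode_eq inj_map_eq_map[OF bij_is_inj[OF bij_enc]])
  moreover have "\<exists>p :: 'a list. y = enc p" for y
    by (rule exI[of _ "map dec (list_decode y)"]) (simp add: enc_list_def o_def)
  ultimately show "bij (enc :: 'a list \<Rightarrow> nat)" by (auto simp: bij_def surj_def)
qed
end

instantiation option :: (coded) coded
begin
definition enc_option :: "'a option \<Rightarrow> nat" where
  "enc_option x = case_option 0 (\<lambda>a. Suc (enc a)) x"
instance
proof
  have "inj (enc :: 'a option \<Rightarrow> nat)"
    by (auto simp: inj_def enc_option_def split: option.splits)
  moreover have "\<exists>p :: 'a option. y = enc p" for y
    by (rule exI[of _ "case y of 0 \<Rightarrow> None | Suc m \<Rightarrow> Some (dec m)"])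
       (simp add: enc_option_def split: nat.splits)
  ultimately show "bij (enc :: 'a option \<Rightarrow> nat)" by (auto simp: bij_def surj_def)
qed
end

instantiation letter :: coded
begin
definition enc_letter :: "letter \<Rightarrow> nat" where "enc_letter = letter_code"
instance
proof
  have "\<exists>a. y = letter_code a" for y
  proof (cases "even y")
    case True
    then show ?thesis by (intro exI[of _ "Gen (y div 2)"]) simp
  next
    case False
    then show ?thesis by (intro exI[of _ "GenInv (y div 2)"]) simp
  qed
  then show "bij (enc :: letter \<Rightarrow> nat)"
    using inj_letter_code by (auto simp: bij_def surj_def enc_letter_def)
qed
end

definition computable :: "('a::coded \<Rightarrow> 'b::coded) \<Rightarrow> bool" where
  "computable f \<longleftrightarrow> total_recursive (\<lambda>n. enc (f (dec n)))"

definition decidable :: "('a::coded \<Rightarrow> bool) \<Rightarrow> bool" where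
  "decidable P \<longleftrightarrow> computable (\<lambda>x. if P x then 1 else 0 :: nat)"

named_theorems computable_intros

text \<open>The rules below have the form of introduction rules for the body of a lambda abstraction, whose
  bound variable is the tuple of all variables in scope.  A computability proof is then a
  traversal of the term.\<close>

lemma computable_id [computable_intros]: "computable (\<lambda>x. x)"
  by (simp add: computable_def total_recursive_id)

lemma computable_const [computable_intros]: "computable (\<lambda>x. c)"
  by (simp add: computable_def total_recursive_const)

lemma computable_comp:
  assumes "computable f" "computable g"
  shows "computable (\<lambda>x. f (g x))"
  using total_recursive_comp[OF assms[unfolded computable_def]] by (simp add: computable_def)

lemma computable_Pair [computable_intros]:
  assumes "computable f" "computable g"
  shows "computable (\<lambda>x. (f x, g x))"
  using total_recursive_pair[OF assms[unfolded computable_def]]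
  by (simp add: computable_def enc_prod_def)

lemma prod_decode_dec: "prod_decode n = (enc (fst (dec n :: 'a::coded \<times> 'b::coded)), enc (snd (dec n :: 'a \<times> 'b)))"
proof -
  have "n = enc (dec n :: 'a \<times> 'b)" by simp
  then have "prod_decode n = prod_decode (enc (dec n :: 'a \<times> 'b))" by simp
  also have "\<dots> = (enc (fst (dec n :: 'a \<times> 'b)), enc (snd (dec n :: 'a \<times> 'b)))"
    unfolding enc_prod_def by simp
  finally show ?thesis .
qed

lemma computable_fst [computable_intros]:
  fixes f :: "'a::coded \<Rightarrow> 'b::coded \<times> 'c::coded"
  assumes "computable f"
  shows "computable (\<lambda>x. fst (f x))"
proof -
  have "computable (fst :: 'b \<times> 'c \<Rightarrow> 'b)"
    using total_recursive_fst by (simp add: computable_def prod_decode_dec[where 'a='b and 'b='c])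
  then show ?thesis by (rule computable_comp) fact
qed

lemma computable_snd [computable_intros]:
  fixes f :: "'a::coded \<Rightarrow> 'b::coded \<times> 'c::coded"
  assumes "computable f"
  shows "computable (\<lambda>x. snd (f x))"
proof -
  have "computable (snd :: 'b \<times> 'c \<Rightarrow> 'c)"
    using total_recursive_snd by (simp add: computable_def prod_decode_dec[where 'a='b and 'b='c])
  then show ?thesis by (rule computable_comp) fact
qed

lemma computable_enc [computable_intros]:
  assumes "computable f"
  shows "computable (\<lambda>x. enc (f x))"
  using assms by (simp add: computable_def)

lemma computable_dec [computable_intros]:
  assumes "computable f"
  shows "computable (\<lambda>x. dec (f x))"
  using assms by (simp add: computable_def)

lemma computable_Suc [computable_intros]:
  assumes "computable f"
  shows "computable (\<lambda>x. Suc (f x))"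
  using total_recursive_comp[OF total_recursive_Suc assms[unfolded computable_def]]
  by (simp add: computable_def)

lemma computable_rec_nat [computable_intros]:
  fixes f :: "'a::coded \<Rightarrow> 'b::coded"
  assumes f: "computable f"
    and g: "computable (\<lambda>p. g (fst p) (fst (snd p)) (snd (snd p)))"
    and m: "computable m"
  shows "computable (\<lambda>x. rec_nat (f x) (g x) (m x))"
proof -
  have enc_rec: "enc (rec_nat (f a) (g a) n) =
      rec_nat (enc (f a)) (\<lambda>m y. enc (g a m (dec y))) n" for a n
  proof (induction n)
    case (Suc n)
    show ?case by (simp flip: Suc)
  qed simp
  have dec_triple: "dec (prod_encode (x, prod_encode (m, y))) = (dec x :: 'a, m :: nat, dec y :: 'b)" for x m y
    using dec_enc[of "(dec x :: 'a, m, dec y :: 'b)"] by (simp add: enc_prod_def)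
  have "computable (\<lambda>p. rec_nat (f (fst p)) (g (fst p)) (snd p))"
    using total_recursive_prec[OF f[unfolded computable_def] g[unfolded computable_def]]
    by (simp add: computable_def enc_rec dec_triple prod_decode_dec[where 'a='a and 'b=nat])
  from computable_comp[OF this computable_Pair[OF computable_id m]] show ?thesis by simp
qed

lemma computable_case_nat [computable_intros]:
  assumes "computable f" "computable (\<lambda>p. g (fst p) (snd p))" "computable m"
  shows "computable (\<lambda>x. case m x of 0 \<Rightarrow> f x | Suc i \<Rightarrow> g x i)"
proof -
  have eq: "(case n of 0 \<Rightarrow> a | Suc i \<Rightarrow> h i) = rec_nat a (\<lambda>i r. h i) n" for n h and a :: 'd
    by (cases n) auto
  have "computable (\<lambda>p. g (fst p) (fst (snd p)))"
    using computable_comp[OF assms(2), of "\<lambda>p. (fst p, fst (snd p))"]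
    by (simp add: computable_intros)
  then show ?thesis unfolding eq using assms by (intro computable_rec_nat) simp_all
qed

lemma computable_case_option [computable_intros]:
  assumes "computable f" "computable (\<lambda>p. g (fst p) (snd p))" "computable m"
  shows "computable (\<lambda>x. case m x of None \<Rightarrow> f x | Some i \<Rightarrow> g x i)"
proof -
  have eq: "(case n of None \<Rightarrow> a | Some i \<Rightarrow> h i) = (case enc n of 0 \<Rightarrow> a | Suc j \<Rightarrow> h (dec j))"
    for n :: "'c option" and h and a :: 'b
    by (simp add: enc_option_def split: option.splits)
  have "computable (\<lambda>p. g (fst p) (dec (snd p)))"
    using computable_comp[OF assms(2), of "\<lambda>p. (fst p, dec (snd p))"]
    by (simp add: computable_intros)
  then show ?thesis unfolding eq using assms by (intro computable_intros)
qed

lemma computable_Some [computable_intros]: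
  assumes "computable f"
  shows "computable (\<lambda>x. Some (f x))"
  using computable_Suc[OF computable_enc[OF assms]] by (simp add: computable_def enc_option_def)

lemma enc_Cons: "enc (y # ys) = Suc (enc (y, ys))"
  by (simp add: enc_list_def enc_prod_def)

lemma computable_Cons [computable_intros]:
  assumes "computable f" "computable g"
  shows "computable (\<lambda>x. f x # g x)"
  using computable_Suc[OF computable_enc[OF computable_Pair[OF assms]]]
  by (simp add: computable_def enc_Cons)

text \<open>The number of a nonempty list is the successor of the number of its head and tail, so a case
  distinction on a list is one on a number.\<close>

lemma computable_case_list [computable_intros]:
  assumes "computable f" "computable (\<lambda>p. g (fst p) (fst (snd p)) (snd (snd p)))" "computable l"
  shows "computable (\<lambda>x. case l x of [] \<Rightarrow> f x | y # ys \<Rightarrow> g x y ys)"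
proof -
  have eq: "(case xs of [] \<Rightarrow> a | y # ys \<Rightarrow> h y ys) =
      (case enc xs of 0 \<Rightarrow> a | Suc j \<Rightarrow> h (fst (dec j :: 'c \<times> 'c list)) (snd (dec j :: 'c \<times> 'c list)))"
    for xs :: "'c list" and h and a :: 'b
    by (cases xs) (simp_all add: enc_Cons, simp add: enc_list_def)
  have "computable (\<lambda>p. g (fst p) (fst (dec (snd p) :: 'c \<times> 'c list)) (snd (dec (snd p) :: 'c \<times> 'c list)))"
    using computable_comp[OF assms(2), of "\<lambda>p. (fst p, dec (snd p))"]
    by (simp add: computable_intros)
  then show ?thesis unfolding eq using assms by (intro computable_intros)
qed

lemma length_le_enc: "length xs \<le> enc xs"
  by (induction xs) (auto simp: enc_Cons enc_prod_def intro: le_trans[OF _ le_prod_encode_2])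

text \<open>Lists are consumed by primitive recursion on the code of the list, which bounds its length.\<close>

lemma computable_foldl [computable_intros]:
  assumes h: "computable (\<lambda>p. h (fst p) (fst (snd p)) (snd (snd p)))"
    and a: "computable a" and l: "computable l"
  shows "computable (\<lambda>x. foldl (h x) (a x) (l x))"
proof -
  define step where "step x = (\<lambda>(_::nat) q. case fst q of [] \<Rightarrow> ([], snd q)
    | y # ys \<Rightarrow> (ys, h x (snd q) y))" for x
  have "snd (rec_nat (xs, b) (step x) m) = foldl (h x) b (take m xs) \<and>
      fst (rec_nat (xs, b) (step x) m) = drop m xs" for x xs b m
  proof (induction m)
    case (Suc m)
    show ?case
    proof (cases "m < length xs")
      case True
      then have "drop m xs = xs ! m # drop (Suc m) xs" by (simp add: Cons_nth_drop_Suc)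
      with True Suc show ?thesis by (simp add: step_def take_Suc_conv_app_nth)
    qed (use Suc in \<open>simp add: step_def\<close>)
  qed simp
  then have eq: "foldl (h x) b xs = snd (rec_nat (xs, b) (step x) (enc xs))" for x b xs
    using length_le_enc[of xs] by simp
  have h': "computable (\<lambda>p. h (f1 p) (f2 p) (f3 p))"
    if "computable f1" "computable f2" "computable f3" for f1 f2 f3
    using computable_comp[OF h, of "\<lambda>p. (f1 p, f2 p, f3 p)"] that by (simp add: computable_intros)
  show ?thesis
    unfolding eq step_def by (intro computable_intros h' a l)
qed


lemma computable_if [computable_intros]:
  assumes "decidable P" "computable f" "computable g"
  shows "computable (\<lambda>x. if P x then f x else g x)"
proof -
  have eq: "(if P x then f x else g x) = (case (if P x then 1 else 0) of 0 \<Rightarrow> g x | Suc (i::nat) \<Rightarrow> f x)" for x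
    by simp
  have "computable (\<lambda>p. f (fst p))"
    using computable_comp[OF assms(2)] computable_fst[OF computable_id] by blast
  then show ?thesis
    unfolding eq using assms unfolding decidable_def by (intro computable_case_nat)
qed

lemma computable_pred [computable_intros]:
  assumes "computable f"
  shows "computable (\<lambda>x. f x - Suc 0)"
proof -
  have "n - Suc 0 = (case n of 0 \<Rightarrow> 0 | Suc i \<Rightarrow> i)" for n by (cases n) auto
  then show ?thesis using assms by (simp only:) (intro computable_intros)
qed

lemma computable_plus [computable_intros]:
  fixes f g :: "'a::coded \<Rightarrow> nat"
  assumes "computable f" "computable g"
  shows "computable (\<lambda>x. f x + g x)"
proof -
  have "m + n = rec_nat m (\<lambda>_ r. Suc r) n" for m n :: nat by (induction n) auto
  then show ?thesis using assms by (simp only:) (intro computable_intros)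
qed

lemma computable_minus [computable_intros]:
  fixes f g :: "'a::coded \<Rightarrow> nat"
  assumes "computable f" "computable g"
  shows "computable (\<lambda>x. f x - g x)"
proof -
  have eq: "m - n = rec_nat m (\<lambda>_ r. r - Suc 0) n" for m n :: nat
  proof (induction n)
    case (Suc n)
    show ?case by (simp flip: Suc)
  qed simp
  have "f x - g x = rec_nat (f x) (\<lambda>_ r. r - Suc 0) (g x)" for x by (rule eq)
  then show ?thesis using assms by (simp only:) (intro computable_intros)
qed

lemma computable_times [computable_intros]:
  fixes f g :: "'a::coded \<Rightarrow> nat"
  assumes "computable f" "computable g"
  shows "computable (\<lambda>x. f x * g x)"
proof -
  have eq: "m * n = rec_nat 0 (\<lambda>_ r. r + m) n" for m n :: nat by (induction n) auto
  have "computable (\<lambda>p :: 'a \<times> nat \<times> nat. f (fst p))"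
    by (rule computable_comp[OF assms(1)]) (intro computable_intros)
  then show ?thesis unfolding eq using assms by (intro computable_intros)
qed

lemma computable_power [computable_intros]:
  fixes f g :: "'a::coded \<Rightarrow> nat"
  assumes "computable f" "computable g"
  shows "computable (\<lambda>x. f x ^ g x)"
proof -
  have eq: "m ^ n = rec_nat 1 (\<lambda>_ r. r * m) n" for m n :: nat by (induction n) auto
  have "computable (\<lambda>p :: 'a \<times> nat \<times> nat. f (fst p))"
    by (rule computable_comp[OF assms(1)]) (intro computable_intros)
  then show ?thesis unfolding eq using assms by (intro computable_intros)
qed

lemma decidable_const [computable_intros]: "decidable (\<lambda>x. c)"
  unfolding decidable_def by (rule computable_const)

lemma decidable_comp:
  assumes "decidable P" "computable f"
  shows "decidable (\<lambda>x. P (f x))"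
  using computable_comp[OF assms(1)[unfolded decidable_def] assms(2)] by (simp add: decidable_def)

lemma decidable_if:
  assumes "decidable P" "decidable Q" "decidable R"
  shows "decidable (\<lambda>x. if P x then Q x else R x)"
proof -
  have eq: "(if (if P x then Q x else R x) then 1 else 0) =
      (if P x then (if Q x then 1 else 0 :: nat) else (if R x then 1 else 0))" for x by simp
  show ?thesis
    unfolding decidable_def eq
    by (rule computable_if[OF assms(1) assms(2,3)[unfolded decidable_def]])
qed

lemma decidable_not [computable_intros]:
  assumes "decidable P" shows "decidable (\<lambda>x. \<not> P x)"
proof -
  have eq: "(\<not> P x) = (if P x then False else True)" for x by simp
  show ?thesis unfolding eq by (intro decidable_if assms decidable_const)
qed

lemma decidable_conj [computable_intros]:
  assumes "decidable P" "decidable Q" shows "decidable (\<lambda>x. P x \<and> Q x)"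
proof -
  have eq: "(P x \<and> Q x) = (if P x then Q x else False)" for x by simp
  show ?thesis unfolding eq by (intro decidable_if assms decidable_const)
qed

lemma decidable_disj [computable_intros]:
  assumes "decidable P" "decidable Q" shows "decidable (\<lambda>x. P x \<or> Q x)"
proof -
  have eq: "(P x \<or> Q x) = (if P x then True else Q x)" for x by simp
  show ?thesis unfolding eq by (intro decidable_if assms decidable_const)
qed

lemma decidable_imp [computable_intros]:
  assumes "decidable P" "decidable Q" shows "decidable (\<lambda>x. P x \<longrightarrow> Q x)"
proof -
  have eq: "(P x \<longrightarrow> Q x) = (if P x then Q x else True)" for x by simp
  show ?thesis unfolding eq by (intro decidable_if assms decidable_const)
qed

lemma decidable_iff [computable_intros]:
  assumes "decidable P" "decidable Q" shows "decidable (\<lambda>x. P x = Q x)"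
proof -
  have eq: "(P x = Q x) = (if P x then Q x else \<not> Q x)" for x by simp
  show ?thesis unfolding eq by (intro decidable_if assms decidable_not)
qed

lemma decidable_le [computable_intros]:
  fixes f g :: "'a::coded \<Rightarrow> nat"
  assumes "computable f" "computable g"
  shows "decidable (\<lambda>x. f x \<le> g x)"
proof -
  have eq: "(if f x \<le> g x then 1 else 0) = 1 - (f x - g x)" for x by simp
  show ?thesis unfolding decidable_def eq using assms by (intro computable_intros)
qed

lemma decidable_eq [computable_intros]:
  fixes f g :: "'a::coded \<Rightarrow> 'b::coded"
  assumes "computable f" "computable g"
  shows "decidable (\<lambda>x. f x = g x)"
proof -
  have "f x = g x \<longleftrightarrow> enc (f x) \<le> enc (g x) \<and> enc (g x) \<le> enc (f x)" for x
    by (metis enc_eq_iff order_antisym order_refl)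
  then have eq: "(\<lambda>x. f x = g x) = (\<lambda>x. enc (f x) \<le> enc (g x) \<and> enc (g x) \<le> enc (f x))" by blast
  show ?thesis unfolding eq using assms by (intro computable_intros)
qed

lemma computable_rev [computable_intros]:
  assumes "computable f"
  shows "computable (\<lambda>x. rev (f x))"
proof -
  have "rev xs = foldl (\<lambda>acc y. y # acc) [] xs" for xs :: "'b list"
    by (induction xs rule: rev_induct) auto
  then show ?thesis using assms by (simp only:) (intro computable_intros)
qed

lemma computable_append [computable_intros]:
  assumes "computable f" "computable g"
  shows "computable (\<lambda>x. f x @ g x)"
proof -
  have "xs @ zs = foldl (\<lambda>acc y. y # acc) zs (rev xs)" for xs zs :: "'b list"
    by (induction xs) auto
  then show ?thesis using assms by (simp only:) (intro computable_intros)
qed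

lemma computable_map [computable_intros]:
  assumes "computable (\<lambda>p. f (fst p) (snd p))" "computable l"
  shows "computable (\<lambda>x. map (f x) (l x))"
proof -
  have aux: "map h xs = foldl (\<lambda>acc y. acc @ [h y]) [] xs" for h :: "'b \<Rightarrow> 'c" and xs
    by (induction xs rule: rev_induct) auto
  have "computable (\<lambda>p. f (fst p) (snd (snd p)))"
    using computable_comp[OF assms(1), of "\<lambda>p. (fst p, snd (snd p))"] by (simp add: computable_intros)
  then show ?thesis unfolding aux using assms by (intro computable_intros)
qed

lemma computable_length [computable_intros]:
  assumes "computable f"
  shows "computable (\<lambda>x. length (f x))"
proof -
  have "length xs = foldl (\<lambda>a y. Suc a) 0 xs" for xs :: "'b list"
    by (induction xs rule: rev_induct) auto
  then show ?thesis using assms by (simp only:) (intro computable_intros)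
qed

lemma computable_concat [computable_intros]:
  assumes "computable f"
  shows "computable (\<lambda>x. concat (f x))"
proof -
  have "concat xs = foldl (\<lambda>a y. a @ y) [] xs" for xs :: "'b list list"
    by (induction xs rule: rev_induct) auto
  then show ?thesis using assms by (simp only:) (intro computable_intros)
qed

lemma computable_sum_list [computable_intros]:
  fixes f :: "'a::coded \<Rightarrow> nat list"
  assumes "computable f"
  shows "computable (\<lambda>x. sum_list (f x))"
proof -
  have "sum_list xs = foldl (\<lambda>a y. a + y) 0 xs" for xs :: "nat list"
    by (induction xs rule: rev_induct) auto
  then show ?thesis using assms by (simp only:) (intro computable_intros)
qed

lemma computable_drop [computable_intros]:
  assumes "computable n" "computable f"
  shows "computable (\<lambda>x. drop (n x) (f x))"
proof -
  have "drop m xs = rec_nat xs (\<lambda>_ r. case r of [] \<Rightarrow> [] | y # ys \<Rightarrow> ys) m" for m and xs :: "'b list"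
  proof (induction m)
    case (Suc m)
    have "drop (Suc m) xs = tl (drop m xs)" by (simp add: drop_Suc drop_tl)
    also have "\<dots> = (case drop m xs of [] \<Rightarrow> [] | y # ys \<Rightarrow> ys)" by (cases "drop m xs") auto
    finally show ?case by (simp add: Suc)
  qed simp
  then show ?thesis using assms by (simp only:) (intro computable_intros)
qed

lemma computable_take [computable_intros]:
  assumes "computable n" "computable f"
  shows "computable (\<lambda>x. take (n x) (f x))"
proof -
  have "take m xs = rev (drop (length xs - m) (rev xs))" for m and xs :: "'b list"
    by (cases "m \<le> length xs") (auto simp: rev_drop)
  then show ?thesis using assms by (simp only:) (intro computable_intros)
qed

lemma computable_upt [computable_intros]:
  assumes "computable f"
  shows "computable (\<lambda>x. [0..<f x])"
proof -
  have "[0..<m] = rec_nat [] (\<lambda>i r. r @ [i]) m" for m by (induction m) auto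
  then show ?thesis using assms by (simp only:) (intro computable_intros)
qed

lemma decidable_ball [computable_intros]:
  assumes "decidable (\<lambda>p. P (fst p) (snd p))" "computable l"
  shows "decidable (\<lambda>x. \<forall>y\<in>set (l x). P x y)"
proof -
  have eq: "(\<forall>y\<in>set xs. Q y) \<longleftrightarrow> foldl (\<lambda>a y. if Q y then a else 0) (1::nat) xs = 1"
    for Q :: "'b \<Rightarrow> bool" and xs
    by (induction xs rule: rev_induct) auto
  have "decidable (\<lambda>p. P (fst p) (snd (snd p)))"
    using decidable_comp[OF assms(1), of "\<lambda>p. (fst p, snd (snd p))"] by (simp add: computable_intros)
  then show ?thesis unfolding eq using assms by (intro computable_intros)
qed

lemma decidable_bex [computable_intros]:
  assumes "decidable (\<lambda>p. P (fst p) (snd p))" "computable l"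
  shows "decidable (\<lambda>x. \<exists>y\<in>set (l x). P x y)"
  using decidable_not[OF decidable_ball[OF decidable_not[OF assms(1)] assms(2)]] by simp

lemma decidable_ex_less [computable_intros]:
  fixes n :: "'a::coded \<Rightarrow> nat"
  assumes "decidable (\<lambda>p. P (fst p) (snd p))" "computable n"
  shows "decidable (\<lambda>x. \<exists>i<n x. P x i)"
  using decidable_bex[OF assms(1) computable_upt[OF assms(2)]] by (simp add: Bex_def)


section \<open>Semidecidable predicates and unbounded search\<close>

lemma mu_search_decidable:
  assumes "decidable (P :: nat \<times> nat \<Rightarrow> bool)"
  shows "partial_recursive (\<lambda>x. if \<exists>n. P (x, n) then Some (LEAST n. P (x, n)) else None)"
proof -
  define f where "f z = (if P (prod_decode z) then 0 else 1 :: nat)" for z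
  have "(\<lambda>n. enc (if \<not> P (dec n) then 1 else 0 :: nat)) = f"
    by (intro ext) (simp add: f_def prod_decode_dec[where 'a=nat and 'b=nat])
  then have "total_recursive f"
    using decidable_not[OF assms] unfolding decidable_def computable_def by simp
  then have "partial_recursive (\<lambda>x. mu_search (\<lambda>n. Some (f (prod_encode (x, n)))))"
    using partial_recursive.mu[of "\<lambda>z. Some (f z)"] by (simp add: total_recursive_def)
  moreover have "mu_search (\<lambda>n. Some (f (prod_encode (x, n)))) =
      (if \<exists>n. P (x, n) then Some (LEAST n. P (x, n)) else None)" for x
  proof -
    have f: "f (prod_encode (x, n)) = 0 \<longleftrightarrow> P (x, n)"
      "(\<exists>k>0. f (prod_encode (x, n)) = k) \<longleftrightarrow> \<not> P (x, n)" for n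
      by (auto simp: f_def)
    have 1: "(\<exists>n. P (x, n) \<and> (\<forall>m<n. \<not> P (x, m))) \<longleftrightarrow> (\<exists>n. P (x, n))"
      using LeastI_ex[of "\<lambda>n. P (x, n)"] not_less_Least[of _ "\<lambda>n. P (x, n)"] by blast
    show ?thesis
      unfolding mu_search_def option.inject f 1 ..
  qed
  ultimately show ?thesis by simp
qed

text \<open>A total function whose graph is decidable is found by unbounded search.\<close>

lemma computable_if_graph_decidable:
  assumes "decidable (\<lambda>p. snd p = f (fst p))"
  shows "computable f"
proof -
  have "decidable (\<lambda>p :: nat \<times> nat. dec (snd p) = f (dec (fst p)))"
    using decidable_comp[OF assms, of "\<lambda>p. (dec (fst p), dec (snd p))"] by (simp add: computable_intros)
  from mu_search_decidable[OF this]
  have "partial_recursive (\<lambda>x. if \<exists>n. dec n = f (dec x) then Some (LEAST n. dec n = f (dec x)) else None)"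
    by (simp only: fst_conv snd_conv)
  moreover have "\<exists>n. dec n = f (dec x)" "(LEAST n. dec n = f (dec x)) = enc (f (dec x))" for x
    by (rule exI[of _ "enc (f (dec x))"], simp) (rule Least_equality, simp, metis enc_dec order_refl)
  ultimately show ?thesis by (simp add: computable_def total_recursive_def)
qed

definition semidecidable :: "('a::coded \<Rightarrow> bool) \<Rightarrow> bool" where
  "semidecidable P \<longleftrightarrow> (\<exists>Q. decidable Q \<and> (\<forall>x. P x \<longleftrightarrow> (\<exists>n::nat. Q (x, n))))"

lemma semidecidable_if_decidable:
  assumes "decidable P" shows "semidecidable P"
  unfolding semidecidable_def
  by (rule exI[of _ "\<lambda>p. P (fst p)"]) (simp add: decidable_comp[OF assms] computable_intros)

lemma semidecidable_comp:
  assumes "semidecidable P" "computable f"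
  shows "semidecidable (\<lambda>x. P (f x))"
proof -
  obtain Q where Q: "decidable Q" "\<And>x. P x \<longleftrightarrow> (\<exists>n::nat. Q (x, n))"
    using assms(1) unfolding semidecidable_def by auto
  have "decidable (\<lambda>p. Q (f (fst p), snd p))"
    by (rule decidable_comp[OF Q(1)]) (intro computable_intros computable_comp[OF assms(2)])
  then show ?thesis
    unfolding semidecidable_def Q(2) by (intro exI[of _ "\<lambda>p. Q (f (fst p), snd p)"]) simp
qed

lemma semidecidable_ex:
  fixes P :: "'a::coded \<Rightarrow> 'b::coded \<Rightarrow> bool"
  assumes "semidecidable (\<lambda>p. P (fst p) (snd p))"
  shows "semidecidable (\<lambda>x. \<exists>y. P x y)"
proof -
  obtain Q where Q: "decidable Q" "\<And>x y. P x y \<longleftrightarrow> (\<exists>n::nat. Q ((x, y), n))"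
    using assms unfolding semidecidable_def by auto
  let ?Q = "\<lambda>p :: 'a \<times> nat. Q ((fst p, fst (dec (snd p) :: 'b \<times> nat)), snd (dec (snd p) :: 'b \<times> nat))"
  have "decidable ?Q" by (rule decidable_comp[OF Q(1)]) (intro computable_intros)
  moreover have "(\<exists>y. P x y) \<longleftrightarrow> (\<exists>m. ?Q (x, m))" for x
    unfolding Q(2) 
  proof (intro iffI; elim exE)
    fix y n assume "Q ((x, y), n)"
    then show "\<exists>m. ?Q (x, m)" by (intro exI[of _ "enc (y, n)"]) simp
  qed auto
  ultimately show ?thesis unfolding semidecidable_def by blast
qed

lemma semidecidable_conj:
  assumes "semidecidable P" "semidecidable Q"
  shows "semidecidable (\<lambda>x. P x \<and> Q x)"
proof -
  obtain P' Q' where 1: "decidable P'" "decidable Q'" "\<And>x. P x \<longleftrightarrow> (\<exists>n::nat. P' (x, n))"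
    "\<And>x. Q x \<longleftrightarrow> (\<exists>n::nat. Q' (x, n))"
    using assms unfolding semidecidable_def by metis
  have "semidecidable (\<lambda>x. \<exists>p :: nat \<times> nat. P' (x, fst p) \<and> Q' (x, snd p))"
    by (intro semidecidable_ex semidecidable_if_decidable decidable_conj decidable_comp[OF 1(1)]
        decidable_comp[OF 1(2)] computable_intros)
  then show ?thesis by (simp add: 1(3,4))
qed

text \<open>A bounded universal quantifier costs nothing: finitely many witnesses have a common bound.\<close>

lemma semidecidable_ball:
  assumes "semidecidable (\<lambda>p. P (fst p) (snd p))" "computable l"
  shows "semidecidable (\<lambda>x. \<forall>y\<in>set (l x). P x y)"
proof -
  obtain Q where Q: "decidable Q" "\<And>x y. P x y \<longleftrightarrow> (\<exists>n::nat. Q ((x, y), n))"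
    using assms unfolding semidecidable_def by auto
  let ?Q = "\<lambda>p. \<forall>y\<in>set (l (fst p)). \<exists>n<snd p. Q ((fst p, y), n)"
  have "decidable ?Q"
    by (intro computable_intros decidable_comp[OF Q(1)] computable_comp[OF assms(2)])
  moreover have "(\<forall>y\<in>set (l x). P x y) \<longleftrightarrow> (\<exists>m. ?Q (x, m))" for x
  proof
    assume *: "\<forall>y\<in>set (l x). P x y"
    then obtain h where h: "\<And>y. y \<in> set (l x) \<Longrightarrow> Q ((x, y), h y)" unfolding Q(2) by metis
    have "h y < Suc (Max (h ` set (l x)))" if "y \<in> set (l x)" for y
      using that by (simp add: less_Suc_eq_le)
    with h show "\<exists>m. ?Q (x, m)" by auto
  qed (auto simp: Q(2))
  ultimately show ?thesis unfolding semidecidable_def by blast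
qed

lemma semidecidable_imp:
  assumes "decidable P" "semidecidable Q"
  shows "semidecidable (\<lambda>x. P x \<longrightarrow> Q x)"
proof -
  obtain Q' where Q: "decidable Q'" "\<And>x. Q x \<longleftrightarrow> (\<exists>n::nat. Q' (x, n))"
    using assms(2) unfolding semidecidable_def by auto
  have "decidable (\<lambda>p. P (fst p) \<longrightarrow> Q' p)"
    using Q(1) by (intro computable_intros decidable_comp[OF assms(1)])
  then show ?thesis unfolding semidecidable_def Q(2) by (intro exI[of _ "\<lambda>p. P (fst p) \<longrightarrow> Q' p"]) auto
qed

text \<open>Searching for a pair of a solution and a proof of its correctness turns a semidecidable
  relation into a partial algorithm that finds a solution exactly where there is one.\<close>

lemma semidecidable_uniformization:
  fixes P :: "'a::coded \<Rightarrow> 'b::coded \<Rightarrow> bool" and h :: "'b \<Rightarrow> 'c::coded"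
  assumes "semidecidable (\<lambda>p. P (fst p) (snd p))" and h: "computable h"
  obtains alg where "partial_recursive alg"
    "\<forall>x y. P x y \<longrightarrow> (\<exists>y. P x y \<and> alg (enc x) = Some (enc (h y)))"
    "\<forall>x. (\<forall>y. \<not> P x y) \<longrightarrow> alg (enc x) = None"
proof -
  obtain Q where Q: "decidable Q" "\<And>x y. P x y \<longleftrightarrow> (\<exists>n::nat. Q ((x, y), n))"
    using assms unfolding semidecidable_def by auto
  define R where "R p = Q ((dec (fst p), fst (dec (snd p) :: 'b \<times> nat)), snd (dec (snd p) :: 'b \<times> nat))" for p
  have "decidable R"
    unfolding R_def by (rule decidable_comp[OF Q(1)]) (intro computable_intros)
  note search = mu_search_decidable[OF this]
  have "computable (\<lambda>n. h (fst (dec n :: 'b \<times> nat)))"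
    by (rule computable_comp[OF h]) (intro computable_intros)
  then have out: "partial_recursive (\<lambda>n. Some (enc (h (fst (dec n :: 'b \<times> nat)))))"
    unfolding computable_def total_recursive_def by simp
  define alg where "alg x = Option.bind (if \<exists>n. R (x, n) then Some (LEAST n. R (x, n)) else None)
    (\<lambda>n. Some (enc (h (fst (dec n :: 'b \<times> nat)))))" for x
  show ?thesis
  proof
    show "partial_recursive alg"
      using partial_recursive.comp[OF out search] by (simp only: alg_def[abs_def])
    show "\<forall>x y. P x y \<longrightarrow> (\<exists>y. P x y \<and> alg (enc x) = Some (enc (h y)))"
    proof (intro allI impI)
      fix x y assume "P x y"
      then obtain m where "Q ((x, y), m)" unfolding Q(2) by blast
      then have "R (enc x, enc (y, m))" by (simp add: R_def)
      then have ex: "\<exists>n. R (enc x, n)" by blast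
      then have "R (enc x, LEAST n. R (enc x, n))" by (rule LeastI_ex)
      then have "P x (fst (dec (LEAST n. R (enc x, n)) :: 'b \<times> nat))"
        by (auto simp: R_def Q(2))
      moreover have "alg (enc x) = Some (enc (h (fst (dec (LEAST n. R (enc x, n)) :: 'b \<times> nat))))"
        using ex by (simp add: alg_def)
      ultimately show "\<exists>y. P x y \<and> alg (enc x) = Some (enc (h y))" by blast
    qed
    show "\<forall>x. (\<forall>y. \<not> P x y) \<longrightarrow> alg (enc x) = None"
    proof (intro allI impI)
      fix x assume none: "\<forall>y. \<not> P x y"
      have "\<not> R (enc x, n)" for n using none unfolding R_def Q(2) fst_conv snd_conv dec_enc by blast
      then show "alg (enc x) = None" by (simp add: alg_def)
    qed
  qed
qed


section \<open>Runs of automata and finite index\<close>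

lemma run_append: "run M s (u @ v) = Option.bind (run M s u) (\<lambda>t. run M t v)"
  by (induction u arbitrary: s) (auto split: option.splits)

abbreviation state_after :: "'a fsa \<Rightarrow> 'a list \<Rightarrow> nat option" where
  "state_after M w \<equiv> run M (initial M) w"

lemma in_lang_iff: "w \<in> lang M \<longleftrightarrow> (\<exists>s\<in>set (final M). state_after M w = Some s)"
  by (simp add: lang_def)

text \<open>The state reached is an invariant of the prefix that determines which completions are accepted.\<close>

lemma lang_append_cong:
  assumes "state_after M x = state_after M y"
  shows "x @ z \<in> lang M \<longleftrightarrow> y @ z \<in> lang M"
  using assms by (simp add: in_lang_iff run_append)

text \<open>The possible outcomes of a run: the targets in the table, the starting state, and failure.\<close>

definition run_bound :: "'a fsa \<Rightarrow> nat" where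
  "run_bound M = length (table M) + 2"

lemma run_range: "run M s w \<in> insert None (Some ` insert s (snd ` set (table M)))"
proof (induction w arbitrary: s)
  case (Cons a w)
  show ?case
  proof (cases "map_of (table M) (s, a)")
    case (Some q)
    then have "q \<in> snd ` set (table M)" by (force dest: map_of_SomeD)
    with Cons.IH[of q] Some show ?thesis by auto
  qed simp
qed simp

lemma card_run_range: "card (insert None (Some ` insert s (snd ` set (table M)))) \<le> run_bound M"
proof -
  have "card (insert None (Some ` insert s (snd ` set (table M)))) \<le> Suc (card (Some ` insert s (snd ` set (table M))))"
    by (rule card_insert_le_m1) auto
  also have "\<dots> \<le> Suc (card (insert s (snd ` set (table M))))"
    using card_image_le[of "insert s (snd ` set (table M))" Some] by simp
  also have "\<dots> \<le> Suc (Suc (card (snd ` set (table M))))"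
    using card_insert_le_m1[of "Suc (card (snd ` set (table M)))" "snd ` set (table M)" s] by simp
  also have "\<dots> \<le> run_bound M"
    using card_image_le[of "set (table M)" snd] card_length[of "table M"]
    by (simp add: run_bound_def)
  finally show ?thesis .
qed

lemma run_letters:
  assumes "run M s w = Some t"
  shows "set w \<subseteq> (snd \<circ> fst) ` set (table M)"
  using assms
proof (induction w arbitrary: s)
  case (Cons a w)
  then obtain q where q: "map_of (table M) (s, a) = Some q" "run M q w = Some t"
    by (auto split: option.splits)
  from map_of_SomeD[OF q(1)] have "a \<in> (snd \<circ> fst) ` set (table M)" by force
  with Cons.IH[OF q(2)] show ?case by simp
qed simp

definition letters_in :: "'a fsa \<Rightarrow> 'a set \<Rightarrow> bool" where
  "letters_in M X \<longleftrightarrow> (\<forall>e\<in>set (table M). snd (fst e) \<in> X)"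

lemma lang_subset_lists:
  assumes "letters_in M X" shows "lang M \<subseteq> lists X"
  using assms run_letters unfolding in_lang_iff letters_in_def
  by (fastforce simp: in_lang_iff)

text \<open>One half of the Myhill--Nerode theorem, stated for an arbitrary invariant \<open>f\<close> of words
  that refines the residual classes.\<close>

lemma regular_if_finite_index:
  assumes X: "finite X" and K: "K \<subseteq> lists X" and fin: "finite (f ` lists X)"
    and f: "\<And>x y z. x \<in> lists X \<Longrightarrow> y \<in> lists X \<Longrightarrow> z \<in> lists X \<Longrightarrow> f x = f y \<Longrightarrow> x @ z \<in> K \<Longrightarrow> y @ z \<in> K"
  obtains M where "lang M = K" "letters_in M X"
proof -
  define r where "r x = {z \<in> lists X. x @ z \<in> K}" for x
  have r_f: "r x = r y" if "x \<in> lists X" "y \<in> lists X" "f x = f y" for x y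
    using f[of x y] f[of y x] that by (auto simp: r_def)
  have "r ` lists X \<subseteq> (\<lambda>q. r (SOME x. x \<in> lists X \<and> f x = q)) ` (f ` lists X)"
  proof (rule image_subsetI)
    fix x assume x: "x \<in> lists X"
    define y where "y = (SOME y. y \<in> lists X \<and> f y = f x)"
    have "y \<in> lists X \<and> f y = f x" unfolding y_def by (rule someI[of _ x]) (simp add: x)
    then have "r x = r y" using x by (intro r_f) auto
    then show "r x \<in> (\<lambda>q. r (SOME x. x \<in> lists X \<and> f x = q)) ` (f ` lists X)"
      using x unfolding y_def by blast
  qed
  then have fin_r: "finite (r ` lists X)" by (rule finite_subset) (simp add: fin)
  then obtain h :: "'a list set \<Rightarrow> nat" where h: "inj_on h (r ` lists X)"
    using finite_imp_inj_to_nat_seg by metis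
  define num where "num x = h (r x)" for x
  have num_eq: "num x = num y \<longleftrightarrow> r x = r y" if "x \<in> lists X" "y \<in> lists X" for x y
    unfolding num_def using inj_on_eq_iff[OF h] that by blast
  have r_snoc: "r (x @ [a]) = r (y @ [a])" if "r x = r y" "a \<in> X" for x y a
  proof -
    have "z \<in> r (x @ [a]) \<longleftrightarrow> a # z \<in> r x" for z x using that(2) by (auto simp: r_def)
    then show ?thesis using that(1) by auto
  qed
  define S where "S = (\<lambda>(x, a). ((num x, a), num (x @ [a]))) ` (lists X \<times> X)"
  have "num ` lists X = h ` r ` lists X" by (auto simp: num_def)
  then have fin_num: "finite (num ` lists X)" using fin_r by simp
  have S_cases: thesis
    if "e \<in> S" "\<And>x a. x \<in> lists X \<Longrightarrow> a \<in> X \<Longrightarrow> e = ((num x, a), num (x @ [a])) \<Longrightarrow> thesis" for e thesis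
    using that(1) unfolding S_def by (elim imageE SigmaE) (auto intro: that(2))
  have "S \<subseteq> (num ` lists X \<times> X) \<times> num ` lists X"
  proof
    fix e assume "e \<in> S"
    then show "e \<in> (num ` lists X \<times> X) \<times> num ` lists X"
    proof (rule S_cases)
      fix x a assume "x \<in> lists X" "a \<in> X" "e = ((num x, a), num (x @ [a]))"
      moreover have "x @ [a] \<in> lists X" by (simp add: calculation)
      ultimately show "e \<in> (num ` lists X \<times> X) \<times> num ` lists X"
        by (simp only: mem_Sigma_iff imageI simp_thms)
    qed
  qed
  then have "finite S" by (rule finite_subset) (use X fin_num in simp)
  then obtain t where t: "set t = S" "distinct t" using finite_distinct_list by blast
  have "inj_on fst S"
  proof (rule inj_onI)
    fix e e' assume "e \<in> S" "e' \<in> S" and eq: "fst e = fst e'"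
    from this(1) obtain x a where xa: "x \<in> lists X" "a \<in> X" "e = ((num x, a), num (x @ [a]))"
      by (rule S_cases)
    from \<open>e' \<in> S\<close> obtain y b where yb: "y \<in> lists X" "b \<in> X" "e' = ((num y, b), num (y @ [b]))"
      by (rule S_cases)
    have "r x = r y" "a = b" using eq xa yb num_eq[of x y] by auto
    with xa yb r_snoc[of x y a] show "e = e'" by (simp add: num_def)
  qed
  then have t_map: "distinct (map fst t)" using t by (simp add: distinct_map)
  obtain F where F: "set F = num ` K"
    using finite_list[OF finite_subset[OF image_mono[OF K] fin_num]] by blast
  define M where "M = \<lparr>initial = num [], final = F, table = t\<rparr>"
  have run: "run M (num x) z = Some (num (x @ z))" if "x \<in> lists X" "z \<in> lists X" for x z
    using that(2,1)
  proof (induction z arbitrary: x)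
    case (Cons a z)
    then have "(x, a) \<in> lists X \<times> X" by simp
    then have "((num x, a), num (x @ [a])) \<in> set t" unfolding t(1) S_def by (rule rev_image_eqI) simp
    then have "map_of (table M) (num x, a) = Some (num (x @ [a]))"
      using t_map by (simp add: M_def map_of_eq_Some_iff)
    then show ?case using Cons.IH[of "x @ [a]"] Cons.prems Cons.hyps by simp
  qed simp
  have letters: "letters_in M X" 
    unfolding letters_in_def M_def fsa.simps t(1) by (auto elim: S_cases)
  have "w \<in> lang M \<longleftrightarrow> w \<in> K" if w: "w \<in> lists X" for w
  proof -
    have "w \<in> lang M \<longleftrightarrow> num w \<in> num ` K"
      using run[of "[]" w] w F by (simp add: in_lang_iff M_def)
    also have "\<dots> \<longleftrightarrow> w \<in> K"
    proof
      assume "num w \<in> num ` K"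
      then obtain u where u: "u \<in> K" "num w = num u" by blast
      then have "r w = r u" using num_eq[of w u] K w by blast
      with u(1) have "u \<in> K" "r w = r u" by simp_all
      moreover have "[] \<in> r u \<longleftrightarrow> u \<in> K" "[] \<in> r w \<longleftrightarrow> w \<in> K" by (auto simp: r_def)
      ultimately show "w \<in> K" by simp
    qed simp
    finally show ?thesis .
  qed
  then have "lang M = K" using lang_subset_lists[OF letters] K by blast
  with letters that show ?thesis by blast
qed

text \<open>Pigeonhole: a shortest word with a given value of a right invariant passes through each value
  at most once.\<close>

lemma small_model:
  assumes inv: "\<And>x y a. x \<in> lists X \<Longrightarrow> y \<in> lists X \<Longrightarrow> a \<in> X \<Longrightarrow> f x = f y \<Longrightarrow> f (x @ [a]) = f (y @ [a])"
    and F: "\<And>x. x \<in> lists X \<Longrightarrow> f x \<in> F" "finite F" "card F \<le> T" and x: "x \<in> lists X"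
  obtains y where "y \<in> lists X" "length y \<le> T" "f y = f x"
proof -
  have inv': "f (x @ z) = f (y @ z)" if "z \<in> lists X" "x \<in> lists X" "y \<in> lists X" "f x = f y" for x y z
    using that(1)
  proof (induction z rule: rev_induct)
    case (snoc a z)
    then show ?case using inv[of "x @ z" "y @ z" a] that(2,3) by simp
  qed (simp add: that)
  define y where "y = arg_min length (\<lambda>y. y \<in> lists X \<and> f y = f x)"
  have y: "y \<in> lists X \<and> f y = f x"
    unfolding y_def by (rule arg_min_natI[of _ x]) (simp add: x)
  have min: "length y \<le> length u" if "u \<in> lists X" "f u = f x" for u
    unfolding y_def by (rule arg_min_nat_le) (simp add: that)
  have "length y \<le> T"
  proof (rule ccontr)
    assume "\<not> length y \<le> T"
    have take: "take i y \<in> lists X" "drop i y \<in> lists X" for i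
      using y set_take_subset[of i y] set_drop_subset[of i y] by (auto simp: in_lists_conv_set)
    have "(\<lambda>i. f (take i y)) ` {..length y} \<subseteq> F" using F(1) take by blast
    then have "card ((\<lambda>i. f (take i y)) ` {..length y}) \<le> card F" by (intro card_mono F(2))
    also have "\<dots> < card {..length y}" using F(3) \<open>\<not> length y \<le> T\<close> by simp
    finally have "\<not> inj_on (\<lambda>i. f (take i y)) {..length y}" by (metis card_image nat_neq_iff)
    then obtain i j where "i \<le> length y" "j \<le> length y" "i \<noteq> j" "f (take i y) = f (take j y)"
      by (auto simp: inj_on_def)
    then obtain i j where ij: "i < j" "j \<le> length y" "f (take i y) = f (take j y)"
      by (metis linorder_neqE_nat)
    then have "f (take i y @ drop j y) = f (take j y @ drop j y)" using take by (intro inv') auto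
    then have "length y \<le> length (take i y @ drop j y)" using y take by (intro min) auto
    then show False using ij by simp
  qed
  with y that show ?thesis by blast
qed

lemma run_small_model:
  assumes "run M s w = Some q"
  obtains v where "set v \<subseteq> set w" "length v \<le> run_bound M" "run M s v = Some q"
proof -
  show ?thesis
  proof (rule small_model[where f="run M s" and X="set w" and x=w and T="run_bound M"
        and F="insert None (Some ` insert s (snd ` set (table M)))"])
    fix v assume "v \<in> lists (set w)" "length v \<le> run_bound M" "run M s v = run M s w"
    with assms that show thesis by (auto simp: in_lists_conv_set)
  qed (rule run_range card_run_range | simp add: run_append in_lists_conv_set)+
qed

text \<open>So a property that depends only on the value of such an invariant holds for all words if it holds
  for the words of length at most the number of values.\<close>

lemma all_short_words_suffice:
  assumes "\<And>x y a. x \<in> lists X \<Longrightarrow> y \<in> lists X \<Longrightarrow> a \<in> X \<Longrightarrow> f x = f y \<Longrightarrow> f (x @ [a]) = f (y @ [a])"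
    and "\<And>x. x \<in> lists X \<Longrightarrow> f x \<in> F" "finite F" "card F \<le> T"
    and P: "\<And>x y. x \<in> lists X \<Longrightarrow> y \<in> lists X \<Longrightarrow> f x = f y \<Longrightarrow> P x \<Longrightarrow> P y"
    and short: "\<And>x. x \<in> lists X \<Longrightarrow> length x \<le> T \<Longrightarrow> P x"
    and x: "x \<in> lists X"
  shows "P x"
proof -
  show ?thesis
  proof (rule small_model[where f=f and X=X and F=F and T=T and x=x])
    fix y assume "y \<in> lists X" "length y \<le> T" "f y = f x"
    then show "P x" using P[of y x] short[of y] x by simp
  qed (rule assms; assumption?)+
qed


section \<open>Padded pairs of words\<close>

text \<open>Padding a pair means reading both words position by position, beyond the end of the shorter one.
  This form of \<^const>\<open>pad\<close> has no simultaneous recursion on two lists.\<close>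

definition nth_opt :: "'a list \<Rightarrow> nat \<Rightarrow> 'a option" where
  "nth_opt xs i = (case drop i xs of [] \<Rightarrow> None | y # ys \<Rightarrow> Some y)"

lemma nth_opt_eq: "nth_opt xs i = (if i < length xs then Some (xs ! i) else None)"
  by (auto simp: nth_opt_def hd_drop_conv_nth[symmetric] split: list.split)

lemma pad_conv_map: "pad w u = map (\<lambda>i. (nth_opt w i, nth_opt u i)) [0..<max (length w) (length u)]"
proof (induction w u rule: pad.induct)
  case (2 a w)
  then show ?case
    by (simp add: upt_conv_Cons map_Suc_upt[symmetric] o_def nth_opt_def del: upt_Suc)
next
  case (3 b u)
  then show ?case
    by (simp add: upt_conv_Cons map_Suc_upt[symmetric] o_def nth_opt_def del: upt_Suc)
next
  case (4 a w b u)
  then show ?case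
    by (simp add: upt_conv_Cons map_Suc_upt[symmetric] o_def nth_opt_def del: upt_Suc)
qed simp

lemma length_pad [simp]: "length (pad w u) = max (length w) (length u)"
  by (simp add: pad_conv_map)

lemma nth_pad: "i < max (length w) (length u) \<Longrightarrow> pad w u ! i = (nth_opt w i, nth_opt u i)"
  by (simp add: pad_conv_map)

lemma take_pad: "take i (pad w u) = pad (take i w) (take i u)"
  by (rule nth_equalityI) (auto simp: nth_pad nth_opt_eq)

definition tape1 :: "'a padded list \<Rightarrow> 'a list" where
  "tape1 z = concat (map (\<lambda>p. case fst p of None \<Rightarrow> [] | Some a \<Rightarrow> [a]) z)"

definition tape2 :: "'a padded list \<Rightarrow> 'a list" where
  "tape2 z = concat (map (\<lambda>p. case snd p of None \<Rightarrow> [] | Some a \<Rightarrow> [a]) z)"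

lemma tape1_pad [simp]: "tape1 (pad w u) = w"
  by (induction w u rule: pad.induct) (auto simp: tape1_def)

lemma tape2_pad [simp]: "tape2 (pad w u) = u"
  by (induction w u rule: pad.induct) (auto simp: tape2_def)

lemma tape_append [simp]: "tape1 (x @ y) = tape1 x @ tape1 y" "tape2 (x @ y) = tape2 x @ tape2 y"
  by (auto simp: tape1_def tape2_def)

lemma tape_Nil [simp]: "tape1 [] = []" "tape2 [] = []"
  by (auto simp: tape1_def tape2_def)

lemma tape_singleton: "tape1 [p] = (case fst p of None \<Rightarrow> [] | Some a \<Rightarrow> [a])"
  "tape2 [p] = (case snd p of None \<Rightarrow> [] | Some a \<Rightarrow> [a])"
  by (auto simp: tape1_def tape2_def)

lemma pad_eq_iff [simp]: "pad w u = pad w' u' \<longleftrightarrow> w = w' \<and> u = u'"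
  by (metis tape1_pad tape2_pad)

definition valid :: "'a padded list \<Rightarrow> bool" where
  "valid z \<longleftrightarrow> pad (tape1 z) (tape2 z) = z"

lemma valid_pad [simp]: "valid (pad w u)"
  by (simp add: valid_def)

lemma None_in_fst_pad: "None \<in> fst ` set (pad w u) \<longleftrightarrow> length w < length u"
  by (induction w u rule: pad.induct) auto

lemma None_in_snd_pad: "None \<in> snd ` set (pad w u) \<longleftrightarrow> length u < length w"
  by (induction w u rule: pad.induct) auto

lemma pad_snoc:
  assumes "p \<noteq> (None, None)"
    and "fst p \<noteq> None \<Longrightarrow> length u \<le> length w" "snd p \<noteq> None \<Longrightarrow> length w \<le> length u"
  shows "pad w u @ [p] = pad (w @ tape1 [p]) (u @ tape2 [p])"
proof -
  obtain x y where p: "p = (x, y)" by (cases p)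
  show ?thesis
    using assms unfolding p
    by (induction w u rule: pad.induct) (cases x; cases y; simp add: tape_singleton)+
qed

text \<open>Validity of a padded string can be checked while reading it, remembering only which of the
  two tapes have ended.\<close>

lemma valid_snoc:
  "valid (z @ [p]) \<longleftrightarrow> valid z \<and> p \<noteq> (None, None) \<and>
     (fst p \<noteq> None \<longrightarrow> None \<notin> fst ` set z) \<and> (snd p \<noteq> None \<longrightarrow> None \<notin> snd ` set z)"
proof
  assume v: "valid (z @ [p])"
  define w u where "w = tape1 (z @ [p])" and "u = tape2 (z @ [p])"
  have eq: "z @ [p] = pad w u" using v by (simp add: valid_def w_def u_def)
  have len: "Suc (length z) = max (length w) (length u)" using arg_cong[OF eq, of length] by simp
  have z: "z = pad (take (length z) w) (take (length z) u)"
    using arg_cong[OF eq, of "take (length z)"] by (simp add: take_pad)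
  have p: "p = (nth_opt w (length z), nth_opt u (length z))"
    using arg_cong[OF eq, of "\<lambda>l. l ! length z"] len by (simp add: nth_pad)
  have "valid z" using z valid_pad by metis
  moreover have "None \<notin> fst ` set z" if "fst p \<noteq> None"
    using that p None_in_fst_pad[of "take (length z) w" "take (length z) u"] len
    by (subst z) (auto simp: nth_opt_eq split: if_splits)
  moreover have "None \<notin> snd ` set z" if "snd p \<noteq> None"
    using that p None_in_snd_pad[of "take (length z) w" "take (length z) u"] len
    by (subst z) (auto simp: nth_opt_eq split: if_splits)
  moreover have "p \<noteq> (None, None)" using p len by (auto simp: nth_opt_eq split: if_splits)
  ultimately show "valid z \<and> p \<noteq> (None, None) \<and>
     (fst p \<noteq> None \<longrightarrow> None \<notin> fst ` set z) \<and> (snd p \<noteq> None \<longrightarrow> None \<notin> snd ` set z)" by blast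
next
  assume *: "valid z \<and> p \<noteq> (None, None) \<and>
     (fst p \<noteq> None \<longrightarrow> None \<notin> fst ` set z) \<and> (snd p \<noteq> None \<longrightarrow> None \<notin> snd ` set z)"
  then have z: "pad (tape1 z) (tape2 z) = z" by (simp add: valid_def)
  show "valid (z @ [p])"
    using pad_snoc[of p "tape2 z" "tape1 z"] * None_in_fst_pad[of "tape1 z" "tape2 z"]
      None_in_snd_pad[of "tape1 z" "tape2 z"]
    unfolding valid_def z by fastforce
qed

definition diagonal :: "'a padded list \<Rightarrow> bool" where
  "diagonal z \<longleftrightarrow> (\<forall>p\<in>set z. fst p = snd p)"

lemma diagonal_pad: "diagonal (pad w u) \<longleftrightarrow> w = u"
  by (induction w u rule: pad.induct) (auto simp: diagonal_def)

definition padded_alphabet :: "'a set \<Rightarrow> 'a padded set" where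
  "padded_alphabet A = insert None (Some ` A) \<times> insert None (Some ` A)"

lemma finite_padded_alphabet [simp]: "finite A \<Longrightarrow> finite (padded_alphabet A)"
  by (simp add: padded_alphabet_def)

lemma pad_in_lists_iff: "pad w u \<in> lists (padded_alphabet A) \<longleftrightarrow> w \<in> lists A \<and> u \<in> lists A"
  by (induction w u rule: pad.induct) (auto simp: padded_alphabet_def)

lemma tape_in_lists:
  assumes "z \<in> lists (padded_alphabet A)" shows "tape1 z \<in> lists A" "tape2 z \<in> lists A"
  using assms by (auto simp: tape1_def tape2_def padded_alphabet_def in_lists_conv_set
      split: option.splits)

lemma map_fst_pad_take: "map fst (take (length w) (pad w u)) = map Some w"
  by (rule nth_equalityI) (auto simp: nth_pad nth_opt_eq)

lemma fst_drop_pad: "p \<in> set (drop (length w) (pad w u)) \<Longrightarrow> fst p = None"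
  by (auto simp: pad_conv_map nth_opt_eq drop_map)


section \<open>Words of a presented group and fellow travelling\<close>

primrec all_words :: "'a list \<Rightarrow> nat \<Rightarrow> 'a list list" where
  "all_words xs 0 = [[]]"
| "all_words xs (Suc t) = [] # concat (map (\<lambda>a. map (\<lambda>w. a # w) (all_words xs t)) xs)"

lemma set_all_words: "set (all_words xs t) = {w \<in> lists (set xs). length w \<le> t}"
proof (induction t)
  case (Suc t)
  have "w \<in> set (all_words xs (Suc t)) \<longleftrightarrow> w \<in> lists (set xs) \<and> length w \<le> Suc t" for w
    using Suc by (cases w) (auto simp: image_iff)
  then show ?case by blast
qed auto

definition letters :: "nat \<Rightarrow> letter list" where
  "letters n = map Gen [0..<n] @ map GenInv [0..<n]"

lemma set_letters [simp]: "set (letters n) = alphabet n"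
  by (auto simp: letters_def alphabet_def)

lemma finite_alphabet [simp]: "finite (alphabet n)"
  by (simp add: alphabet_def)

definition winv :: "word \<Rightarrow> word" where
  "winv w = rev (map inv_letter w)"

lemma length_winv [simp]: "length (winv w) = length w"
  by (simp add: winv_def)

locale presentation =
  fixes n :: nat and rs :: "word list"
  assumes relators: "set rs \<subseteq> lists (alphabet n)"
begin

abbreviation "A \<equiv> alphabet n"
abbreviation "G \<equiv> presented_group n (set rs)"
abbreviation "cl \<equiv> word_class n (set rs)"

sublocale G: group G
  by (rule group_presented_group[OF relators])

lemma winv_in [simp]: "winv w \<in> lists A \<longleftrightarrow> w \<in> lists A"
  by (auto simp: winv_def in_lists_conv_set)

lemma take_in [simp]: "w \<in> lists A \<Longrightarrow> take t w \<in> lists A"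
  by (auto simp: in_lists_conv_set dest: in_set_takeD)

lemma cl_in [simp]: "w \<in> lists A \<Longrightarrow> cl w \<in> carrier G"
  by (simp add: carrier_presented_group)

lemma cl_append: "u \<in> lists A \<Longrightarrow> v \<in> lists A \<Longrightarrow> cl (u @ v) = cl u \<otimes>\<^bsub>G\<^esub> cl v"
  by (simp add: mult_presented_group[OF relators])

lemma cl_Nil: "cl [] = \<one>\<^bsub>G\<^esub>"
  by (simp add: one_presented_group)

lemma cl_winv: "w \<in> lists A \<Longrightarrow> cl (winv w) = inv\<^bsub>G\<^esub> (cl w)"
proof -
  assume w: "w \<in> lists A"
  have "cl (winv w @ w) = cl []"
    using word_cong_inverse[OF w, of "set rs"] w
    by (subst word_class_eq_iff[OF relators]) (auto simp flip: winv_def)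
  then show ?thesis using w by (intro G.inv_equality[symmetric]) (simp_all add: cl_append cl_Nil)
qed

lemma cl_eq_iff: "u \<in> lists A \<Longrightarrow> v \<in> lists A \<Longrightarrow> cl u = cl v \<longleftrightarrow> (u, v) \<in> word_cong n (set rs)"
  by (rule word_class_eq_iff[OF relators])

definition near :: "nat \<Rightarrow> word \<Rightarrow> word \<Rightarrow> bool" where
  "near k x y \<longleftrightarrow> (\<exists>e\<in>lists A. length e \<le> k \<and> cl (x @ e) = cl y)"

lemma near_iff:
  assumes "x \<in> lists A" "y \<in> lists A"
  shows "near k x y \<longleftrightarrow> (\<exists>e\<in>lists A. length e \<le> k \<and> cl e = cl (winv x @ y))"
  unfolding near_def using assms
  by (intro bex_cong refl conj_cong)
     (auto simp: cl_append cl_winv G.inv_solve_left)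

lemma near_mono: "near k x y \<Longrightarrow> k \<le> l \<Longrightarrow> near l x y"
  unfolding near_def by force

lemma near_trans:
  assumes "near k x y" "near l y z" "x \<in> lists A" "y \<in> lists A"
  shows "near (k + l) x z"
proof -
  obtain e where e: "e \<in> lists A" "length e \<le> k" "cl (x @ e) = cl y"
    using assms by (auto simp: near_def)
  obtain d where d: "d \<in> lists A" "length d \<le> l" "cl (y @ d) = cl z"
    using assms by (auto simp: near_def)
  have "cl y = cl x \<otimes>\<^bsub>G\<^esub> cl e" using e assms by (simp add: cl_append)
  then have "cl (x @ e @ d) = cl z" using d e assms by (simp add: cl_append G.m_assoc)
  then show ?thesis unfolding near_def using e d by (intro bexI[of _ "e @ d"]) auto
qed

definition fellow :: "nat \<Rightarrow> word \<Rightarrow> word \<Rightarrow> bool" where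
  "fellow k w u \<longleftrightarrow> (\<forall>t. near k (take t w) (take t u))"

lemma fellow_mono: "fellow k w u \<Longrightarrow> k \<le> l \<Longrightarrow> fellow l w u"
  unfolding fellow_def using near_mono by blast

lemma fellow_trans:
  "fellow k w u \<Longrightarrow> fellow l u v \<Longrightarrow> w \<in> lists A \<Longrightarrow> u \<in> lists A \<Longrightarrow> fellow (k + l) w v"
  unfolding fellow_def using near_trans take_in by blast

text \<open>Words with a common prefix are connected through the end of that prefix.\<close>

lemma fellow_common_prefix:
  assumes "x \<in> lists A" "c \<in> lists A" "d \<in> lists A"
  shows "fellow (length c + length d) (x @ c) (x @ d)"
  unfolding fellow_def
proof
  fix t
  let ?c = "take (t - length x) c" and ?d = "take (t - length x) d"
  have "cl ((take t x @ ?c) @ (winv ?c @ ?d)) = cl (take t x @ ?d)"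
    using assms by (simp add: cl_append cl_winv G.m_assoc[symmetric])
  then show "near (length c + length d) (take t (x @ c)) (take t (x @ d))"
    unfolding near_def take_append using assms by (intro bexI[of _ "winv ?c @ ?d"]) auto
qed


section \<open>Local conditions that force unique representatives\<close>

text \<open>These two conditions speak only about words that stay near each other, so that both can be checked
  by a finite automaton.\<close>

definition neighbours_within :: "nat \<Rightarrow> word set \<Rightarrow> bool" where
  "neighbours_within k L \<longleftrightarrow> (\<forall>w\<in>L. \<forall>a\<in>A. \<exists>u\<in>L. cl (w @ [a]) = cl u \<and> fellow k w u)"

definition unique_within :: "nat \<Rightarrow> word set \<Rightarrow> bool" where
  "unique_within r L \<longleftrightarrow> (\<forall>w\<in>L. \<forall>u\<in>L. cl w = cl u \<longrightarrow> fellow r w u \<longrightarrow> w = u)"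

context
  fixes L :: "word set" and k r N :: nat
  assumes L: "L \<subseteq> lists A" "L \<noteq> {}"
    and total: "neighbours_within k L" and uniq: "unique_within r L"
    and completion: "\<And>x y. x @ y \<in> L \<Longrightarrow> \<exists>c. length c \<le> N \<and> x @ c \<in> L"
    and r: "2 * k \<le> r" "\<And>q. q \<in> set rs \<Longrightarrow> k * length q \<le> r" "(2 * N + 1) * (k + 1) \<le> r"
begin

definition move :: "word \<Rightarrow> letter \<Rightarrow> word" where
  "move w a = (SOME u. u \<in> L \<and> cl (w @ [a]) = cl u \<and> fellow k w u)"

lemma move: "w \<in> L \<Longrightarrow> a \<in> A \<Longrightarrow> move w a \<in> L \<and> cl (w @ [a]) = cl (move w a) \<and> fellow k w (move w a)"
  unfolding move_def by (rule someI_ex) (use total in \<open>unfold neighbours_within_def, blast\<close>)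

lemma in_lists: "w \<in> L \<Longrightarrow> w \<in> lists A"
  using L by blast

text \<open>A product of \<open>m\<close> letters moves a word by at most \<open>k\<close> times \<open>m\<close>, since the distances add up.\<close>

lemma moves:
  assumes "w \<in> L" "e \<in> lists A"
  shows "foldl move w e \<in> L \<and> cl (w @ e) = cl (foldl move w e) \<and> fellow (k * length e) w (foldl move w e)"
  using assms(2)
proof (induction e rule: rev_induct)
  case Nil
  have "fellow 0 w w" using fellow_common_prefix[of w "[]" "[]"] in_lists[OF assms(1)] by simp
  then show ?case using assms by simp
next
  case (snoc a e)
  define v where "v = foldl move w e"
  have e: "e \<in> lists A" "a \<in> A" using snoc.prems by auto
  have v: "v \<in> L" "cl (w @ e) = cl v" "fellow (k * length e) w v"
    using snoc.IH e by (auto simp: v_def)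
  note m = move[OF v(1) e(2)]
  have "cl (w @ e @ [a]) = cl (w @ e) \<otimes>\<^bsub>G\<^esub> cl [a]"
    using e in_lists[OF assms(1)] by (simp add: cl_append G.m_assoc)
  also have "\<dots> = cl (move v a)" using m e in_lists[OF v(1)] v(2) by (simp add: cl_append)
  finally have "cl (w @ e @ [a]) = cl (move v a)" .
  moreover have "fellow (k * length (e @ [a])) w (move v a)"
    using fellow_trans[OF v(3), of k "move v a"] m in_lists[OF assms(1)] in_lists[OF v(1)] by (simp add: add.commute)
  ultimately show ?case using m by (simp add: v_def)
qed

lemma unique: "w \<in> L \<Longrightarrow> u \<in> L \<Longrightarrow> cl w = cl u \<Longrightarrow> fellow r w u \<Longrightarrow> w = u"
  using uniq by (auto simp: unique_within_def)

lemma moves_trivial: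
  assumes w: "w \<in> L" and e: "e \<in> lists A" "cl (w @ e) = cl w" "k * length e \<le> r"
  shows "foldl move w e = w"
  using moves[OF w e(1)] w e by (intro unique[symmetric]) (auto intro: fellow_mono)

text \<open>The moves define an action of the group on \<open>L\<close>, since by local uniqueness each defining
  relation moves every word along a short detour back to itself.\<close>

lemma moves_cong:
  assumes "(e, e') \<in> word_cong n (set rs)" "w \<in> L"
  shows "foldl move w e = foldl move w e'"
  using assms
proof (induction arbitrary: w)
  case (cancel u v a)
  define x where "x = foldl move w u"
  have x: "x \<in> L" using moves[OF cancel(4,1)] by (simp add: x_def)
  have "(x @ [a, inv_letter a] @ [], x @ []) \<in> word_cong n (set rs)"
    by (rule word_cong.cancel) (use in_lists[OF x] cancel in auto)
  then have "cl (x @ [a, inv_letter a]) = cl x" using in_lists[OF x] cancel by (simp add: cl_eq_iff)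
  then have "foldl move x [a, inv_letter a] = x"
    by (intro moves_trivial x) (use cancel r in auto)
  then show ?case by (simp add: x_def)
next
  case (relator u v q)
  define x where "x = foldl move w u"
  have x: "x \<in> L" using moves[OF relator(4,1)] by (simp add: x_def)
  have "(x @ q @ [], x @ []) \<in> word_cong n (set rs)"
    by (rule word_cong.relator) (use in_lists[OF x] relator in auto)
  moreover have q: "q \<in> lists A" using relators relator by blast
  ultimately have "cl (x @ q) = cl x" using in_lists[OF x] by (simp add: cl_eq_iff)
  then have "foldl move x q = x"
    by (intro moves_trivial x q) (use relator r in auto)
  then show ?case by (simp add: x_def)
qed auto

text \<open>The action is transitive: a word of \<open>L\<close> is reached from a short one \<open>c0\<close> letter by letter,
  because completing two successive prefixes gives words that fellow travel.\<close>

lemma moves_reach: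
  assumes c0: "c0 \<in> L"
  assumes "length c0 \<le> N" "x @ c \<in> L" "length c \<le> N"
  shows "foldl move c0 (winv c0 @ x @ c) = x @ c"
  using assms(3,4)
proof (induction x arbitrary: c rule: rev_induct)
  case Nil
  have c: "c \<in> L" "c \<in> lists A" "c0 \<in> lists A" using Nil in_lists c0 by auto
  define v where "v = foldl move c0 (winv c0 @ c)"
  have v: "v \<in> L" "cl (c0 @ winv c0 @ c) = cl v" "fellow (k * length (winv c0 @ c)) c0 v"
    using moves[OF c0, of "winv c0 @ c"] c by (auto simp: v_def)
  have "k * length (winv c0 @ c) \<le> k * (2 * N)"
    by (rule mult_le_mono2) (use Nil assms(2) in simp)
  then have "length c0 + length c + k * length (winv c0 @ c) \<le> 2 * N + k * (2 * N)"
    using Nil assms(2) by linarith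
  also have "\<dots> \<le> r" using r(3) by (simp add: algebra_simps)
  finally have bound: "length c0 + length c + k * length (winv c0 @ c) \<le> r" .
  have "fellow (length c0 + length c) c c0"
    using fellow_common_prefix[of "[]" c c0] c by (simp add: add.commute)
  from fellow_trans[OF this v(3) c(2,3)] have "fellow r c v" using bound by (rule fellow_mono)
  moreover have "cl c = cl v" using v(2) c by (simp add: cl_append cl_winv G.m_assoc[symmetric])
  ultimately have "c = v" by (intro unique c v)
  then show ?case by (simp add: v_def)
next
  case (snoc a x)
  have ac: "a # c \<in> lists A" "x \<in> lists A" "c0 \<in> lists A"
    using in_lists[OF snoc.prems(1)] in_lists[OF c0] by auto
  obtain d where d: "length d \<le> N" "x @ d \<in> L" using completion[of x "a # c"] snoc.prems by auto
  then have dA: "d \<in> lists A" using in_lists[of "x @ d"] by simp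
  have IH: "foldl move c0 (winv c0 @ x @ d) = x @ d" by (rule snoc.IH) (use d in auto)
  define e where "e = winv d @ a # c"
  have e: "e \<in> lists A" "length e = length d + Suc (length c)" using ac dA by (auto simp: e_def)
  define v where "v = foldl move (x @ d) e"
  have v: "v \<in> L" "cl ((x @ d) @ e) = cl v" "fellow (k * length e) (x @ d) v"
    using moves[OF d(2) e(1)] by (auto simp: v_def)
  have "cl (((winv c0 @ x) @ d) @ e) = cl ((winv c0 @ x) @ a # c)"
    using ac dA unfolding e_def
    by (simp add: cl_append cl_winv G.m_assoc) (simp add: G.m_assoc[symmetric])
  then have "((winv c0 @ x @ d) @ e, winv c0 @ x @ a # c) \<in> word_cong n (set rs)"
    using ac dA e by (simp add: cl_eq_iff)
  from moves_cong[OF this c0] have eq: "foldl move c0 (winv c0 @ x @ a # c) = v"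
    using IH by (simp add: v_def)
  have "k * length e \<le> k * (2 * N + 1)"
    by (rule mult_le_mono2) (use snoc.prems d e in simp)
  moreover have "length (a # c) + length d \<le> 2 * N + 1" using snoc.prems d by simp
  ultimately have "length (a # c) + length d + k * length e \<le> (2 * N + 1) + k * (2 * N + 1)"
    by linarith
  also have "\<dots> \<le> r" using r(3) by (simp add: algebra_simps)
  finally have bound: "length (a # c) + length d + k * length e \<le> r" .
  have "fellow (length (a # c) + length d) (x @ a # c) (x @ d)"
    by (rule fellow_common_prefix) (use ac dA in auto)
  from fellow_trans[OF this v(3)] have "fellow r (x @ a # c) v"
    using bound ac dA by (auto intro: fellow_mono)
  moreover have "cl (x @ a # c) = cl v"
    using v(2) ac dA unfolding e_def
    by (simp add: cl_append cl_winv G.m_assoc) (simp add: G.m_assoc[symmetric])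
  ultimately have "x @ a # c = v" using snoc.prems v by (intro unique) auto
  with eq show ?case by simp
qed

lemma short_word: obtains c0 where "c0 \<in> L" "length c0 \<le> N"
  using L(2) completion[of "[]"] that by fastforce

text \<open>A word of \<open>L\<close> is the image of \<open>c0\<close> under the group element that leads from \<open>c0\<close> to it.\<close>

lemma unique_representatives:
  assumes "w \<in> L" "u \<in> L" "cl w = cl u"
  shows "w = u"
proof -
  obtain c0 where c0: "c0 \<in> L" "length c0 \<le> N" by (rule short_word)
  have A: "c0 \<in> lists A" "w \<in> lists A" "u \<in> lists A" using c0 assms in_lists by auto
  then have "cl (winv c0 @ w) = cl (winv c0 @ u)" using assms(3) by (simp add: cl_append)
  then have "foldl move c0 (winv c0 @ w) = foldl move c0 (winv c0 @ u)"
    using A by (intro moves_cong c0) (simp add: cl_eq_iff)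
  then show ?thesis
    using moves_reach[OF c0, of w "[]"] moves_reach[OF c0, of u "[]"] assms by simp
qed

lemma every_element_represented:
  assumes "w \<in> lists A"
  shows "\<exists>u\<in>L. cl u = cl w"
proof -
  obtain c0 where c0: "c0 \<in> L" "length c0 \<le> N" by (rule short_word)
  have "cl (c0 @ winv c0 @ w) = cl w"
    using assms in_lists[OF c0(1)] by (simp add: cl_append cl_winv G.m_assoc[symmetric])
  then show ?thesis using moves[OF c0(1), of "winv c0 @ w"] assms in_lists[OF c0(1)] by auto
qed

end


section \<open>Reading two words and their difference\<close>

definition close :: "nat \<Rightarrow> letter padded list \<Rightarrow> bool" where
  "close r z \<longleftrightarrow> (\<forall>t\<le>length z. near r (tape1 (take t z)) (tape2 (take t z)))"

lemma close_snoc: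
  "close r (z @ [p]) \<longleftrightarrow> close r z \<and> near r (tape1 (z @ [p])) (tape2 (z @ [p]))"
  by (auto simp: close_def le_Suc_eq)

lemma close_pad: "close r (pad w u) \<longleftrightarrow> fellow r w u"
proof
  assume *: "close r (pad w u)"
  show "fellow r w u"
    unfolding fellow_def
  proof
    fix t
    show "near r (take t w) (take t u)"
    proof (cases "t \<le> length (pad w u)")
      case True
      then show ?thesis using * by (force simp: close_def take_pad)
    next
      case False
      then show ?thesis using *[unfolded close_def, rule_format, of "length (pad w u)"]
        by (auto simp: take_pad)
    qed
  qed
qed (simp add: close_def fellow_def take_pad)

definition diff :: "letter padded list \<Rightarrow> word set" where
  "diff z = cl (winv (tape1 z) @ tape2 z)"

abbreviation "PA \<equiv> padded_alphabet A"

text \<open>Nearness of the two words depends on their difference alone; with \<open>diff_snoc\<close> this lets a machine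
  with finitely many states decide it letter by letter.\<close>

lemma near_diff:
  assumes "z \<in> lists PA"
  shows "near r (tape1 z) (tape2 z) \<longleftrightarrow> diff z \<in> cl ` {e \<in> lists A. length e \<le> r}"
  unfolding diff_def using near_iff[of "tape1 z" "tape2 z" r] tape_in_lists[OF assms] by auto

lemma diff_snoc:
  assumes "z \<in> lists PA" "p \<in> PA"
  shows "diff (z @ [p]) = cl (winv (tape1 [p])) \<otimes>\<^bsub>G\<^esub> diff z \<otimes>\<^bsub>G\<^esub> cl (tape2 [p])"
  using tape_in_lists[OF assms(1)] tape_in_lists[of "[p]" A] assms(2)
  by (simp add: diff_def cl_append cl_winv G.inv_mult_group G.m_assoc)

lemma diff_eq_iff:
  assumes "z \<in> lists PA" "v \<in> lists A"
  shows "cl (tape1 z @ v) = cl (tape2 z) \<longleftrightarrow> diff z = cl v"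
  using tape_in_lists[OF assms(1)] assms(2)
  by (auto simp: diff_def cl_append cl_winv G.inv_solve_left')

text \<open>Everything that a machine with finitely many states can remember about a padded pair of words:
  the states of an automaton reading the pair and of two automata reading each word, the shape of
  the padding, and the difference of the words as long as they stay close.\<close>

definition track where
  "track r P M H z =
    (state_after P z, (state_after M (tape1 z), state_after M (tape2 z)),
     (state_after H (tape1 z), state_after H (tape2 z)),
     (valid z, None \<in> fst ` set z, None \<in> snd ` set z, diagonal z),
     if close r z then Some (diff z) else None)"

lemma track_snoc:
  assumes z: "z \<in> lists PA" "z' \<in> lists PA" and p: "p \<in> PA" and eq: "track r P M H z = track r P M H z'"
  shows "track r P M H (z @ [p]) = track r P M H (z' @ [p])"
proof -
  have cl: "close r z \<longleftrightarrow> close r z'" and d: "close r z \<Longrightarrow> diff z = diff z'"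
    using eq by (auto simp: track_def split: if_splits)
  have d': "diff (z @ [p]) = diff (z' @ [p])" if "close r z"
    using d[OF that] diff_snoc[OF z(1) p] diff_snoc[OF z(2) p] by simp
  have zp: "z @ [p] \<in> lists PA" "z' @ [p] \<in> lists PA" using z p by auto
  have cl': "close r (z @ [p]) \<longleftrightarrow> close r (z' @ [p])"
  proof (cases "close r z")
    case True
    with cl show ?thesis
      unfolding close_snoc near_diff[OF zp(1)] near_diff[OF zp(2)] d'[OF True] by simp
  qed (simp add: close_snoc flip: cl)
  have "(if close r (z @ [p]) then Some (diff (z @ [p])) else None) =
      (if close r (z' @ [p]) then Some (diff (z' @ [p])) else None)"
  proof (cases "close r (z @ [p])")
    case True
    then have "close r z" by (simp add: close_snoc)
    with True cl' d' show ?thesis by simp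
  qed (use cl' in simp)
  moreover have "valid (z @ [p]) = valid (z' @ [p])" "diagonal (z @ [p]) = diagonal (z' @ [p])"
    "(None \<in> fst ` set (z @ [p])) = (None \<in> fst ` set (z' @ [p]))"
    "(None \<in> snd ` set (z @ [p])) = (None \<in> snd ` set (z' @ [p]))"
    using eq by (simp_all add: track_def valid_snoc diagonal_def)
  moreover have "state_after P (z @ [p]) = state_after P (z' @ [p])"
    "state_after M (tape1 (z @ [p])) = state_after M (tape1 (z' @ [p]))"
    "state_after M (tape2 (z @ [p])) = state_after M (tape2 (z' @ [p]))"
    "state_after H (tape1 (z @ [p])) = state_after H (tape1 (z' @ [p]))"
    "state_after H (tape2 (z @ [p])) = state_after H (tape2 (z' @ [p]))"
    using eq by (simp_all add: track_def run_append)
  ultimately show ?thesis unfolding track_def by simp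
qed

definition track_bound where
  "track_bound r P M H = run_bound P * ((run_bound M * run_bound M) * ((run_bound H * run_bound H) *
     (16 * (length (all_words (letters n) r) + 1))))"

definition track_range where
  "track_range r P M H =
     insert None (Some ` insert (initial P) (snd ` set (table P))) \<times>
     (insert None (Some ` insert (initial M) (snd ` set (table M))) \<times>
      insert None (Some ` insert (initial M) (snd ` set (table M)))) \<times>
     (insert None (Some ` insert (initial H) (snd ` set (table H))) \<times>
      insert None (Some ` insert (initial H) (snd ` set (table H)))) \<times>
     (UNIV :: (bool \<times> bool \<times> bool \<times> bool) set) \<times>
     insert None (Some ` cl ` set (all_words (letters n) r))"

lemma finite_track_range: "finite (track_range r P M H)"
  by (simp add: track_range_def)

lemma card_track_range: "card (track_range r P M H) \<le> track_bound r P M H"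
proof -
  have "card (insert None (Some ` cl ` set (all_words (letters n) r))) \<le>
      Suc (card (Some ` cl ` set (all_words (letters n) r)))"
    by (rule card_insert_le_m1) auto
  also have "\<dots> \<le> Suc (card (set (all_words (letters n) r)))"
    unfolding image_image by (simp add: card_image_le)
  also have "\<dots> \<le> length (all_words (letters n) r) + 1"
    using card_length[of "all_words (letters n) r"] by simp
  finally have 1: "card (insert None (Some ` cl ` set (all_words (letters n) r))) \<le> length (all_words (letters n) r) + 1" .
  have 2: "card (UNIV :: (bool \<times> bool \<times> bool \<times> bool) set) = 16" by (simp add: card_UNIV_bool flip: UNIV_Times_UNIV)
  show ?thesis
    unfolding track_range_def track_bound_def card_cartesian_product 2
    by (intro mult_le_mono card_run_range 1 order_refl)
qed

lemma track_in_range: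
  assumes "z \<in> lists PA"
  shows "track r P M H z \<in> track_range r P M H"
proof -
  have "diff z \<in> cl ` set (all_words (letters n) r)" if "close r z"
  proof -
    have "near r (tape1 z) (tape2 z)" using that[unfolded close_def, rule_format, of "length z"] by simp
    then show ?thesis using near_diff[OF assms] by (simp add: set_all_words)
  qed
  then have "(if close r z then Some (diff z) else None) \<in> insert None (Some ` cl ` set (all_words (letters n) r))"
    by simp
  then show ?thesis
    unfolding track_def track_range_def by (intro SigmaI run_range UNIV_I)
qed

end


section \<open>Unique representatives in an arbitrary automatic structure\<close>

text \<open>The lexicographic comparison of two words of equal length, as a property of the padded pair.\<close>

fun lex_less :: "nat padded list \<Rightarrow> bool" where
  "lex_less [] = False"
| "lex_less (p # z) = ((\<exists>a b. p = (Some a, Some b) \<and> b < a) \<or> fst p = snd p \<and> lex_less z)"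

lemma lex_less_append: "lex_less (x @ y) \<longleftrightarrow> lex_less x \<or> diagonal x \<and> lex_less y"
  by (induction x) (auto simp: diagonal_def)

lemma lex_less_pad: "length w = length u \<Longrightarrow> lex_less (pad w u) \<longleftrightarrow> (u, w) \<in> lex less_than"
  by (induction w u rule: pad.induct) auto

lemma lenlex_pad:
  "(u, w) \<in> lenlex less_than \<longleftrightarrow>
     length u \<le> length w \<and> (None \<in> snd ` set (pad w u) \<or> lex_less (pad w u))"
proof (cases "length u = length w")
  case True
  then show ?thesis by (simp add: lenlex_conv None_in_snd_pad lex_less_pad)
next
  case False
  then show ?thesis by (auto simp: lenlex_conv None_in_snd_pad)
qed

definition padded_over :: "'a set \<Rightarrow> 'a list \<Rightarrow> 'a padded list set" where
  "padded_over X w = {z \<in> lists (padded_alphabet X). map fst z = map Some w}"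

lemma padded_over_append:
  "padded_over X (w @ v) = {x @ y | x y. x \<in> padded_over X w \<and> y \<in> padded_over X v}"
proof (intro equalityI subsetI)
  fix z assume "z \<in> padded_over X (w @ v)"
  then have z: "z \<in> lists (padded_alphabet X)" "map fst z = map Some w @ map Some v"
    by (auto simp: padded_over_def)
  then obtain x y where "z = x @ y" "map fst x = map Some w" "map fst y = map Some v"
    by (auto simp: map_eq_append_conv)
  then show "z \<in> {x @ y | x y. x \<in> padded_over X w \<and> y \<in> padded_over X v}"
    using z by (auto simp: padded_over_def)
qed (auto simp: padded_over_def)

lemma pad_in_padded_over:
  "pad w u \<in> padded_over X v \<longleftrightarrow> w = v \<and> length u \<le> length w \<and> w \<in> lists X \<and> u \<in> lists X"
proof -
  have "map fst (pad w u) = map Some v \<longleftrightarrow> w = v \<and> length u \<le> length w"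
  proof
    assume *: "map fst (pad w u) = map Some v"
    have "fst ` set (pad w u) = Some ` set v" using arg_cong[OF *, of set] by simp
    then have "None \<notin> fst ` set (pad w u)" by auto
    then have "length u \<le> length w" by (simp add: None_in_fst_pad)
    then show "w = v \<and> length u \<le> length w" using * map_fst_pad_take[of w u] by (auto simp: inj_map_eq_map)
  next
    assume "w = v \<and> length u \<le> length w"
    then show "map fst (pad w u) = map Some v" using map_fst_pad_take[of w u] by (auto simp: max_def)
  qed
  then show ?thesis by (auto simp: padded_over_def pad_in_lists_iff)
qed

locale automatic =
  fixes G (structure) and B :: "nat set" and \<mu> :: "nat \<Rightarrow> 'g" and M Meq Mm
  assumes automatic: "automatic_structure G B \<mu> M Meq Mm"
begin

abbreviation "ev \<equiv> eval_word G \<mu>"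

sublocale group G
  using automatic by (simp add: automatic_structure_def)

lemma finite_B: "finite B" and mu_in: "a \<in> B \<Longrightarrow> \<mu> a \<in> carrier G"
  and mu_inverse: "a \<in> B \<Longrightarrow> \<exists>b\<in>B. \<mu> b = inv (\<mu> a)"
  and mu_generate: "generate G (\<mu> ` B) = carrier G"
  and lang_M: "lang M \<subseteq> lists B" "ev ` lang M = carrier G"
  and lang_Meq: "lang Meq = {pad w u | w u. w \<in> lang M \<and> u \<in> lang M \<and> ev w = ev u}"
  and lang_Mm: "a \<in> B \<Longrightarrow> lang (Mm a) = {pad w u | w u. w \<in> lang M \<and> u \<in> lang M \<and> ev (w @ [a]) = ev u}"
  using automatic by (auto simp: automatic_structure_def generating_alphabet_def)

lemma ev_simps [simp]: "ev [] = \<one>" "ev (a # w) = \<mu> a \<otimes> ev w"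
  by (simp_all add: eval_word_def)

lemma ev_in [simp]: "w \<in> lists B \<Longrightarrow> ev w \<in> carrier G"
  by (induction w) (auto simp: mu_in)

lemma ev_append: "u \<in> lists B \<Longrightarrow> v \<in> lists B \<Longrightarrow> ev (u @ v) = ev u \<otimes> ev v"
  by (induction u) (auto simp: mu_in m_assoc)

definition shortlex_language :: "nat list set" where
  "shortlex_language = {w \<in> lang M. \<forall>u\<in>lang M. ev u = ev w \<longrightarrow> (u, w) \<notin> lenlex less_than}"

lemma shortlex_language_subset: "shortlex_language \<subseteq> lang M"
  by (auto simp: shortlex_language_def)

lemma shortlex_unique:
  assumes "w \<in> shortlex_language" "u \<in> shortlex_language" "ev w = ev u"
  shows "w = u"
proof -
  have "total (lenlex less_than)" by (rule total_lenlex) simp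
  then have "w = u \<or> (w, u) \<in> lenlex less_than \<or> (u, w) \<in> lenlex less_than"
    unfolding total_on_def by blast
  then show ?thesis using assms unfolding shortlex_language_def by auto
qed

lemma shortlex_represents:
  assumes "g \<in> carrier G"
  shows "\<exists>w\<in>shortlex_language. ev w = g"
proof -
  have "wf (lenlex less_than)" by (rule wf_lenlex) simp
  moreover have "{w \<in> lang M. ev w = g} \<noteq> {}" using assms unfolding lang_M(2)[symmetric] by auto
  ultimately obtain w where w: "w \<in> {w \<in> lang M. ev w = g}"
    "\<And>u. (u, w) \<in> lenlex less_than \<Longrightarrow> u \<notin> {w \<in> lang M. ev w = g}"
    by (rule wfE_min') (rule that)
  then have "w \<in> shortlex_language" unfolding shortlex_language_def by auto
  with w(1) show ?thesis by auto
qed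

text \<open>A competitor that is smaller in shortlex order is not longer, so it fits on the second tape while
  the first one is read, and only pairs without padding on the first tape matter.\<close>

lemma shortlex_iff:
  "w \<in> shortlex_language \<longleftrightarrow> w \<in> lang M \<and>
     \<not> (\<exists>z\<in>padded_over B w. z \<in> lang Meq \<and> (None \<in> snd ` set z \<or> lex_less z))"
proof (cases "w \<in> lang M")
  case True
  then have w: "w \<in> lists B" using lang_M by blast
  have "(\<exists>z\<in>padded_over B w. z \<in> lang Meq \<and> (None \<in> snd ` set z \<or> lex_less z)) \<longleftrightarrow>
      (\<exists>u\<in>lang M. ev u = ev w \<and> (u, w) \<in> lenlex less_than)"
  proof
    assume "\<exists>z\<in>padded_over B w. z \<in> lang Meq \<and> (None \<in> snd ` set z \<or> lex_less z)"
    then obtain z where z: "z \<in> padded_over B w" "z \<in> lang Meq" "None \<in> snd ` set z \<or> lex_less z"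
      by blast
    then obtain v u where "z = pad v u" "v \<in> lang M" "u \<in> lang M" "ev v = ev u"
      unfolding lang_Meq by auto
    with z show "\<exists>u\<in>lang M. ev u = ev w \<and> (u, w) \<in> lenlex less_than"
      unfolding lenlex_pad by (intro bexI[of _ u]) (auto simp: pad_in_padded_over)
  next
    assume "\<exists>u\<in>lang M. ev u = ev w \<and> (u, w) \<in> lenlex less_than"
    then obtain u where u: "u \<in> lang M" "ev u = ev w" "(u, w) \<in> lenlex less_than" by blast
    moreover have "u \<in> lists B" using u lang_M by blast
    ultimately show "\<exists>z\<in>padded_over B w. z \<in> lang Meq \<and> (None \<in> snd ` set z \<or> lex_less z)"
      using w True unfolding lenlex_pad lang_Meq
      by (intro bexI[of _ "pad w u"]) (auto simp: pad_in_padded_over)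
  qed
  with True show ?thesis by (auto simp: shortlex_language_def)
qed (simp add: shortlex_language_def)

text \<open>Subset construction: a word is tracked together with all competitors that could have been read in
  the same time.\<close>

lemma regular_shortlex: obtains N where "lang N = shortlex_language" "letters_in N B"
proof -
  define g where "g z = (state_after Meq z, None \<in> snd ` set z, lex_less z, diagonal z)" for z
  define f where "f w = (state_after M w, g ` padded_over B w)" for w
  have "g z \<in> insert None (Some ` insert (initial Meq) (snd ` set (table Meq))) \<times> UNIV" for z
    unfolding g_def by (intro SigmaI run_range UNIV_I)
  then have "f w \<in> insert None (Some ` insert (initial M) (snd ` set (table M))) \<times>
      Pow (insert None (Some ` insert (initial Meq) (snd ` set (table Meq))) \<times> UNIV)" for w
    unfolding f_def by (intro SigmaI run_range) blast
  then have "f ` lists B \<subseteq> insert None (Some ` insert (initial M) (snd ` set (table M))) \<times>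
      Pow (insert None (Some ` insert (initial Meq) (snd ` set (table Meq))) \<times> UNIV)" by blast
  then have fin: "finite (f ` lists B)" by (rule finite_subset) simp
  have g_append: "(x @ y \<in> lang Meq \<and> (None \<in> snd ` set (x @ y) \<or> lex_less (x @ y))) =
      (x' @ y \<in> lang Meq \<and> (None \<in> snd ` set (x' @ y) \<or> lex_less (x' @ y)))"
    if "g x = g x'" for x x' y
    using that lang_append_cong[of Meq x x' y] by (auto simp: g_def lex_less_append)
  have bad_append: "(\<exists>z\<in>padded_over B (y @ v). z \<in> lang Meq \<and> (None \<in> snd ` set z \<or> lex_less z))"
    if eq: "g ` padded_over B x = g ` padded_over B y"
      and bad: "\<exists>z\<in>padded_over B (x @ v). z \<in> lang Meq \<and> (None \<in> snd ` set z \<or> lex_less z)" for x y v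
  proof -
    obtain z1 z2 where z: "z1 \<in> padded_over B x" "z2 \<in> padded_over B v"
      "z1 @ z2 \<in> lang Meq \<and> (None \<in> snd ` set (z1 @ z2) \<or> lex_less (z1 @ z2))"
      using bad unfolding padded_over_append by blast
    have "g z1 \<in> g ` padded_over B y" using eq z(1) by blast
    then obtain z1' where z1': "z1' \<in> padded_over B y" "g z1 = g z1'" by blast
    show ?thesis
      unfolding padded_over_append using z1'(1) z(2) z(3)[unfolded g_append[OF z1'(2), of z2]] by blast
  qed
  show ?thesis
  proof (rule regular_if_finite_index[where X=B and K=shortlex_language and f=f])
    show "shortlex_language \<subseteq> lists B" using shortlex_language_subset lang_M by blast
    fix x y z assume "f x = f y" and xz: "x @ z \<in> shortlex_language"
    then have eq: "state_after M x = state_after M y" "g ` padded_over B y = g ` padded_over B x"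
      by (simp_all add: f_def)
    show "y @ z \<in> shortlex_language"
      using xz bad_append[OF eq(2), of z] lang_append_cong[OF eq(1), of z]
      unfolding shortlex_iff by blast
  qed (use finite_B fin that in blast)+
qed


section \<open>Finitely many word differences\<close>

text \<open>A state of the multiplier automaton from which a final state can be reached determines the
  difference of the two words read so far: they differ by the same element as their common
  completions.\<close>

lemma finite_multiplier_differences:
  assumes a: "a \<in> B"
  shows "finite {inv (ev (take t w)) \<otimes> ev (take t u) | w u t.
     w \<in> lang M \<and> u \<in> lang M \<and> ev (w @ [a]) = ev u}"
proof -
  let ?P = "Mm a"
  define d where "d x = inv (ev (tape1 x)) \<otimes> ev (tape2 x)" for x
  have tapes: "tape1 x \<in> lists B" "tape2 x \<in> lists B" "tape1 y \<in> lists B" "tape2 y \<in> lists B"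
      "ev (tape1 x) \<otimes> (ev (tape1 y) \<otimes> \<mu> a) = ev (tape2 x) \<otimes> ev (tape2 y)"
    if xy: "x @ y \<in> lang ?P" for x y
  proof -
    obtain w u where wu: "x @ y = pad w u" "w \<in> lang M" "u \<in> lang M" "ev (w @ [a]) = ev u"
      using xy unfolding lang_Mm[OF a] by auto
    have w: "w = tape1 x @ tape1 y" using arg_cong[OF wu(1), of tape1] by simp
    have u: "u = tape2 x @ tape2 y" using arg_cong[OF wu(1), of tape2] by simp
    have "w \<in> lists B" "u \<in> lists B" using wu lang_M by auto
    then show 1: "tape1 x \<in> lists B" "tape2 x \<in> lists B" "tape1 y \<in> lists B" "tape2 y \<in> lists B"
      unfolding w u by auto
    show "ev (tape1 x) \<otimes> (ev (tape1 y) \<otimes> \<mu> a) = ev (tape2 x) \<otimes> ev (tape2 y)"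
      using wu(4) 1 a unfolding w u by (simp add: ev_append mu_in m_assoc)
  qed
  have d_eq: "d x = ev (tape1 y) \<otimes> \<mu> a \<otimes> inv (ev (tape2 y))" if "x @ y \<in> lang ?P" for x y
  proof -
    note t = tapes[OF that]
    have "ev (tape2 x) = ev (tape1 x) \<otimes> (ev (tape1 y) \<otimes> \<mu> a) \<otimes> inv (ev (tape2 y))"
      unfolding t(5) using t(1-4) by (simp add: m_assoc)
    then show ?thesis
      unfolding d_def using t(1-4) a by (simp add: mu_in m_assoc[symmetric])
  qed
  define D where "D s = d (SOME x. state_after ?P x = s \<and> (\<exists>y. x @ y \<in> lang ?P))" for s
  have d_D: "d x = D (state_after ?P x)" if xy: "x @ y \<in> lang ?P" for x y
  proof -
    define x' where "x' = (SOME x'. state_after ?P x' = state_after ?P x \<and> (\<exists>y. x' @ y \<in> lang ?P))"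
    have "state_after ?P x' = state_after ?P x \<and> (\<exists>y. x' @ y \<in> lang ?P)"
      unfolding x'_def by (rule someI[of _ x]) (use xy in blast)
    then have "x' @ y \<in> lang ?P" using lang_append_cong[of ?P x x' y] xy by simp
    then have "d x' = d x" using d_eq xy by simp
    then show ?thesis by (simp add: D_def x'_def)
  qed
  have "{inv (ev (take t w)) \<otimes> ev (take t u) | w u t. w \<in> lang M \<and> u \<in> lang M \<and> ev (w @ [a]) = ev u}
     \<subseteq> D ` insert None (Some ` insert (initial ?P) (snd ` set (table ?P)))"
  proof
    fix q assume "q \<in> {inv (ev (take t w)) \<otimes> ev (take t u) | w u t. w \<in> lang M \<and> u \<in> lang M \<and> ev (w @ [a]) = ev u}"
    then obtain w u t where q: "q = inv (ev (take t w)) \<otimes> ev (take t u)"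
      and wu: "w \<in> lang M" "u \<in> lang M" "ev (w @ [a]) = ev u" by blast
    have "take t (pad w u) @ drop t (pad w u) \<in> lang ?P" using wu unfolding lang_Mm[OF a] by auto
    from d_D[OF this] have "q = D (state_after ?P (take t (pad w u)))"
      by (simp add: d_def q take_pad)
    then show "q \<in> D ` insert None (Some ` insert (initial ?P) (snd ` set (table ?P)))"
      using run_range by blast
  qed
  then show ?thesis by (rule finite_subset) simp
qed

definition differences :: "'g \<Rightarrow> 'g set" where
  "differences g = {inv (ev (take t w)) \<otimes> ev (take t u) | w u t.
     w \<in> shortlex_language \<and> u \<in> shortlex_language \<and> ev w \<otimes> g = ev u}"

lemma shortlex_in_lists [simp]: "w \<in> shortlex_language \<Longrightarrow> w \<in> lists B"
  using shortlex_language_subset lang_M by blast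

lemma take_in [simp]: "w \<in> lists B \<Longrightarrow> take t w \<in> lists B"
  by (auto simp: in_lists_conv_set dest: in_set_takeD)

lemma finite_differences_letter:
  assumes "a \<in> B" shows "finite (differences (\<mu> a))"
proof (rule finite_subset[OF _ finite_multiplier_differences[OF assms]], rule subsetI)
  fix x assume "x \<in> differences (\<mu> a)"
  then obtain w u t where x: "x = inv (ev (take t w)) \<otimes> ev (take t u)"
    "w \<in> shortlex_language" "u \<in> shortlex_language" "ev w \<otimes> \<mu> a = ev u"
    unfolding differences_def by blast
  moreover have "ev (w @ [a]) = ev u" using x assms by (simp add: ev_append mu_in)
  ultimately show "x \<in> {inv (ev (take t w)) \<otimes> ev (take t u) | w u t.
     w \<in> lang M \<and> u \<in> lang M \<and> ev (w @ [a]) = ev u}" using shortlex_language_subset by blast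
qed

text \<open>The bound for letters extends to products by inserting the representative of the intermediate
  element: the differences of a product are products of differences.\<close>

lemma finite_differences:
  assumes "g \<in> carrier G" shows "finite (differences g)"
proof -
  have "g \<in> generate G (\<mu> ` B)" using assms mu_generate by simp
  then show ?thesis
  proof (induction rule: generate.induct)
    case one
    have "differences \<one> \<subseteq> {\<one>}"
    proof
      fix x assume "x \<in> differences \<one>"
      then obtain w u t where x: "x = inv (ev (take t w)) \<otimes> ev (take t u)"
        "w \<in> shortlex_language" "u \<in> shortlex_language" "ev w \<otimes> \<one> = ev u"
        unfolding differences_def by blast
      then have "w = u" by (intro shortlex_unique) simp_all
      with x show "x \<in> {\<one>}" by simp
    qed
    then show ?case by (rule finite_subset) simp
  next
    case (incl h)
    then show ?case using finite_differences_letter by blast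
  next
    case (inv h)
    then obtain a where "a \<in> B" "h = \<mu> a" by blast
    then show ?case using finite_differences_letter mu_inverse by metis
  next
    case (eng h1 h2)
    have h: "h1 \<in> carrier G" "h2 \<in> carrier G" using eng mu_generate by auto
    have "differences (h1 \<otimes> h2) \<subseteq> (\<lambda>(x, y). x \<otimes> y) ` (differences h1 \<times> differences h2)"
    proof
      fix x assume "x \<in> differences (h1 \<otimes> h2)"
      then obtain w u t where x: "x = inv (ev (take t w)) \<otimes> ev (take t u)"
        "w \<in> shortlex_language" "u \<in> shortlex_language" "ev w \<otimes> (h1 \<otimes> h2) = ev u"
        unfolding differences_def by blast
      have "ev w \<otimes> h1 \<in> carrier G" using x h by simp
      then obtain v where v: "v \<in> shortlex_language" "ev v = ev w \<otimes> h1"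
        using shortlex_represents by blast
      have "ev v \<otimes> h2 = ev u" using x v h by (simp add: m_assoc)
      then have "inv (ev (take t v)) \<otimes> ev (take t u) \<in> differences h2"
        using x v unfolding differences_def by blast
      moreover have "inv (ev (take t w)) \<otimes> ev (take t v) \<in> differences h1"
        using x v unfolding differences_def by fastforce
      moreover have "x = (inv (ev (take t w)) \<otimes> ev (take t v)) \<otimes> (inv (ev (take t v)) \<otimes> ev (take t u))"
      proof -
        have "ev (take t v) \<otimes> (inv (ev (take t v)) \<otimes> ev (take t u)) = ev (take t u)"
          using x v by (simp add: m_assoc[symmetric])
        then show ?thesis using x v by (simp add: m_assoc)
      qed
      ultimately show "x \<in> (\<lambda>(x, y). x \<otimes> y) ` (differences h1 \<times> differences h2)" by force
    qed
    then show ?case by (rule finite_subset) (use eng in simp)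
  qed
qed

end


section \<open>Changing the generating set\<close>

text \<open>A word over the old generators is rewritten letter by letter.  The word chosen for a letter is
  lengthened by trivial pairs until the output has length \<open>c\<close> per letter read, up to a deficit of at
  most one: lengths can only be changed by an even number, so the deficit repairs the parity.\<close>

definition out :: "('b \<Rightarrow> word) \<Rightarrow> nat \<Rightarrow> nat \<Rightarrow> 'b \<Rightarrow> word" where
  "out \<omega> c d a = \<omega> a @ concat (replicate ((c + d - length (\<omega> a)) div 2) [Gen 0, GenInv 0])"

definition deficit_after :: "('b \<Rightarrow> word) \<Rightarrow> nat \<Rightarrow> nat \<Rightarrow> 'b \<Rightarrow> nat" where
  "deficit_after \<omega> c d a = (c + d - length (\<omega> a)) mod 2"

fun translate :: "('b \<Rightarrow> word) \<Rightarrow> nat \<Rightarrow> nat \<Rightarrow> 'b list \<Rightarrow> word" where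
  "translate \<omega> c d [] = []"
| "translate \<omega> c d (a # w) = out \<omega> c d a @ translate \<omega> c (deficit_after \<omega> c d a) w"

fun deficit :: "('b \<Rightarrow> word) \<Rightarrow> nat \<Rightarrow> nat \<Rightarrow> 'b list \<Rightarrow> nat" where
  "deficit \<omega> c d [] = d"
| "deficit \<omega> c d (a # w) = deficit \<omega> c (deficit_after \<omega> c d a) w"

lemma translate_append:
  "translate \<omega> c d (w @ u) = translate \<omega> c d w @ translate \<omega> c (deficit \<omega> c d w) u"
  by (induction w arbitrary: d) auto

lemma deficit_le_1: "d \<le> 1 \<Longrightarrow> deficit \<omega> c d w \<le> 1"
proof (induction w arbitrary: d)
  case (Cons a w)
  have "deficit_after \<omega> c d a \<le> 1" by (simp add: deficit_after_def)
  then show ?case using Cons.IH by simp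
qed simp

lemma length_out:
  assumes "length (\<omega> a) \<le> c"
  shows "length (out \<omega> c d a) + deficit_after \<omega> c d a = c + d"
proof -
  have "length (concat (replicate j [Gen 0, GenInv 0])) = 2 * j" for j
    by (induction j) auto
  then show ?thesis using assms by (simp add: out_def deficit_after_def)
qed

lemma length_translate:
  assumes "\<And>a. a \<in> set w \<Longrightarrow> length (\<omega> a) \<le> c"
  shows "length (translate \<omega> c d w) + deficit \<omega> c d w = c * length w + d"
  using assms
proof (induction w arbitrary: d)
  case (Cons a w)
  have "length (out \<omega> c d a) + deficit_after \<omega> c d a = c + d"
    by (rule length_out) (simp add: Cons.prems)
  moreover have "length (translate \<omega> c (deficit_after \<omega> c d a) w) +
      deficit \<omega> c (deficit_after \<omega> c d a) w = c * length w + deficit_after \<omega> c d a"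
    using Cons by simp
  ultimately show ?case by simp
qed simp

locale translation = presentation n rs + automatic "presented_group n (set rs)" B \<mu> M Meq Mm
  for n rs and B :: "nat set" and \<mu> M Meq Mm +
  fixes \<omega> :: "nat \<Rightarrow> word" and c :: nat
  assumes n: "0 < n" and c: "0 < c"
    and \<omega>: "\<And>a. a \<in> B \<Longrightarrow> \<omega> a \<in> lists (alphabet n) \<and> length (\<omega> a) \<le> c \<and> cl (\<omega> a) = \<mu> a"
begin

abbreviation "tr \<equiv> translate \<omega> c"

lemma padding_in: "concat (replicate j [Gen 0, GenInv 0]) \<in> lists A"
  using n by (auto simp: alphabet_def in_lists_conv_set)

lemma cl_padding: "cl (concat (replicate j [Gen 0, GenInv 0])) = \<one>\<^bsub>G\<^esub>"
proof (induction j)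
  case (Suc j)
  have "([] @ [Gen 0, inv_letter (Gen 0)] @ [], [] @ []) \<in> word_cong n (set rs)"
    by (rule word_cong.cancel) (use n in \<open>auto simp: alphabet_def\<close>)
  then have pair: "cl [Gen 0, GenInv 0] = \<one>\<^bsub>G\<^esub>" "[Gen 0, GenInv 0] \<in> lists A"
    using padding_in[of 1] by (simp_all add: cl_eq_iff flip: cl_Nil)
  have "cl ([Gen 0, GenInv 0] @ concat (replicate j [Gen 0, GenInv 0])) = \<one>\<^bsub>G\<^esub>"
    using cl_append[OF pair(2) padding_in[of j]] pair(1) Suc by simp
  then show ?case by simp
qed (simp add: cl_Nil)

lemma translate_in [simp]: "w \<in> lists B \<Longrightarrow> tr d w \<in> lists A"
proof (induction w arbitrary: d)
  case (Cons a w)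
  then have a: "a \<in> B" "w \<in> lists B" by auto
  have "out \<omega> c d a \<in> lists A" unfolding out_def using \<omega>[OF a(1)] padding_in by simp
  then show ?case using Cons.IH a by simp
qed simp

lemma cl_translate: "w \<in> lists B \<Longrightarrow> cl (tr d w) = ev w"
proof (induction w arbitrary: d)
  case (Cons a w)
  then have a: "a \<in> B" "w \<in> lists B" by auto
  have 1: "out \<omega> c d a \<in> lists A" unfolding out_def using \<omega>[OF a(1)] padding_in by simp
  have "cl (out \<omega> c d a) = \<mu> a"
    unfolding out_def using \<omega>[OF a(1)] mu_in[OF a(1)] by (simp add: cl_append padding_in cl_padding)
  then show ?case using Cons.IH a 1 by (simp add: cl_append)
qed (simp add: cl_Nil)

lemma length_translate_B:
  assumes "w \<in> lists B"
  shows "length (tr d w) + deficit \<omega> c d w = c * length w + d"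
  using assms \<omega> by (intro length_translate) auto

text \<open>A word over the new generators remembers how the old words whose translation it begins can be
  left: the state of the old automaton and what is left over of the last translated letter.\<close>

lemma regular_translation:
  assumes N: "lang N \<subseteq> lists B"
  obtains N' where "lang N' = tr 0 ` lang N" "letters_in N' A"
proof -
  define f where "f x = {(state_after N w, deficit \<omega> c 0 w, y) | w y.
    w \<in> lists B \<and> tr 0 w = x @ y \<and> length y \<le> c + 1}" for x
  have "f x \<subseteq> insert None (Some ` insert (initial N) (snd ` set (table N))) \<times> {..1} \<times>
      {y. set y \<subseteq> A \<and> length y \<le> c + 1}" for x
  proof
    fix q assume "q \<in> f x"
    then obtain w y where q: "q = (state_after N w, deficit \<omega> c 0 w, y)"
      "w \<in> lists B" "tr 0 w = x @ y" "length y \<le> c + 1" unfolding f_def by blast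
    have "x @ y \<in> lists A" using translate_in[OF q(2), of 0] q(3) by simp
    then show "q \<in> insert None (Some ` insert (initial N) (snd ` set (table N))) \<times> {..1} \<times>
      {y. set y \<subseteq> A \<and> length y \<le> c + 1}"
      unfolding q(1) using q(4) deficit_le_1[of 0 \<omega> c w] by (intro SigmaI run_range) auto
  qed
  then have "f ` lists A \<subseteq> Pow (insert None (Some ` insert (initial N) (snd ` set (table N))) \<times> {..1} \<times>
      {y. set y \<subseteq> A \<and> length y \<le> c + 1})" by blast
  then have fin: "finite (f ` lists A)"
    by (rule finite_subset) (simp add: finite_lists_length_le)
  show ?thesis
  proof (rule regular_if_finite_index[where X=A and K="tr 0 ` lang N" and f=f])
    show "tr 0 ` lang N \<subseteq> lists A" using N translate_in by blast
    fix x x' z assume f: "f x = f x'" and "x @ z \<in> tr 0 ` lang N"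
    then obtain w where w: "w \<in> lang N" "tr 0 w = x @ z" by auto
    have wB: "w \<in> lists B" using w N by blast
    define j where "j = (LEAST j. length x \<le> length (tr 0 (take j w)))"
    have "length x \<le> length (tr 0 (take (length w) w))" using w by simp
    then have j: "length x \<le> length (tr 0 (take j w))" unfolding j_def by (rule LeastI)
    define w1 w2 where "w1 = take j w" and "w2 = drop j w"
    have w12: "w = w1 @ w2" "w1 \<in> lists B" "w2 \<in> lists B"
      using wB set_take_subset[of j w] set_drop_subset[of j w]
      by (auto simp: w1_def w2_def in_lists_conv_set)
    have eq: "x @ z = tr 0 w1 @ tr (deficit \<omega> c 0 w1) w2"
      using w(2) unfolding w12(1) translate_append by simp
    have "take (length x) (tr 0 w1) = x"
      using arg_cong[OF eq, of "take (length x)"] j by (simp add: w1_def)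
    then obtain y where y: "tr 0 w1 = x @ y" by (metis append_take_drop_id)
    have z: "z = y @ tr (deficit \<omega> c 0 w1) w2" using eq y by simp
    have "length (tr 0 w1) \<le> length x + (c + 1)"
    proof (cases j)
      case 0
      then show ?thesis by (simp add: w1_def)
    next
      case (Suc i)
      have less: "length (tr 0 (take i w)) < length x"
        using not_less_Least[of i "\<lambda>j. length x \<le> length (tr 0 (take j w))"] Suc by (simp add: j_def)
      then have "i < length w" using w(2) by (cases "i < length w") auto
      then have "w1 = take i w @ [w ! i]" "w ! i \<in> B"
        using wB Suc by (auto simp: w1_def take_Suc_conv_app_nth)
      moreover have "length (out \<omega> c (deficit \<omega> c 0 (take i w)) (w ! i)) \<le> c + 1"
        using length_out[of \<omega> "w ! i" c "deficit \<omega> c 0 (take i w)"] \<omega>[OF \<open>w ! i \<in> B\<close>]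
          deficit_le_1[of 0 \<omega> c "take i w"] by simp
      ultimately show ?thesis using less by (simp add: translate_append)
    qed
    then have "(state_after N w1, deficit \<omega> c 0 w1, y) \<in> f x"
      unfolding f_def using w12 y by auto
    then have "(state_after N w1, deficit \<omega> c 0 w1, y) \<in> f x'" by (simp only: f)
    then obtain v where v: "state_after N v = state_after N w1" "deficit \<omega> c 0 v = deficit \<omega> c 0 w1"
      "set v \<subseteq> B" "tr 0 v = x' @ y"
      unfolding f_def by (auto simp: subset_iff)
    have "v @ w2 \<in> lang N" using lang_append_cong[OF v(1), of w2] w(1) w12(1) by simp
    moreover have "tr 0 (v @ w2) = x' @ z" using v z by (simp add: translate_append)
    ultimately show "x' @ z \<in> tr 0 ` lang N" by (metis imageI)
  qed (use fin that in auto)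
qed

text \<open>At time \<open>t\<close> a translated word has read \<open>t div c\<close> old letters, whatever the word: this is why
  translation preserves synchronous fellow travelling.\<close>

lemma take_translate:
  assumes w: "w \<in> lists B"
  obtains e where "e \<in> lists A" "length e \<le> c"
    "take t (tr 0 w) = tr 0 (take (t div c) w) @ e"
proof -
  define s where "s = t div c"
  have t: "c * s \<le> t" "t < c * s + c"
    using div_mult_mod_eq[of t c] mod_less_divisor[OF c, of t]
    unfolding s_def mult.commute[of c] by linarith+
  define w1 w2 where "w1 = take s w" and "w2 = drop s w"
  have w12: "w = w1 @ w2" "w1 \<in> lists B" "w2 \<in> lists B"
    using w set_take_subset[of s w] set_drop_subset[of s w]
    by (auto simp: w1_def w2_def in_lists_conv_set)
  let ?d = "deficit \<omega> c 0 w1"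
  have len: "length (tr 0 w1) + ?d = c * length w1" using length_translate_B[OF w12(2), of 0] by simp
  have d: "?d \<le> 1" by (rule deficit_le_1) simp
  have "c * length w1 \<le> c * s" by (simp add: w1_def)
  then have le: "length (tr 0 w1) \<le> t" using len t by linarith
  define e where "e = take (t - length (tr 0 w1)) (tr ?d w2)"
  have "take t (tr 0 w) = tr 0 w1 @ e"
    using le unfolding w12(1) translate_append e_def by simp
  moreover have "e \<in> lists A"
    unfolding e_def using translate_in[OF w12(3), of ?d] set_take_subset[of _ "tr ?d w2"]
    by (auto simp: in_lists_conv_set)
  moreover have "length e \<le> c"
  proof (cases "s < length w")
    case True
    then have "length w1 = s" by (simp add: w1_def)
    then have "t - length (tr 0 w1) \<le> c" using len d t by simp
    then show ?thesis by (simp add: e_def)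
  next
    case False
    then have "w2 = []" by (simp add: w2_def)
    then show ?thesis by (simp add: e_def)
  qed
  ultimately show ?thesis using that unfolding w1_def s_def by blast
qed

lemma finite_short_words: "finite {e \<in> lists A. length e \<le> k}"
  using set_all_words[of "letters n" k] by (metis List.finite_set set_letters)

lemma elements_within:
  assumes "finite D" "D \<subseteq> carrier G"
  shows "\<exists>k. \<forall>g\<in>D. \<exists>e\<in>lists A. length e \<le> k \<and> cl e = g"
proof -
  have "\<forall>g\<in>D. \<exists>e\<in>lists A. cl e = g" using assms(2) by (auto simp: carrier_presented_group)
  then obtain h where h: "\<And>g. g \<in> D \<Longrightarrow> h g \<in> lists A \<and> cl (h g) = g" by metis
  have "length (h g) \<le> Max ((\<lambda>g. length (h g)) ` D)" if "g \<in> D" for g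
    using assms(1) that by simp
  with h show ?thesis by blast
qed

text \<open>At each time, two translated words differ by an old difference of the words read so far,
  changed by bounded remainders on both sides.\<close>

lemma translated_fellow:
  assumes g: "g \<in> carrier G"
  shows "\<exists>k. \<forall>w\<in>tr 0 ` shortlex_language. \<forall>u\<in>tr 0 ` shortlex_language.
    cl w \<otimes>\<^bsub>G\<^esub> g = cl u \<longrightarrow> fellow k w u"
proof -
  let ?E = "{e \<in> lists A. length e \<le> c}"
  define D where "D = (\<Union>e1\<in>?E. \<Union>x\<in>differences g.
    (\<lambda>e2. inv\<^bsub>G\<^esub> (cl e1) \<otimes>\<^bsub>G\<^esub> x \<otimes>\<^bsub>G\<^esub> cl e2) ` ?E)"
  have diffs: "differences g \<subseteq> carrier G" by (auto simp: differences_def)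
  have "finite D"
    unfolding D_def by (intro finite_UN_I finite_imageI finite_differences g finite_short_words)
  moreover have "D \<subseteq> carrier G"
  proof -
    have "inv\<^bsub>G\<^esub> (cl e1) \<otimes>\<^bsub>G\<^esub> x \<otimes>\<^bsub>G\<^esub> cl e2 \<in> carrier G"
      if "e1 \<in> lists A" "x \<in> differences g" "e2 \<in> lists A" for e1 x e2
      using cl_in[OF that(1)] cl_in[OF that(3)] subsetD[OF diffs that(2)] by simp
    then show ?thesis unfolding D_def by (intro UN_least image_subsetI) simp_all
  qed
  ultimately obtain k where "\<forall>x\<in>D. \<exists>e\<in>lists A. length e \<le> k \<and> cl e = x"
    using elements_within[of D] by presburger
  note k = bspec[OF this]
  have "fellow k (tr 0 w) (tr 0 u)"
    if w: "w \<in> shortlex_language" and u: "u \<in> shortlex_language"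
      and eq: "cl (tr 0 w) \<otimes>\<^bsub>G\<^esub> g = cl (tr 0 u)" for w u
    unfolding fellow_def
  proof
    fix t
    have wB: "w \<in> lists B" and uB: "u \<in> lists B" using w u by simp_all
    obtain e1 where e1: "e1 \<in> lists A" "length e1 \<le> c" "take t (tr 0 w) = tr 0 (take (t div c) w) @ e1"
      by (rule take_translate[OF wB])
    obtain e2 where e2: "e2 \<in> lists A" "length e2 \<le> c" "take t (tr 0 u) = tr 0 (take (t div c) u) @ e2"
      by (rule take_translate[OF uB])
    let ?w = "take (t div c) w" and ?u = "take (t div c) u"
    have B: "?w \<in> lists B" "?u \<in> lists B"
      using wB uB by (auto simp: in_lists_conv_set dest: in_set_takeD)
    have d: "inv\<^bsub>G\<^esub> (ev ?w) \<otimes>\<^bsub>G\<^esub> ev ?u \<in> differences g"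
      unfolding differences_def using w u eq wB uB by (auto simp: cl_translate)
    have "inv\<^bsub>G\<^esub> (cl e1) \<otimes>\<^bsub>G\<^esub> (inv\<^bsub>G\<^esub> (ev ?w) \<otimes>\<^bsub>G\<^esub> ev ?u) \<otimes>\<^bsub>G\<^esub> cl e2 \<in> D"
      
      unfolding D_def
    proof (intro UN_I)
      show "e1 \<in> ?E" using e1 by simp
      show "inv\<^bsub>G\<^esub> (ev ?w) \<otimes>\<^bsub>G\<^esub> ev ?u \<in> differences g" by (rule d)
      show "inv\<^bsub>G\<^esub> (cl e1) \<otimes>\<^bsub>G\<^esub> (inv\<^bsub>G\<^esub> (ev ?w) \<otimes>\<^bsub>G\<^esub> ev ?u) \<otimes>\<^bsub>G\<^esub> cl e2 \<in>
          (\<lambda>e2. inv\<^bsub>G\<^esub> (cl e1) \<otimes>\<^bsub>G\<^esub> (inv\<^bsub>G\<^esub> (ev ?w) \<otimes>\<^bsub>G\<^esub> ev ?u) \<otimes>\<^bsub>G\<^esub> cl e2) ` ?E"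
        by (rule imageI) (use e2 in simp)
    qed
    also have "inv\<^bsub>G\<^esub> (cl e1) \<otimes>\<^bsub>G\<^esub> (inv\<^bsub>G\<^esub> (ev ?w) \<otimes>\<^bsub>G\<^esub> ev ?u) \<otimes>\<^bsub>G\<^esub> cl e2 =
        cl (winv (take t (tr 0 w)) @ take t (tr 0 u))"
      unfolding e1(3) e2(3) using e1(1) e2(1) B
      by (simp add: cl_append cl_winv cl_translate G.inv_mult_group G.m_assoc)
    finally have "\<exists>e\<in>lists A. length e \<le> k \<and> cl e = cl (winv (take t (tr 0 w)) @ take t (tr 0 u))"
      by (rule k)
    moreover have "take t (tr 0 w) \<in> lists A" "take t (tr 0 u) \<in> lists A"
      unfolding e1(3) e2(3) using e1(1) e2(1) B by simp_all
    ultimately show "near k (take t (tr 0 w)) (take t (tr 0 u))" by (simp add: near_iff)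
  qed
  then show ?thesis by blast
qed

end

text \<open>What an automatic structure with uniqueness over the given generators amounts to.  The
  multipliers are left out: they are determined by the language and the constant \<open>k\<close>.\<close>

context presentation
begin

definition standard :: "word set \<Rightarrow> nat \<Rightarrow> bool" where
  "standard L k \<longleftrightarrow> L \<subseteq> lists A \<and>
     (\<forall>w\<in>L. \<forall>u\<in>L. cl w = cl u \<longrightarrow> w = u) \<and> (\<forall>w\<in>lists A. \<exists>u\<in>L. cl u = cl w) \<and>
     (\<forall>w\<in>L. \<forall>u\<in>L. \<forall>a\<in>A. cl (w @ [a]) = cl u \<longrightarrow> fellow k w u)"

lemma standard_structure_nontrivial:
  fixes B :: "nat set"
  assumes aut: "automatic_structure G B \<mu> M Meq Mm" and n: "0 < n"
  obtains N k where "standard (lang N) k" "letters_in N A"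
    "\<And>K. regular (preimage_in G \<mu> (lang M) K) \<Longrightarrow>
       \<exists>NK. lang NK = {w \<in> lang N. cl w \<in> K} \<and> letters_in NK A"
proof -
  interpret automatic G B \<mu> M Meq Mm by unfold_locales (rule aut)
  have "\<exists>w. w \<in> lists A \<and> cl w = \<mu> a" if "a \<in> B" for a
    using mu_in[OF that] unfolding carrier_presented_group by (elim imageE) auto
  then have "\<forall>a\<in>B. \<exists>w. w \<in> lists A \<and> cl w = \<mu> a" by (rule ballI)
  from bchoice[OF this] obtain \<omega> where \<omega>: "\<forall>a\<in>B. \<omega> a \<in> lists A \<and> cl (\<omega> a) = \<mu> a" ..
  \<comment> \<open>an upper bound for the lengths of the chosen words; the successor makes it positive\<close>
  define c where "c = Suc (\<Sum>a\<in>B. length (\<omega> a))"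
  have c: "length (\<omega> a) \<le> c" if "a \<in> B" for a
    using member_le_sum[OF that, of "\<lambda>a. length (\<omega> a)"] finite_B by (simp add: c_def)
  interpret translation n rs B \<mu> M Meq Mm \<omega> c
  proof unfold_locales
    show "0 < n" by (rule n)
    show "0 < c" by (simp add: c_def)
    show "\<omega> a \<in> lists A \<and> length (\<omega> a) \<le> c \<and> cl (\<omega> a) = \<mu> a" if "a \<in> B" for a
      using bspec[OF \<omega> that] c[OF that] by simp
  qed
  let ?L = "tr 0 ` shortlex_language"
  obtain N1 where N1: "lang N1 = shortlex_language" "letters_in N1 B" by (rule regular_shortlex)
  have "shortlex_language \<subseteq> lists B" using shortlex_in_lists by blast
  then obtain N where N: "lang N = ?L" "letters_in N A"
    by (rule regular_translation[of N1, unfolded N1(1)])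
  have cl_tr: "cl (tr 0 w) = ev w" if "w \<in> shortlex_language" for w
    using that by (simp add: cl_translate)
  define k where "k a = (SOME k. \<forall>w\<in>?L. \<forall>u\<in>?L. cl w \<otimes>\<^bsub>G\<^esub> cl [a] = cl u \<longrightarrow> fellow k w u)" for a
  have k: "\<forall>w\<in>?L. \<forall>u\<in>?L. cl w \<otimes>\<^bsub>G\<^esub> cl [a] = cl u \<longrightarrow> fellow (k a) w u" if "a \<in> A" for a
    unfolding k_def by (rule someI_ex, rule translated_fellow) (use that in simp)
  have sub: "?L \<subseteq> lists A" by (intro image_subsetI translate_in shortlex_in_lists)
  have "standard (lang N) (\<Sum>a\<in>A. k a)"
    unfolding standard_def N(1)
  proof (intro conjI sub ballI impI)
    fix w u assume "w \<in> ?L" "u \<in> ?L" "cl w = cl u"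
    then obtain x y where "x \<in> shortlex_language" "y \<in> shortlex_language" "w = tr 0 x" "u = tr 0 y"
      and "cl w = cl u" by blast
    then show "w = u" using cl_tr[of x] cl_tr[of y] shortlex_unique[of x y] by simp
  next
    fix w assume "w \<in> lists A"
    then obtain v where "v \<in> shortlex_language" "ev v = cl w" using shortlex_represents[of "cl w"] by auto
    then show "\<exists>u\<in>?L. cl u = cl w" using cl_tr by auto
  next
    fix w u a assume *: "w \<in> ?L" "u \<in> ?L" "a \<in> A" "cl (w @ [a]) = cl u"
    then have "cl w \<otimes>\<^bsub>G\<^esub> cl [a] = cl u" using sub by (simp add: cl_append subsetD)
    then have "fellow (k a) w u" using k[OF *(3)] * by blast
    then show "fellow (\<Sum>a\<in>A. k a) w u"
      by (rule fellow_mono) (rule member_le_sum, use * in auto)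
  qed
  moreover have "\<exists>NK. lang NK = {w \<in> lang N. cl w \<in> K} \<and> letters_in NK A"
    if reg: "regular (preimage_in G \<mu> (lang M) K)" for K
  proof -
    obtain Q where Q: "lang Q = preimage_in G \<mu> (lang M) K" using reg by (auto simp: regular_def)
    define f where "f w = (state_after N1 w, state_after Q w)" for w
    have mem: "w \<in> shortlex_language \<and> ev w \<in> K \<longleftrightarrow> w \<in> lang N1 \<and> w \<in> lang Q" for w
      using shortlex_language_subset unfolding Q N1 preimage_in_def by blast
    obtain Q1 where Q1: "lang Q1 = {w \<in> shortlex_language. ev w \<in> K}" "letters_in Q1 B"
    proof (rule regular_if_finite_index[where X=B and K="{w \<in> shortlex_language. ev w \<in> K}" and f=f])
      show "finite B" by (rule finite_B)
      show "{w \<in> shortlex_language. ev w \<in> K} \<subseteq> lists B" using shortlex_in_lists by blast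
      have "f ` lists B \<subseteq> insert None (Some ` insert (initial N1) (snd ` set (table N1))) \<times>
          insert None (Some ` insert (initial Q) (snd ` set (table Q)))"
        unfolding f_def by (intro image_subsetI SigmaI run_range)
      then show "finite (f ` lists B)" by (rule finite_subset) simp
      fix x y z assume "f x = f y" and xz: "x @ z \<in> {w \<in> shortlex_language. ev w \<in> K}"
      then have eq: "state_after N1 x = state_after N1 y" "state_after Q x = state_after Q y"
        by (simp_all add: f_def)
      show "y @ z \<in> {w \<in> shortlex_language. ev w \<in> K}"
        using xz lang_append_cong[OF eq(1), of z] lang_append_cong[OF eq(2), of z]
        unfolding mem_Collect_eq mem by blast
    qed (use that in blast)
    have "{w \<in> shortlex_language. ev w \<in> K} \<subseteq> lists B" using shortlex_in_lists by blast
    then obtain NK where NK: "lang NK = tr 0 ` {w \<in> shortlex_language. ev w \<in> K}" "letters_in NK A"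
      by (rule regular_translation[of Q1, unfolded Q1(1)])
    have "tr 0 ` {w \<in> shortlex_language. ev w \<in> K} = {w \<in> ?L. cl w \<in> K}"
      using cl_tr by auto
    with NK show ?thesis unfolding N(1) by auto
  qed
  ultimately show ?thesis using that N(2) by blast
qed

text \<open>Without generators there are no trivial pairs to pad with, but then the group is trivial.\<close>

lemma standard_structure_trivial:
  assumes n: "n = 0"
  obtains N k where "standard (lang N) k" "letters_in N A"
    "\<And>K. \<exists>NK. lang NK = {w \<in> lang N. cl w \<in> K} \<and> letters_in NK A"
proof -
  have A: "A = {}" using n by (simp add: alphabet_def)
  have reg: "\<exists>N. lang N = K \<and> letters_in N A" if "K \<subseteq> {[]}" for K
  proof (rule regular_if_finite_index[where X=A and K=K and f="\<lambda>_. ()"])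
    fix x y z :: word assume "x \<in> lists A" "y \<in> lists A" "x @ z \<in> K"
    then show "y @ z \<in> K" by (simp add: A)
  qed (use that in auto)
  obtain N where N: "lang N = {[]}" "letters_in N A" using reg[of "{[]}"] by blast
  have "standard (lang N) 0" unfolding standard_def N(1) by (auto simp: A)
  moreover have "\<exists>NK. lang NK = {w \<in> lang N. cl w \<in> K} \<and> letters_in NK A" for K
    by (rule reg) (auto simp: N)
  ultimately show ?thesis using that N(2) by blast
qed

theorem standard_structure:
  fixes B :: "nat set"
  assumes aut: "automatic_structure G B \<mu> M Meq Mm"
  obtains N k where "standard (lang N) k" "letters_in N A"
    "\<And>K. regular (preimage_in G \<mu> (lang M) K) \<Longrightarrow>
       \<exists>NK. lang NK = {w \<in> lang N. cl w \<in> K} \<and> letters_in NK A"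
proof (cases "n = 0")
  case True
  obtain N k where "standard (lang N) k" "letters_in N A"
    "\<And>K. \<exists>NK. lang NK = {w \<in> lang N. cl w \<in> K} \<and> letters_in NK A"
    by (rule standard_structure_trivial[OF True]) blast
  then show ?thesis by (rule that)
next
  case False
  then have "0 < n" by simp
  from standard_structure_nontrivial[OF aut this] that show ?thesis by blast
qed

text \<open>The two-tape automata of the structure follow both words in the automaton of the language and
  keep track of their difference.\<close>

lemma regular_tracked:
  fixes M H :: "letter fsa" and P :: "letter padded fsa"
  assumes K: "K \<subseteq> lists PA"
    and inv: "\<And>x y. x \<in> lists PA \<Longrightarrow> y \<in> lists PA \<Longrightarrow> track r P M H x = track r P M H y \<Longrightarrow> x \<in> K \<Longrightarrow> y \<in> K"
  obtains Q where "lang Q = K" "letters_in Q PA"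
proof (rule regular_if_finite_index[where X=PA and K=K and f="track r P M H"])
  have "track r P M H ` lists PA \<subseteq> track_range r P M H" using track_in_range by blast
  then show "finite (track r P M H ` lists PA)" by (rule finite_subset) (rule finite_track_range)
  fix x y z assume xy: "x \<in> lists PA" "y \<in> lists PA" "z \<in> lists PA" "track r P M H x = track r P M H y"
    and "x @ z \<in> K"
  have "track r P M H (x @ z) = track r P M H (y @ z)"
    using xy(3)
  proof (induction z rule: rev_induct)
    case (snoc p z)
    then show ?case using track_snoc[of "x @ z" "y @ z" p r P M H] xy(1,2) by simp
  qed (simp add: xy)
  then show "y @ z \<in> K" using inv[of "x @ z" "y @ z"] xy \<open>x @ z \<in> K\<close> by simp
qed (use K that in auto)

end


section \<open>Computing with words and automata\<close>

text \<open>Record types have no numbering of their own, so the algorithm handles the components of an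
  automaton as a tuple.\<close>

type_synonym 'a machine = "nat \<times> nat list \<times> ((nat \<times> 'a) \<times> nat) list"

definition fsa_of :: "'a machine \<Rightarrow> 'a fsa" where
  "fsa_of m = \<lparr>initial = fst m, final = fst (snd m), table = snd (snd m)\<rparr>"

lemma fsa_of_sel [simp]: "initial (fsa_of m) = fst m" "final (fsa_of m) = fst (snd m)"
  "table (fsa_of m) = snd (snd m)"
  by (simp_all add: fsa_of_def)

text \<open>This is why the search over tuples misses no automaton.\<close>

lemma fsa_of_surj: obtains m where "fsa_of m = M"
  using that[of "(initial M, final M, table M)"] by (simp add: fsa_of_def)

lemma letter_code_enc: "letter_code = enc"
  by (simp add: enc_letter_def fun_eq_iff)

lemma padded_code_enc: "padded_code = enc"
proof
  fix p :: "letter padded"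
  show "padded_code p = enc p"
    by (cases p) (simp only: padded_code.simps enc_prod_def enc_option_def letter_code_enc fst_conv snd_conv)
qed

lemma words_code_enc: "words_code = enc"
proof
  fix vs :: "word list"
  show "words_code vs = enc vs"
    unfolding words_code_def letter_code_enc enc_list_def[of vs]
    by (intro arg_cong[of _ _ list_encode] map_cong refl) (simp_all add: enc_list_def)
qed

lemma fsa_code_enc: "fsa_code enc (fsa_of m) = enc m"
proof -
  have 1: "map (enc :: nat \<Rightarrow> nat) xs = xs" for xs by (simp add: map_idI)
  have 2: "map (\<lambda>((s, a), t). prod_encode (prod_encode (s, enc a), t)) (snd (snd m)) = map enc (snd (snd m))"
    by (rule map_cong) (auto simp: enc_prod_def)
  show ?thesis
    unfolding fsa_code_def fsa_of_sel 2 enc_prod_def[of m] enc_prod_def[of "snd m"]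
      enc_list_def[of "fst (snd m)"] enc_list_def[of "snd (snd m)"] 1 enc_nat_def ..
qed

lemma map_of_conv_foldl:
  "map_of t a = foldl (\<lambda>r e. case r of None \<Rightarrow> if fst e = a then Some (snd e) else None | Some v \<Rightarrow> Some v) None t"
proof -
  have "foldl (\<lambda>r e. case r of None \<Rightarrow> if fst e = a then Some (snd e) else None | Some v \<Rightarrow> Some v) (Some v) t = Some v" for v
    by (induction t) auto
  then show ?thesis by (induction t) auto
qed

lemma run_conv_foldl:
  "run M s w = foldl (\<lambda>r a. case r of None \<Rightarrow> None | Some q \<Rightarrow> map_of (table M) (q, a)) (Some s) w"
proof -
  have "foldl (\<lambda>r a. case r of None \<Rightarrow> None | Some q \<Rightarrow> map_of (table M) (q, a)) None w = None"
    by (induction w) auto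
  then show ?thesis by (induction w arbitrary: s) (auto split: option.splits)
qed

lemma computable_map_of [computable_intros]:
  fixes t :: "'a::coded \<Rightarrow> ('b::coded \<times> 'c::coded) list"
  assumes "computable t" "computable a"
  shows "computable (\<lambda>x. map_of (t x) (a x))"
proof -
  have "computable (\<lambda>p :: 'a \<times> 'c option \<times> 'b \<times> 'c. a (fst p))"
    by (rule computable_comp[OF assms(2)]) (intro computable_intros)
  then show ?thesis unfolding map_of_conv_foldl using assms by (intro computable_intros)
qed

lemma computable_run [computable_intros]:
  fixes m :: "'a::coded \<Rightarrow> 'b::coded machine"
  assumes "computable m" "computable s" "computable w"
  shows "computable (\<lambda>x. run (fsa_of (m x)) (s x) (w x))"
proof -
  have "computable (\<lambda>p :: ('a \<times> nat option \<times> 'b) \<times> nat. m (fst (fst p)))"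
    by (rule computable_comp[OF assms(1)]) (intro computable_intros)
  then show ?thesis unfolding run_conv_foldl fsa_of_sel using assms by (intro computable_intros)
qed

lemma decidable_lang [computable_intros]:
  fixes m :: "'a::coded \<Rightarrow> 'b::coded machine"
  assumes "computable m" "computable w"
  shows "decidable (\<lambda>x. w x \<in> lang (fsa_of (m x)))"
proof -
  have "computable (\<lambda>p :: 'a \<times> nat. m (fst p))" "computable (\<lambda>p :: 'a \<times> nat. w (fst p))"
    by (rule computable_comp[OF assms(1)], intro computable_intros)
       (rule computable_comp[OF assms(2)], intro computable_intros)
  then show ?thesis unfolding in_lang_iff fsa_of_sel using assms by (intro computable_intros)
qed

lemma computable_run_bound [computable_intros]:
  assumes "computable m"
  shows "computable (\<lambda>x. run_bound (fsa_of (m x)))"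
  unfolding run_bound_def fsa_of_sel using assms by (intro computable_intros)

lemma decidable_letters_in [computable_intros]:
  assumes "computable m"
  shows "decidable (\<lambda>x. letters_in (fsa_of (m x)) (set xs))"
proof -
  have eq: "a \<in> set xs \<longleftrightarrow> (\<exists>b\<in>set xs. a = b)" for a by blast
  show ?thesis
    unfolding letters_in_def fsa_of_sel by (subst eq) (intro computable_intros assms)
qed

lemma computable_all_words [computable_intros]:
  assumes "computable t"
  shows "computable (\<lambda>x. all_words xs (t x))"
proof -
  have eq: "all_words xs m = rec_nat [[]] (\<lambda>_ r. [] # concat (map (\<lambda>a. map (\<lambda>w. a # w) r) xs)) m" for m
    by (induction m) auto
  show ?thesis unfolding eq by (intro computable_intros assms)
qed

lemma computable_nth_opt [computable_intros]:
  assumes "computable l" "computable i"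
  shows "computable (\<lambda>x. nth_opt (l x) (i x))"
  unfolding nth_opt_def by (intro computable_intros assms)

lemma computable_pad [computable_intros]:
  fixes w u :: "'a::coded \<Rightarrow> 'b::coded list"
  assumes "computable w" "computable u"
  shows "computable (\<lambda>x. pad (w x) (u x))"
proof -
  have "computable (\<lambda>p :: 'a \<times> nat. w (fst p))" "computable (\<lambda>p :: 'a \<times> nat. u (fst p))"
    by (rule computable_comp[OF assms(1)], intro computable_intros)
       (rule computable_comp[OF assms(2)], intro computable_intros)
  then show ?thesis unfolding pad_conv_map max_def by (intro computable_intros assms)
qed

lemma computable_tape [computable_intros]:
  assumes "computable z"
  shows "computable (\<lambda>x. tape1 (z x))" "computable (\<lambda>x. tape2 (z x))"
  unfolding tape1_def tape2_def by (intro computable_intros assms)+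

lemma decidable_valid [computable_intros]:
  assumes "computable z" shows "decidable (\<lambda>x. valid (z x))"
  unfolding valid_def by (intro computable_intros assms)

lemma decidable_diagonal [computable_intros]:
  assumes "computable z" shows "decidable (\<lambda>x. diagonal (z x))"
  unfolding diagonal_def by (intro computable_intros assms)

lemma computable_winv [computable_intros]:
  assumes "computable w" shows "computable (\<lambda>x. winv (w x))"
proof -
  have "decidable (\<lambda>p :: letter \<times> letter. \<exists>i<Suc (enc (fst p)).
      fst p = Gen i \<and> snd p = GenInv i \<or> fst p = GenInv i \<and> snd p = Gen i)"
  proof -
    have eq: "a = Gen i \<longleftrightarrow> enc a = 2 * i" "a = GenInv i \<longleftrightarrow> enc a = 2 * i + 1" for a i
      using inj_letter_code[THEN injD, of a "Gen i"] inj_letter_code[THEN injD, of a "GenInv i"]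
      by (auto simp: enc_letter_def)
    show ?thesis unfolding eq by (intro computable_intros)
  qed
  moreover have "(\<exists>i<Suc (enc a). a = Gen i \<and> b = GenInv i \<or> a = GenInv i \<and> b = Gen i) \<longleftrightarrow>
      b = inv_letter a" for a b
    by (cases a) (auto simp: enc_letter_def)
  ultimately have "computable inv_letter" by (intro computable_if_graph_decidable) simp
  then have "computable (\<lambda>p :: 'a \<times> letter. inv_letter (snd p))"
    by (rule computable_comp) (intro computable_intros)
  then show ?thesis unfolding winv_def by (intro computable_intros assms)
qed


section \<open>Automatic structures solve the word problem\<close>

context presentation
begin

definition weq :: "word \<Rightarrow> word \<Rightarrow> bool" where
  "weq u v \<longleftrightarrow> u \<in> lists A \<and> v \<in> lists A \<and> cl u = cl v"

lemma weq_cl: "u \<in> lists A \<Longrightarrow> v \<in> lists A \<Longrightarrow> weq u v \<longleftrightarrow> cl u = cl v"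
  by (simp add: weq_def)

lemma standardD:
  assumes "standard L k"
  shows "L \<subseteq> lists A" "\<And>w u. w \<in> L \<Longrightarrow> u \<in> L \<Longrightarrow> cl w = cl u \<Longrightarrow> w = u"
    "\<And>w. w \<in> lists A \<Longrightarrow> \<exists>u\<in>L. cl u = cl w"
    "\<And>w u a. w \<in> L \<Longrightarrow> u \<in> L \<Longrightarrow> a \<in> A \<Longrightarrow> cl (w @ [a]) = cl u \<Longrightarrow> fellow k w u"
proof -
  note std = assms[unfolded standard_def]
  show "L \<subseteq> lists A" using std by (rule conjunct1)
  show "w = u" if "w \<in> L" "u \<in> L" "cl w = cl u" for w u
    using std[THEN conjunct2, THEN conjunct1] that by blast
  show "\<exists>u\<in>L. cl u = cl w" if "w \<in> lists A" for w
    using std[THEN conjunct2, THEN conjunct2, THEN conjunct1] that by (rule bspec)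
  show "fellow k w u" if "w \<in> L" "u \<in> L" "a \<in> A" "cl (w @ [a]) = cl u" for w u a
    using std[THEN conjunct2, THEN conjunct2, THEN conjunct2] that by blast
qed

lemma track_eqD:
  assumes "track r P M H x = track r P M H y"
  shows "x \<in> lang P \<longleftrightarrow> y \<in> lang P"
    "tape1 x \<in> lang M \<longleftrightarrow> tape1 y \<in> lang M" "tape2 x \<in> lang M \<longleftrightarrow> tape2 y \<in> lang M"
    "tape1 x \<in> lang H \<longleftrightarrow> tape1 y \<in> lang H" "tape2 x \<in> lang H \<longleftrightarrow> tape2 y \<in> lang H"
    "valid x \<longleftrightarrow> valid y" "diagonal x \<longleftrightarrow> diagonal y" "close r x \<longleftrightarrow> close r y"
    "close r x \<Longrightarrow> diff x = diff y"
proof -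
  have eqs: "state_after P x = state_after P y"
    "state_after M (tape1 x) = state_after M (tape1 y)" "state_after M (tape2 x) = state_after M (tape2 y)"
    "state_after H (tape1 x) = state_after H (tape1 y)" "state_after H (tape2 x) = state_after H (tape2 y)"
    "valid x \<longleftrightarrow> valid y" "diagonal x \<longleftrightarrow> diagonal y"
    "(if close r x then Some (diff x) else None) = (if close r y then Some (diff y) else None)"
    using assms unfolding track_def by simp_all
  show "x \<in> lang P \<longleftrightarrow> y \<in> lang P"
    "tape1 x \<in> lang M \<longleftrightarrow> tape1 y \<in> lang M" "tape2 x \<in> lang M \<longleftrightarrow> tape2 y \<in> lang M"
    "tape1 x \<in> lang H \<longleftrightarrow> tape1 y \<in> lang H" "tape2 x \<in> lang H \<longleftrightarrow> tape2 y \<in> lang H"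
    "valid x \<longleftrightarrow> valid y" "diagonal x \<longleftrightarrow> diagonal y"
    unfolding in_lang_iff using eqs(1-7) by simp_all
  show "close r x \<longleftrightarrow> close r y" "close r x \<Longrightarrow> diff x = diff y"
    using eqs(8) by (simp_all split: if_splits)
qed

definition multiplication_pairs :: "word set \<Rightarrow> letter \<Rightarrow> letter padded list set" where
  "multiplication_pairs L a = {pad w u | w u. w \<in> L \<and> u \<in> L \<and> cl (w @ [a]) = cl u}"

lemma multiplication_pairs_subset: "L \<subseteq> lists A \<Longrightarrow> multiplication_pairs L a \<subseteq> lists PA"
proof
  fix z assume "L \<subseteq> lists A" "z \<in> multiplication_pairs L a"
  then obtain w u where "z = pad w u" "w \<in> lists A" "u \<in> lists A"
    unfolding multiplication_pairs_def by blast
  then show "z \<in> lists PA" using pad_in_lists_iff[of w u A] by simp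
qed

lemma pad_in_multiplication_pairs:
  "pad w u \<in> multiplication_pairs L a \<longleftrightarrow> w \<in> L \<and> u \<in> L \<and> cl (w @ [a]) = cl u"
  by (auto simp: multiplication_pairs_def)

lemma in_multiplication_pairs_iff:
  "z \<in> multiplication_pairs L a \<longleftrightarrow>
     valid z \<and> tape1 z \<in> L \<and> tape2 z \<in> L \<and> cl (tape1 z @ [a]) = cl (tape2 z)"
proof
  assume "z \<in> multiplication_pairs L a"
  then obtain w u where "z = pad w u" "w \<in> L" "u \<in> L" "cl (w @ [a]) = cl u"
    unfolding multiplication_pairs_def by auto
  then show "valid z \<and> tape1 z \<in> L \<and> tape2 z \<in> L \<and> cl (tape1 z @ [a]) = cl (tape2 z)" by simp
next
  assume *: "valid z \<and> tape1 z \<in> L \<and> tape2 z \<in> L \<and> cl (tape1 z @ [a]) = cl (tape2 z)"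
  then have "z = pad (tape1 z) (tape2 z)" by (simp add: valid_def)
  then show "z \<in> multiplication_pairs L a"
    using * pad_in_multiplication_pairs[of "tape1 z" "tape2 z" L a] by simp
qed

text \<open>By the choice of \<open>k\<close>, closeness is automatic for these pairs.  This is what makes them regular.\<close>

lemma multiplication_pairs_close:
  assumes "standard L k" "a \<in> A" "z \<in> multiplication_pairs L a"
  shows "close k z"
proof -
  obtain w u where "z = pad w u" "w \<in> L" "u \<in> L" "cl (w @ [a]) = cl u"
    using assms(3) unfolding multiplication_pairs_def by auto
  with standardD(4)[OF assms(1) _ _ assms(2)] show ?thesis by (simp add: close_pad)
qed

lemma regular_multiplier:
  assumes std: "standard (lang M) k" and a: "a \<in> A"
  shows "\<exists>P. lang P = multiplication_pairs (lang M) a \<and> letters_in P PA"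
proof (rule regular_tracked[of "multiplication_pairs (lang M) a" k "\<lparr>initial = 0, final = [], table = []\<rparr>" M M])
  show "multiplication_pairs (lang M) a \<subseteq> lists PA"
    by (rule multiplication_pairs_subset[OF standardD(1)[OF std]])
  fix x y
  assume x: "x \<in> lists PA" and y: "y \<in> lists PA"
    and eq: "track k \<lparr>initial = 0, final = [], table = []\<rparr> M M x = track k \<lparr>initial = 0, final = [], table = []\<rparr> M M y"
    and xK: "x \<in> multiplication_pairs (lang M) a"
  note t = track_eqD[OF eq]
  have "diff x = diff y" using t(9) multiplication_pairs_close[OF std a xK] .
  moreover have "[a] \<in> lists A" using a by simp
  ultimately show "y \<in> multiplication_pairs (lang M) a"
    using xK t(2,3,6) diff_eq_iff[OF x, of "[a]"] diff_eq_iff[OF y, of "[a]"]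
    unfolding in_multiplication_pairs_iff by simp
qed blast

text \<open>Normal forms are computed letter by letter, by searching for the unique word that the
  multiplier automaton relates to the current one.\<close>

theorem word_problem_decidable:
  assumes std: "standard (lang N) k"
  shows "decidable (\<lambda>p. weq (fst p) (snd p))"
proof -
  obtain m where m: "fsa_of m = N" by (rule fsa_of_surj)
  note L = standardD(1)[OF std] and uniq = standardD(2)[OF std] and rep = standardD(3)[OF std]
  have "\<exists>P. lang (fsa_of P) = multiplication_pairs (lang N) a" if "a \<in> A" for a
  proof -
    from regular_multiplier[OF std that] obtain P' where "lang P' = multiplication_pairs (lang N) a" by auto
    moreover obtain P where "fsa_of P = P'" by (rule fsa_of_surj)
    ultimately have "lang (fsa_of P) = multiplication_pairs (lang N) a" by simp
    then show ?thesis ..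
  qed
  then have "\<forall>a\<in>A. \<exists>P. lang (fsa_of P) = multiplication_pairs (lang N) a" by (rule ballI)
  from bchoice[OF this] obtain P where P: "\<forall>a\<in>A. lang (fsa_of (P a)) = multiplication_pairs (lang N) a" ..
  define step where "step p = (if snd p \<in> A \<and> fst p \<in> lang N
    then THE u. u \<in> lang N \<and> cl (fst p @ [snd p]) = cl u else [])" for p
  have step: "u = step (w, a) \<longleftrightarrow> u \<in> lang N \<and> cl (w @ [a]) = cl u" if "a \<in> A" "w \<in> lang N" for w a u
  proof -
    have "w @ [a] \<in> lists A" using that L by auto
    then obtain v where v: "v \<in> lang N" "cl v = cl (w @ [a])" using rep by blast
    have "step (w, a) = v" unfolding step_def using that v uniq by (auto intro!: the_equality)
    then show ?thesis using v uniq by auto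
  qed
  \<comment> \<open>finitely many multipliers form a constant table\<close>
  define Ps where "Ps = map (\<lambda>a. (a, P a)) (letters n)"
  have graph: "u = step p \<longleftrightarrow> (if (\<exists>b\<in>set (letters n). snd p = b) \<and> fst p \<in> lang (fsa_of m)
      then \<exists>e\<in>set Ps. fst e = snd p \<and> pad (fst p) u \<in> lang (fsa_of (snd e)) else u = [])" for u p
  proof (cases "snd p \<in> A \<and> fst p \<in> lang N")
    case True
    then have "u = step p \<longleftrightarrow> pad (fst p) u \<in> lang (fsa_of (P (snd p)))"
      using step[of "snd p" "fst p" u] bspec[OF P, of "snd p"] by (simp add: pad_in_multiplication_pairs)
    also have "\<dots> \<longleftrightarrow> (\<exists>e\<in>set Ps. fst e = snd p \<and> pad (fst p) u \<in> lang (fsa_of (snd e)))"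
      using True unfolding Ps_def by auto
    finally show ?thesis using True m by auto
  next
    case False
    have step_Nil: "step p = []" unfolding step_def by (rule if_not_P[OF False])
    have no_step: "\<not> ((\<exists>b\<in>set (letters n). snd p = b) \<and> fst p \<in> lang (fsa_of m))" using False m by auto
    show ?thesis unfolding if_not_P[OF no_step] step_Nil ..
  qed
  have "decidable (\<lambda>q :: (word \<times> letter) \<times> word. snd q = step (fst q))"
    unfolding graph by (intro decidable_if computable_intros)
  then have comp_step: "computable step" by (rule computable_if_graph_decidable)
  obtain w0 where w0: "w0 \<in> lang N" "cl w0 = cl []" using rep[of "[]"] by auto
  define nf where "nf u = foldl (\<lambda>w a. step (w, a)) w0 u" for u
  have nf: "nf u \<in> lang N \<and> cl (nf u) = cl u" if "u \<in> lists A" for u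
    using that
  proof (induction u rule: rev_induct)
    case (snoc a u)
    then have u: "nf u \<in> lang N" "cl (nf u) = cl u" "a \<in> A" "u \<in> lists A" by auto
    have nf_snoc: "nf (u @ [a]) = step (nf u, a)" by (simp add: nf_def)
    have "nf (u @ [a]) \<in> lang N \<and> cl (nf u @ [a]) = cl (nf (u @ [a]))"
      using step[OF u(3,1), of "nf (u @ [a])"] nf_snoc by simp
    moreover have "cl (nf u @ [a]) = cl (u @ [a])" using u L by (subst (1 2) cl_append) auto
    ultimately show ?case by simp
  qed (simp add: nf_def w0)
  have step': "computable (\<lambda>p :: (word \<times> word) \<times> word \<times> letter. step (fst (snd p), snd (snd p)))"
    by (rule computable_comp[OF comp_step]) (intro computable_intros)
  have nf_comp: "computable (\<lambda>p :: word \<times> word. nf (fst p))" "computable (\<lambda>p :: word \<times> word. nf (snd p))"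
    unfolding nf_def by (intro step' computable_intros)+
  have "weq u v \<longleftrightarrow> (\<forall>a\<in>set u. \<exists>b\<in>set (letters n). a = b) \<and> (\<forall>a\<in>set v. \<exists>b\<in>set (letters n). a = b) \<and> nf u = nf v"
    for u v
  proof (cases "u \<in> lists A \<and> v \<in> lists A")
    case True
    then have "cl u = cl v \<longleftrightarrow> nf u = nf v" using nf[of u] nf[of v] uniq[of "nf u" "nf v"] by auto
    with True show ?thesis by (auto simp: weq_def in_lists_conv_set)
  qed (auto simp: weq_def in_lists_conv_set)
  then show ?thesis by (simp only:) (intro computable_intros nf_comp)
qed

end


lemma (in group) cancel_middle:
  assumes x: "x \<in> carrier G" and y: "y \<in> carrier G" and a: "a \<in> carrier G"
    and c: "c \<in> carrier G" and z: "z \<in> carrier G"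
  shows "x \<otimes> inv y \<otimes> (y \<otimes> (a \<otimes> c)) \<otimes> inv (z \<otimes> c) = x \<otimes> a \<otimes> inv z"
proof -
  have "inv y \<otimes> (y \<otimes> (a \<otimes> c)) = a \<otimes> c"
    using y a c by (simp add: m_assoc[symmetric])
  then have 1: "x \<otimes> inv y \<otimes> (y \<otimes> (a \<otimes> c)) = x \<otimes> a \<otimes> c"
    using x y a c by (simp add: m_assoc)
  have 2: "c \<otimes> inv (z \<otimes> c) = inv z"
    using c z by (simp add: inv_mult_group m_assoc[symmetric])
  show ?thesis
    unfolding 1 using 2 x a c z by (simp add: m_assoc)
qed

section \<open>A semidecidable test for structures\<close>

context presentation
begin

definition padded_letters :: "letter padded list" where
  "padded_letters = List.product (None # map Some (letters n)) (None # map Some (letters n))"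

lemma set_padded_letters [simp]: "set padded_letters = PA"
  by (simp only: padded_letters_def padded_alphabet_def set_product list.set set_map set_letters)

text \<open>The tests are phrased with the decidable \<^const>\<open>weq\<close> and with quantifiers over finite lists of words.\<close>

definition close_test :: "nat \<Rightarrow> letter padded list \<Rightarrow> bool" where
  "close_test r z \<longleftrightarrow> (\<forall>t\<in>set [0..<Suc (length z)]. \<exists>e\<in>set (all_words (letters n) r).
     weq (tape1 (take t z) @ e) (tape2 (take t z)))"

lemma take_PA: "z \<in> lists PA \<Longrightarrow> take t z \<in> lists PA"
  by (auto simp: in_lists_conv_set dest: in_set_takeD)

lemma close_test_eq:
  assumes z: "z \<in> lists PA" shows "close_test r z \<longleftrightarrow> close r z"
proof -
  have "(\<exists>e\<in>set (all_words (letters n) r). weq (tape1 (take t z) @ e) (tape2 (take t z))) \<longleftrightarrow>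
      near r (tape1 (take t z)) (tape2 (take t z))" for t
    using tape_in_lists[OF take_PA[OF z, of t]] unfolding near_def set_all_words set_letters
    by (auto simp: weq_def)
  then show ?thesis unfolding close_test_def close_def by (auto simp: less_Suc_eq_le)
qed

text \<open>The conditions on single pairs: the equality automaton accepts the diagonal of the language, the
  subgroup automaton accepts only words of the language, and pairs that stay close satisfy local
  uniqueness and invariance under the generators of the subgroup.\<close>

definition language_test where
  "language_test r vs M Meq H z \<longleftrightarrow>
     (z \<in> lang Meq \<longleftrightarrow> valid z \<and> diagonal z \<and> tape1 z \<in> lang M) \<and>
     (valid z \<and> diagonal z \<and> tape1 z \<in> lang H \<longrightarrow> tape1 z \<in> lang M) \<and>
     (valid z \<and> tape1 z \<in> lang M \<and> tape2 z \<in> lang M \<and> close_test r z \<longrightarrow>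
        (weq (tape1 z) (tape2 z) \<longrightarrow> diagonal z) \<and>
        (\<forall>v\<in>set vs. weq (tape1 z @ v) (tape2 z) \<longrightarrow> (tape1 z \<in> lang H \<longleftrightarrow> tape2 z \<in> lang H)))"

definition multiplier_test where
  "multiplier_test k M P a z \<longleftrightarrow>
     (z \<in> lang P \<longleftrightarrow> valid z \<and> tape1 z \<in> lang M \<and> tape2 z \<in> lang M \<and> close_test k z \<and>
        weq (tape1 z @ [a]) (tape2 z))"

text \<open>Large enough to cover, in this order, backtracking along a letter, moving along a relator, moving
  along a generator of the subgroup, and passing from one short completion to the next.  The sums bound
  the maxima.\<close>

definition radius :: "word list \<Rightarrow> letter fsa \<Rightarrow> nat \<Rightarrow> nat" where
  "radius vs M k = 2 * k + k * sum_list (map length rs) + k * sum_list (map length vs) +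
     (2 * run_bound M + 1) * (k + 1)"

definition product_of_generators :: "word list \<Rightarrow> word \<Rightarrow> bool" where
  "product_of_generators vs w \<longleftrightarrow>
     (\<exists>es. (\<forall>e\<in>set es. (\<exists>v\<in>set vs. e = v) \<or> (\<exists>v\<in>set vs. e = winv v)) \<and> weq w (concat es))"

text \<open>All quantifiers except those in \<^const>\<open>product_of_generators\<close> and over partners \<open>u\<close> and the identity
  word are bounded.  The unbounded ones are existential, so the whole test is semidecidable.\<close>

definition passes where
  "passes vs M Meq Mult H k \<longleftrightarrow>
     letters_in M A \<and> letters_in Meq PA \<and> letters_in H A \<and>
     (\<forall>z\<in>set (all_words padded_letters (track_bound (radius vs M k) Meq M H)).
        language_test (radius vs M k) vs M Meq H z) \<and>
     (\<forall>a\<in>A. letters_in (Mult a) PA \<and>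
        (\<forall>z\<in>set (all_words padded_letters (track_bound k (Mult a) M H)). multiplier_test k M (Mult a) a z)) \<and>
     (\<forall>a\<in>A. \<forall>w\<in>set (all_words (letters n) (run_bound M * 2 ^ run_bound (Mult a))).
        w \<in> lang M \<longrightarrow> (\<exists>u. pad w u \<in> lang (Mult a))) \<and>
     (\<forall>w\<in>set (all_words (letters n) (2 * run_bound H + 1)). w \<in> lang H \<longrightarrow> product_of_generators vs w) \<and>
     (\<exists>w. w \<in> lang H \<and> weq w [])"


section \<open>Structures that pass the test are correct\<close>

text \<open>Since \<^term>\<open>track\<close> can be computed letter by letter, short words realize all its values.\<close>

lemma tracked_all:
  assumes short: "\<forall>z\<in>set (all_words padded_letters (track_bound r P M H)). Q z"
    and inv: "\<And>x y. x \<in> lists PA \<Longrightarrow> y \<in> lists PA \<Longrightarrow> track r P M H x = track r P M H y \<Longrightarrow> Q x \<Longrightarrow> Q y"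
    and z: "z \<in> lists PA"
  shows "Q z"
proof (rule all_short_words_suffice[where X=PA and f="track r P M H" and F="track_range r P M H"
      and T="track_bound r P M H" and P=Q])
  show "Q x" if "x \<in> lists PA" "length x \<le> track_bound r P M H" for x
    using short that by (simp add: set_all_words)
qed (fact inv z finite_track_range card_track_range | erule (3) track_snoc | erule track_in_range)+

lemma weq_tapes:
  assumes z: "z \<in> lists PA" and v: "v \<in> lists A"
  shows "weq (tape1 z @ v) (tape2 z) \<longleftrightarrow> diff z = cl v"
  using tape_in_lists[OF z] v diff_eq_iff[OF z v] by (simp add: weq_def)

lemma language_test_all:
  assumes "\<forall>z\<in>set (all_words padded_letters (track_bound r Meq M H)). language_test r vs M Meq H z"
    and vs: "set vs \<subseteq> lists A" and z: "z \<in> lists PA"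
  shows "language_test r vs M Meq H z"
proof (rule tracked_all[OF assms(1) _ z])
  fix x y assume x: "x \<in> lists PA" and y: "y \<in> lists PA" and eq: "track r Meq M H x = track r Meq M H y"
    and test: "language_test r vs M Meq H x"
  note t = track_eqD[OF eq]
  have w: "weq (tape1 x @ v) (tape2 x) \<longleftrightarrow> weq (tape1 y @ v) (tape2 y)" if "v \<in> lists A" "close r x" for v
    unfolding weq_tapes[OF x that(1)] weq_tapes[OF y that(1)] t(9)[OF that(2)] ..
  show "language_test r vs M Meq H y"
  proof (cases "close r x")
    case True
    have "weq (tape1 x) (tape2 x) \<longleftrightarrow> weq (tape1 y) (tape2 y)" using w[of "[]"] True by simp
    moreover have "(\<forall>v\<in>set vs. weq (tape1 x @ v) (tape2 x) \<longrightarrow> (tape1 x \<in> lang H \<longleftrightarrow> tape2 x \<in> lang H)) \<longleftrightarrow>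
        (\<forall>v\<in>set vs. weq (tape1 y @ v) (tape2 y) \<longrightarrow> (tape1 x \<in> lang H \<longleftrightarrow> tape2 x \<in> lang H))"
      by (intro ball_cong refl) (use w True vs in auto)
    ultimately show ?thesis
      using test unfolding language_test_def close_test_eq[OF x] close_test_eq[OF y] t(1-8) by argo
  next
    case False
    then show ?thesis
      using test unfolding language_test_def close_test_eq[OF x] close_test_eq[OF y] t(1-8) by argo
  qed
qed

lemma multiplier_test_all:
  fixes H :: "letter fsa"
  assumes "\<forall>z\<in>set (all_words padded_letters (track_bound k P M H)). multiplier_test k M P a z"
    and a: "a \<in> A" and z: "z \<in> lists PA"
  shows "multiplier_test k M P a z"
proof (rule tracked_all[OF assms(1) _ z])
  fix x y assume x: "x \<in> lists PA" and y: "y \<in> lists PA" and eq: "track k P M H x = track k P M H y"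
    and test: "multiplier_test k M P a x"
  note t = track_eqD[OF eq]
  have a': "[a] \<in> lists A" using a by simp
  have "weq (tape1 x @ [a]) (tape2 x) \<longleftrightarrow> weq (tape1 y @ [a]) (tape2 y)" if "close k x"
    unfolding weq_tapes[OF x a'] weq_tapes[OF y a'] t(9)[OF that] ..
  then show "multiplier_test k M P a y"
    using test unfolding multiplier_test_def close_test_eq[OF x] close_test_eq[OF y] t(1-8) by argo
qed

text \<open>Whether a word has a partner depends on its state and on the set of states that the two-tape
  automaton can be in after reading the word on its first tape.\<close>

lemma partner_for_all:
  assumes short: "\<forall>w\<in>set (all_words (letters n) (run_bound M * 2 ^ run_bound P)).
      w \<in> lang M \<longrightarrow> (\<exists>u. pad w u \<in> lang P)"
    and P: "letters_in P PA" "\<And>z. z \<in> lang P \<Longrightarrow> valid z"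
    and w: "w \<in> lists A" "w \<in> lang M"
  shows "\<exists>u. pad w u \<in> lang P"
proof -
  define f where "f x = (state_after M x, (state_after P) ` padded_over A x)" for x
  define F where "F = insert None (Some ` insert (initial M) (snd ` set (table M))) \<times>
    Pow (insert None (Some ` insert (initial P) (snd ` set (table P))))"
  have "w \<in> lang M \<longrightarrow> (\<exists>u. pad w u \<in> lang P)"
  proof (rule all_short_words_suffice[where X=A and f=f and F=F and T="run_bound M * 2 ^ run_bound P"
        and P="\<lambda>w. w \<in> lang M \<longrightarrow> (\<exists>u. pad w u \<in> lang P)"])
    fix x y a assume "f x = f y"
    then have M: "state_after M x = state_after M y"
      and PP: "state_after P ` padded_over A x = state_after P ` padded_over A y" by (simp_all add: f_def)
    have sub: "state_after P ` padded_over A (x @ [a]) \<subseteq> state_after P ` padded_over A (y @ [a])"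
      if PP: "state_after P ` padded_over A x = state_after P ` padded_over A y" for x y
    proof (rule image_subsetI)
      fix z assume "z \<in> padded_over A (x @ [a])"
      then obtain z1 z2 where z: "z = z1 @ z2" "z1 \<in> padded_over A x" "z2 \<in> padded_over A [a]"
        unfolding padded_over_append by blast
      have "state_after P z1 \<in> state_after P ` padded_over A y" unfolding PP[symmetric] using z(2) by (rule imageI)
      then obtain z1' where z1': "z1' \<in> padded_over A y" "state_after P z1 = state_after P z1'" by (rule imageE)
      have "z1' @ z2 \<in> padded_over A (y @ [a])" unfolding padded_over_append using z1'(1) z(3) by blast
      moreover have "state_after P z = state_after P (z1' @ z2)" unfolding z(1) run_append z1'(2) ..
      ultimately show "state_after P z \<in> state_after P ` padded_over A (y @ [a])" by (rule rev_image_eqI)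
    qed
    show "f (x @ [a]) = f (y @ [a])"
      unfolding f_def using sub[OF PP] sub[OF PP[symmetric]] M by (simp add: run_append subset_antisym)
  next
    fix x
    show "f x \<in> F"
      unfolding f_def F_def by (intro SigmaI run_range PowI image_subsetI)
  next
    show "finite F" unfolding F_def by simp
    show "card F \<le> run_bound M * 2 ^ run_bound P"
      unfolding F_def card_cartesian_product
    proof (intro mult_le_mono card_run_range)
      let ?S = "insert None (Some ` insert (initial P) (snd ` set (table P)))"
      have "card (Pow ?S) = 2 ^ card ?S" by (rule card_Pow) simp
      also have "\<dots> \<le> 2 ^ run_bound P" by (rule power_increasing[OF card_run_range]) simp
      finally show "card (Pow ?S) \<le> 2 ^ run_bound P" .
    qed
  next
    fix x y assume "f x = f y" and x: "x \<in> lang M \<longrightarrow> (\<exists>u. pad x u \<in> lang P)"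
    then have M: "state_after M x = state_after M y"
      and PP: "state_after P ` padded_over A x = state_after P ` padded_over A y" by (simp_all add: f_def)
    show "y \<in> lang M \<longrightarrow> (\<exists>u. pad y u \<in> lang P)"
    proof
      assume "y \<in> lang M"
      then have "x \<in> lang M" using M by (simp add: in_lang_iff)
      with x obtain u where u: "pad x u \<in> lang P" by blast
      define z1 z2 where "z1 = take (length x) (pad x u)" and "z2 = drop (length x) (pad x u)"
      have z: "z1 @ z2 \<in> lang P" using u by (simp add: z1_def z2_def)
      have "z1 @ z2 \<in> lists PA" using z lang_subset_lists[OF P(1)] by blast
      then have "z1 \<in> lists PA" by simp
      moreover have "map fst z1 = map Some x" by (simp add: z1_def map_fst_pad_take)
      ultimately have "z1 \<in> padded_over A x" unfolding padded_over_def by blast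
      then have "state_after P z1 \<in> state_after P ` padded_over A y" unfolding PP[symmetric] by (rule imageI)
      then obtain z1' where z1': "z1' \<in> padded_over A y" "state_after P z1 = state_after P z1'" by (rule imageE)
      have z': "z1' @ z2 \<in> lang P" using z lang_append_cong[OF z1'(2), of z2] by simp
      have "tape1 q = y" if "map fst q = map Some y" for q :: "letter padded list" and y
        using that by (induction q arbitrary: y) (auto simp: tape1_def)
      then have "tape1 z1' = y" using z1'(1) unfolding padded_over_def by blast
      moreover have "tape1 z2 = []"
      proof -
        have "\<forall>p\<in>set z2. fst p = None" unfolding z2_def using fst_drop_pad by blast
        then show ?thesis by (simp add: tape1_def)
      qed
      ultimately have "tape1 (z1' @ z2) = y" by simp
      moreover have "pad (tape1 (z1' @ z2)) (tape2 (z1' @ z2)) = z1' @ z2"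
        using P(2)[OF z'] unfolding valid_def .
      ultimately show "\<exists>u. pad y u \<in> lang P" using z' by metis
    qed
  next
    fix x assume "x \<in> lists A" "length x \<le> run_bound M * 2 ^ run_bound P"
    then show "x \<in> lang M \<longrightarrow> (\<exists>u. pad x u \<in> lang P)" using short by (simp add: set_all_words)
  qed (rule w)
  with w show ?thesis by blast
qed

text \<open>Two short words that lead to the same state have a common short completion, hence lie in the
  same coset of the subgroup.  Replacing a prefix, letter by letter, by a short word that leads to the same
  state extends this to all accepted words.\<close>

lemma language_in_subgroup:
  assumes K: "subgroup K G" and H: "lang H \<subseteq> lists A"
    and short: "\<And>w. w \<in> lang H \<Longrightarrow> length w \<le> 2 * run_bound H + 1 \<Longrightarrow> cl w \<in> K"
    and w: "w \<in> lang H"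
  shows "cl w \<in> K"
proof -
  interpret K: subgroup K G by (rule K)
  have completion: "\<exists>c. length c \<le> run_bound H \<and> x @ c \<in> lang H" if xy: "x @ y \<in> lang H" for x y
  proof -
    obtain s q where s: "state_after H x = Some s" "run H s y = Some q" "q \<in> set (final H)"
      using xy by (auto simp: in_lang_iff run_append bind_eq_Some_conv)
    obtain c where "length c \<le> run_bound H" "run H s c = Some q" by (rule run_small_model[OF s(2)])
    then show ?thesis using s by (auto simp: in_lang_iff run_append)
  qed
  have A: "x \<in> lists A" "y \<in> lists A" if "x @ y \<in> lang H" for x y
    using subsetD[OF H that] by simp_all
  have main: "cl x \<otimes>\<^bsub>G\<^esub> inv\<^bsub>G\<^esub> (cl x') \<in> K"
    if "x @ y \<in> lang H" "state_after H x = state_after H x'" "length x' \<le> run_bound H" for x y x'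
    using that
  proof (induction x arbitrary: y x' rule: rev_induct)
    case Nil
    obtain c where c: "length c \<le> run_bound H" "[] @ c \<in> lang H" using completion[OF Nil(1)] by blast
    have c': "x' @ c \<in> lang H" using c(2) lang_append_cong[OF Nil(2), of c] by simp
    have "cl c \<in> K" using short[of c] c by simp
    moreover have "cl (x' @ c) \<in> K" using short[OF c'] c(1) Nil(3) by simp
    ultimately have "cl c \<otimes>\<^bsub>G\<^esub> inv\<^bsub>G\<^esub> (cl (x' @ c)) \<in> K" by simp
    also have "cl c \<otimes>\<^bsub>G\<^esub> inv\<^bsub>G\<^esub> (cl (x' @ c)) = cl [] \<otimes>\<^bsub>G\<^esub> inv\<^bsub>G\<^esub> (cl x')"
      using A[OF c'] by (simp add: cl_append cl_Nil G.inv_mult_group G.m_assoc[symmetric])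
    finally show ?case .
  next
    case (snoc a x)
    have xy: "x @ (a # y) \<in> lang H" using snoc.prems(1) by simp
    obtain s where s: "state_after H x = Some s" using xy by (auto simp: in_lang_iff run_append bind_eq_Some_conv)
    obtain x0 where x0: "length x0 \<le> run_bound H" "state_after H x0 = Some s" by (rule run_small_model[OF s])
    have eq0: "state_after H x = state_after H x0" using s x0 by simp
    have IH: "cl x \<otimes>\<^bsub>G\<^esub> inv\<^bsub>G\<^esub> (cl x0) \<in> K" by (rule snoc.IH[OF xy eq0 x0(1)])
    obtain c where c: "length c \<le> run_bound H" "(x @ [a]) @ c \<in> lang H"
      using completion[OF snoc.prems(1)] by blast
    have c': "x' @ c \<in> lang H" using c(2) lang_append_cong[OF snoc.prems(2), of c] by simp
    have c0: "x0 @ (a # c) \<in> lang H" using c(2) lang_append_cong[OF eq0, of "a # c"] by simp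
    have "cl (x0 @ (a # c)) \<in> K" using short[OF c0] c(1) x0(1) by simp
    moreover have "cl (x' @ c) \<in> K" using short[OF c'] c(1) snoc.prems(3) by simp
    ultimately have "cl x \<otimes>\<^bsub>G\<^esub> inv\<^bsub>G\<^esub> (cl x0) \<otimes>\<^bsub>G\<^esub> cl (x0 @ (a # c)) \<otimes>\<^bsub>G\<^esub> inv\<^bsub>G\<^esub> (cl (x' @ c)) \<in> K"
      using IH by simp
    also have "cl x \<otimes>\<^bsub>G\<^esub> inv\<^bsub>G\<^esub> (cl x0) \<otimes>\<^bsub>G\<^esub> cl (x0 @ (a # c)) \<otimes>\<^bsub>G\<^esub> inv\<^bsub>G\<^esub> (cl (x' @ c)) =
        cl (x @ [a]) \<otimes>\<^bsub>G\<^esub> inv\<^bsub>G\<^esub> (cl x')"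
    proof -
      have in_A: "x \<in> lists A" "x0 \<in> lists A" "[a] \<in> lists A" "c \<in> lists A" "x' \<in> lists A"
        using A[OF c0] A[OF c'] A[OF xy] by simp_all
      have 1: "cl (x0 @ (a # c)) = cl x0 \<otimes>\<^bsub>G\<^esub> (cl [a] \<otimes>\<^bsub>G\<^esub> cl c)"
        using in_A cl_append[of x0 "a # c"] cl_append[of "[a]" c] by simp
      have 2: "cl (x' @ c) = cl x' \<otimes>\<^bsub>G\<^esub> cl c" "cl (x @ [a]) = cl x \<otimes>\<^bsub>G\<^esub> cl [a]"
        by (rule cl_append[OF in_A(5,4)]) (rule cl_append[OF in_A(1,3)])
      show ?thesis
        unfolding 1 2 by (rule G.cancel_middle) (rule in_A[THEN cl_in])+
    qed
    finally show ?case .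
  qed
  obtain s where s: "state_after H w = Some s" "s \<in> set (final H)" using w by (auto simp: in_lang_iff)
  obtain w' where w': "length w' \<le> run_bound H" "state_after H w' = Some s" by (rule run_small_model[OF s(1)])
  have w'H: "w' \<in> lang H" using w' s by (auto simp: in_lang_iff)
  have "cl w \<otimes>\<^bsub>G\<^esub> inv\<^bsub>G\<^esub> (cl w') \<in> K" using main[of w "[]" w'] w w' s by simp
  moreover have "cl w' \<in> K" using short[OF w'H] w'(1) by simp
  ultimately have "cl w \<otimes>\<^bsub>G\<^esub> inv\<^bsub>G\<^esub> (cl w') \<otimes>\<^bsub>G\<^esub> cl w' \<in> K" by simp
  then show ?thesis
    using cl_in[OF subsetD[OF H w]] cl_in[OF subsetD[OF H w'H]] by (simp add: G.m_assoc)
qed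

lemma product_of_generators_iff:
  assumes vs: "set vs \<subseteq> lists A"
  shows "product_of_generators vs w \<longleftrightarrow> w \<in> lists A \<and> cl w \<in> generate G (cl ` set vs)"
proof -
  let ?gen = "\<lambda>es. \<forall>e\<in>set es. (\<exists>v\<in>set vs. e = v) \<or> (\<exists>v\<in>set vs. e = winv v)"
  let ?K = "generate G (cl ` set vs)"
  have sub: "cl ` set vs \<subseteq> carrier G" using vs by (intro image_subsetI cl_in) blast
  interpret K: subgroup ?K G by (rule G.generate_is_subgroup[OF sub])
  have gen_in: "concat es \<in> lists A \<and> cl (concat es) \<in> ?K" if "?gen es" for es
    using that
  proof (induction es)
    case Nil
    then show ?case by (simp add: cl_Nil)
  next
    case (Cons e es)
    have e: "e \<in> lists A \<and> cl e \<in> ?K"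
    proof -
      consider v where "v \<in> set vs" "e = v" | v where "v \<in> set vs" "e = winv v" using Cons.prems by auto
      then show ?thesis
      proof cases
        case 1
        then show ?thesis using vs by (auto intro: generate.incl)
      next
        case 2
        have "v \<in> lists A" using 2 vs by blast
        then show ?thesis using 2 by (auto simp: cl_winv intro: generate.inv)
      qed
    qed
    then show ?case using Cons by (simp add: cl_append)
  qed
  have gen_ex: "\<exists>es. ?gen es \<and> cl (concat es) = g" if "g \<in> ?K" for g
    using that
  proof (induction rule: generate.induct)
    case one
    show ?case by (rule exI[of _ "[]"]) (simp add: cl_Nil)
  next
    case (incl h)
    then obtain v where "v \<in> set vs" "h = cl v" by blast
    then show ?case by (intro exI[of _ "[v]"]) simp
  next
    case (inv h)
    then obtain v where v: "v \<in> set vs" "h = cl v" by blast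
    then have "v \<in> lists A" using vs by blast
    with v show ?case by (intro exI[of _ "[winv v]"]) (auto simp: cl_winv)
  next
    case (eng h1 h2)
    then obtain es1 es2 where es: "?gen es1" "cl (concat es1) = h1" "?gen es2" "cl (concat es2) = h2" by blast
    have "cl (concat (es1 @ es2)) = h1 \<otimes>\<^bsub>G\<^esub> h2"
      using gen_in[OF es(1)] gen_in[OF es(3)] es(2,4) by (simp add: cl_append)
    moreover have "?gen (es1 @ es2)" using es by auto
    ultimately show ?case by blast
  qed
  show ?thesis
  proof
    assume "product_of_generators vs w"
    then obtain es where es: "?gen es" "weq w (concat es)" unfolding product_of_generators_def by blast
    then show "w \<in> lists A \<and> cl w \<in> ?K" using gen_in[OF es(1)] by (simp add: weq_def)
  next
    assume w: "w \<in> lists A \<and> cl w \<in> ?K"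
    then obtain es where es: "?gen es" "cl (concat es) = cl w" using gen_ex[of "cl w"] by blast
    then have "weq w (concat es)" using gen_in[OF es(1)] w by (simp add: weq_def)
    then show "product_of_generators vs w" unfolding product_of_generators_def using es(1) by blast
  qed
qed

end


context presentation
begin

context
  fixes vs :: "word list" and M H :: "letter fsa" and Meq :: "letter padded fsa"
    and Mult :: "letter \<Rightarrow> letter padded fsa" and k :: nat
  assumes vs: "set vs \<subseteq> lists A" and passes: "passes vs M Meq Mult H k"
begin

lemma passes_letters: "letters_in M A" "letters_in Meq PA" "letters_in H A"
    "a \<in> A \<Longrightarrow> letters_in (Mult a) PA"
  using passes unfolding passes_def by simp_all

lemma passes_language:
  assumes "z \<in> lists PA" shows "language_test (radius vs M k) vs M Meq H z"
proof -
  have "\<forall>z\<in>set (all_words padded_letters (track_bound (radius vs M k) Meq M H)).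
      language_test (radius vs M k) vs M Meq H z"
    using passes unfolding passes_def by (elim conjE)
  then show ?thesis by (rule language_test_all[OF _ vs assms])
qed

lemma passes_multiplier:
  assumes "a \<in> A" "z \<in> lists PA" shows "multiplier_test k M (Mult a) a z"
proof (rule multiplier_test_all[OF _ assms])
  show "\<forall>z\<in>set (all_words padded_letters (track_bound k (Mult a) M H)). multiplier_test k M (Mult a) a z"
    using passes assms(1) unfolding passes_def by simp
qed

lemma M_words: "w \<in> lang M \<Longrightarrow> w \<in> lists A"
  using lang_subset_lists[OF passes_letters(1)] by blast

lemma H_words: "w \<in> lang H \<Longrightarrow> w \<in> lists A"
  using lang_subset_lists[OF passes_letters(3)] by blast

lemma pad_PA: "w \<in> lists A \<Longrightarrow> u \<in> lists A \<Longrightarrow> pad w u \<in> lists PA"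
  by (simp only: pad_in_lists_iff)

lemma H_subset: "w \<in> lang H \<Longrightarrow> w \<in> lang M"
  using passes_language[OF pad_PA[OF H_words H_words], of w w]
  by (simp add: language_test_def diagonal_pad)

lemma lang_Meq: "lang Meq = {pad w w | w. w \<in> lang M}"
proof (intro equalityI subsetI)
  fix z assume z: "z \<in> lang Meq"
  then have "z \<in> lists PA" using lang_subset_lists[OF passes_letters(2)] by blast
  from passes_language[OF this] z have "valid z" "diagonal z" "tape1 z \<in> lang M"
    by (simp_all add: language_test_def)
  moreover have "z = pad (tape1 z) (tape2 z)" using \<open>valid z\<close> by (simp add: valid_def)
  ultimately show "z \<in> {pad w w | w. w \<in> lang M}" using diagonal_pad[of "tape1 z" "tape2 z"] by auto
next
  fix z assume "z \<in> {pad w w | w. w \<in> lang M}"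
  then obtain w where w: "z = pad w w" "w \<in> lang M" by blast
  then show "z \<in> lang Meq"
    using passes_language[OF pad_PA[OF M_words M_words], of w w]
    by (simp add: language_test_def diagonal_pad)
qed

lemma pad_in_Mult:
  assumes "a \<in> A" "w \<in> lists A" "u \<in> lists A"
  shows "pad w u \<in> lang (Mult a) \<longleftrightarrow> w \<in> lang M \<and> u \<in> lang M \<and> fellow k w u \<and> cl (w @ [a]) = cl u"
  using passes_multiplier[OF assms(1) pad_PA[OF assms(2,3)]] close_test_eq[OF pad_PA[OF assms(2,3)]] assms
  by (simp add: multiplier_test_def close_pad weq_def)

lemma valid_Mult: "a \<in> A \<Longrightarrow> z \<in> lang (Mult a) \<Longrightarrow> valid z"
  using passes_multiplier[of a z] lang_subset_lists[OF passes_letters(4), of a]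
  by (auto simp: multiplier_test_def simp del: in_lists_conv_set)

text \<open>The first local condition: the test on short words ensures that every word has a partner on
  the second tape, and the multiplier automaton accepts only pairs that stay close.\<close>

lemma partner:
  assumes a: "a \<in> A" and w: "w \<in> lang M"
  shows "\<exists>u\<in>lang M. cl (w @ [a]) = cl u \<and> fellow k w u"
proof -
  have short: "\<forall>w\<in>set (all_words (letters n) (run_bound M * 2 ^ run_bound (Mult a))).
      w \<in> lang M \<longrightarrow> (\<exists>u. pad w u \<in> lang (Mult a))"
    using passes a unfolding passes_def by simp
  have "\<exists>u. pad w u \<in> lang (Mult a)"
    by (rule partner_for_all[OF short passes_letters(4)[OF a] valid_Mult[OF a] M_words[OF w] w])
  then obtain u where u: "pad w u \<in> lang (Mult a)" by blast
  then have "pad w u \<in> lists PA" using lang_subset_lists[OF passes_letters(4)[OF a]] by blast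
  then have "u \<in> lists A" by (simp only: pad_in_lists_iff)
  with u show ?thesis unfolding pad_in_Mult[OF a M_words[OF w] \<open>u \<in> lists A\<close>] by blast
qed

lemma M_neighbours: "neighbours_within k (lang M)"
  unfolding neighbours_within_def using partner by blast

lemma language_test_pad:
  assumes "w \<in> lang M" "u \<in> lang M" "fellow (radius vs M k) w u"
  shows "cl w = cl u \<Longrightarrow> w = u"
    "v \<in> set vs \<Longrightarrow> cl (w @ v) = cl u \<Longrightarrow> w \<in> lang H \<longleftrightarrow> u \<in> lang H"
proof -
  have wu: "w \<in> lists A" "u \<in> lists A" using assms M_words by auto
  have "language_test (radius vs M k) vs M Meq H (pad w u)" by (rule passes_language[OF pad_PA[OF wu]])
  then have "(weq w u \<longrightarrow> w = u) \<and> (\<forall>v\<in>set vs. weq (w @ v) u \<longrightarrow> (w \<in> lang H \<longleftrightarrow> u \<in> lang H))"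
    unfolding language_test_def close_test_eq[OF pad_PA[OF wu]] using assms
    by (simp add: close_pad diagonal_pad)
  then have test: "weq w u \<Longrightarrow> w = u"
    "\<And>v. v \<in> set vs \<Longrightarrow> weq (w @ v) u \<Longrightarrow> w \<in> lang H \<longleftrightarrow> u \<in> lang H" by blast+
  show "w = u" if "cl w = cl u" by (rule test(1)) (use that wu in \<open>simp add: weq_def\<close>)
  show "w \<in> lang H \<longleftrightarrow> u \<in> lang H" if v: "v \<in> set vs" and eq: "cl (w @ v) = cl u"
  proof (rule test(2)[OF v])
    have "v \<in> lists A" using v vs by blast
    then show "weq (w @ v) u" using wu eq by (simp add: weq_def)
  qed
qed

lemma M_unique_within: "unique_within (radius vs M k) (lang M)"
  unfolding unique_within_def using language_test_pad(1) by blast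

lemma radius_bounds:
  "2 * k \<le> radius vs M k" "q \<in> set rs \<Longrightarrow> k * length q \<le> radius vs M k"
  "(2 * run_bound M + 1) * (k + 1) \<le> radius vs M k" "v \<in> set vs \<Longrightarrow> k * length v \<le> radius vs M k"
proof -
  have *: "k * length q \<le> k * sum_list (map length qs)" if "q \<in> set qs" for q :: word and qs
    using that by (intro mult_le_mono2 member_le_sum_list) auto
  show "2 * k \<le> radius vs M k" "(2 * run_bound M + 1) * (k + 1) \<le> radius vs M k"
    by (simp_all add: radius_def)
  show "q \<in> set rs \<Longrightarrow> k * length q \<le> radius vs M k" using *[of q rs] unfolding radius_def by linarith
  show "v \<in> set vs \<Longrightarrow> k * length v \<le> radius vs M k" using *[of v vs] unfolding radius_def by linarith
qed

lemma M_completion: "x @ y \<in> lang M \<Longrightarrow> \<exists>c. length c \<le> run_bound M \<and> x @ c \<in> lang M"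
proof -
  assume xy: "x @ y \<in> lang M"
  obtain s q where s: "state_after M x = Some s" "run M s y = Some q" "q \<in> set (final M)"
    using xy by (auto simp: in_lang_iff run_append bind_eq_Some_conv)
  obtain c where "length c \<le> run_bound M" "run M s c = Some q" by (rule run_small_model[OF s(2)])
  then show ?thesis using s by (auto simp: in_lang_iff run_append)
qed

lemma identity_word: obtains w where "w \<in> lang H" "cl w = \<one>\<^bsub>G\<^esub>"
  using passes that unfolding passes_def weq_def cl_Nil by blast

lemma M_lists: "lang M \<subseteq> lists A"
  by (rule lang_subset_lists[OF passes_letters(1)])

lemma M_nonempty: "lang M \<noteq> {}"
  using identity_word H_subset by blast

lemma M_unique:
  assumes "w \<in> lang M" "u \<in> lang M" "cl w = cl u" shows "w = u"
  by (rule unique_representatives[where k=k and r="radius vs M k" and N="run_bound M",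
        OF M_lists M_nonempty M_neighbours M_unique_within _ radius_bounds(1) _ radius_bounds(3) assms])
     (erule M_completion, erule radius_bounds(2))

lemma M_represents:
  assumes "w \<in> lists A" shows "\<exists>u\<in>lang M. cl u = cl w"
  by (rule every_element_represented[where k=k and r="radius vs M k" and N="run_bound M",
        OF M_lists M_nonempty M_neighbours M_unique_within _ radius_bounds(1) _ radius_bounds(3) assms])
     (erule M_completion, erule radius_bounds(2))

lemma M_moves:
  assumes "w \<in> lang M" "e \<in> lists A"
  shows "\<exists>v\<in>lang M. cl (w @ e) = cl v \<and> fellow (k * length e) w v"
proof -
  have "foldl (move (lang M) k) w e \<in> lang M \<and> cl (w @ e) = cl (foldl (move (lang M) k) w e) \<and>
      fellow (k * length e) w (foldl (move (lang M) k) w e)"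
    by (rule moves[where k=k and r="radius vs M k" and N="run_bound M",
          OF M_lists M_nonempty M_neighbours M_unique_within _ radius_bounds(1) _ radius_bounds(3) assms])
       (erule M_completion, erule radius_bounds(2))
  then show ?thesis by blast
qed

text \<open>Any two words of the language that differ by \<open>e\<close> fellow travel, since by uniqueness the second is
  the word to which \<open>e\<close> moves the first.\<close>

lemma M_fellow:
  assumes "w \<in> lang M" "u \<in> lang M" "e \<in> lists A" "cl (w @ e) = cl u"
  shows "fellow (k * length e) w u"
proof -
  obtain v where v: "v \<in> lang M" "cl (w @ e) = cl v" "fellow (k * length e) w v"
    using M_moves[OF assms(1,3)] by blast
  have "v = u" by (rule M_unique) (use v assms in auto)
  with v show ?thesis by simp
qed

lemma lang_Mult:
  assumes a: "a \<in> A" shows "lang (Mult a) = multiplication_pairs (lang M) a"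
proof (intro equalityI subsetI)
  fix z assume z: "z \<in> lang (Mult a)"
  then have PA: "z \<in> lists PA" using lang_subset_lists[OF passes_letters(4)[OF a]] by blast
  from passes_multiplier[OF a PA] z show "z \<in> multiplication_pairs (lang M) a"
    unfolding multiplier_test_def in_multiplication_pairs_iff weq_def by blast
next
  fix z assume "z \<in> multiplication_pairs (lang M) a"
  then obtain w u where z: "z = pad w u" "w \<in> lang M" "u \<in> lang M" "cl (w @ [a]) = cl u"
    unfolding multiplication_pairs_def by blast
  have "fellow (k * length [a]) w u" by (rule M_fellow) (use z a in auto)
  then show "z \<in> lang (Mult a)"
    using z unfolding z(1) pad_in_Mult[OF a M_words[OF z(2)] M_words[OF z(3)]] by simp
qed

text \<open>Invariance under the generators, which is tested on close pairs, extends to the whole subgroup: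
  by uniqueness, two words of the language that differ by a generator are close.\<close>

lemma coset_invariance:
  assumes "g \<in> generate G (cl ` set vs)" "w \<in> lang M" "u \<in> lang M" "cl w \<otimes>\<^bsub>G\<^esub> g = cl u"
  shows "w \<in> lang H \<longleftrightarrow> u \<in> lang H"
  using assms
proof (induction arbitrary: w u rule: generate.induct)
  case one
  then have "w = u" using cl_in[OF M_words[OF one(1)]] by (intro M_unique) auto
  then show ?case by simp
next
  case (incl h)
  then obtain v where v: "v \<in> set vs" "h = cl v" by blast
  have vA: "v \<in> lists A" using v vs by blast
  have eq: "cl (w @ v) = cl u" using incl v vA M_words by (simp add: cl_append)
  have "fellow (radius vs M k) w u"
    by (rule fellow_mono[OF M_fellow[OF incl(2,3) vA eq] radius_bounds(4)[OF v(1)]])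
  from language_test_pad(2)[OF incl(2,3) this v(1) eq] show ?case .
next
  case (inv h)
  then obtain v where v: "v \<in> set vs" "h = cl v" by blast
  have vA: "v \<in> lists A" using v vs by blast
  have "cl u \<otimes>\<^bsub>G\<^esub> cl v = cl w"
    unfolding inv(4)[symmetric] v(2) using cl_in[OF vA] cl_in[OF M_words[OF inv(2)]] by (simp add: G.m_assoc)
  then have eq: "cl (u @ v) = cl w" using vA M_words[OF inv(3)] by (simp add: cl_append)
  have "fellow (radius vs M k) u w"
    by (rule fellow_mono[OF M_fellow[OF inv(3,2) vA eq] radius_bounds(4)[OF v(1)]])
  from language_test_pad(2)[OF inv(3,2) this v(1) eq] show ?case by simp
next
  case (eng h1 h2)
  have sub: "cl ` set vs \<subseteq> carrier G" using vs by (intro image_subsetI cl_in) blast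
  have h: "h1 \<in> carrier G" "h2 \<in> carrier G" using eng(1,2) G.generate_in_carrier[OF sub] by auto
  have w: "cl w \<in> carrier G" by (rule cl_in[OF M_words[OF eng(5)]])
  then have "cl w \<otimes>\<^bsub>G\<^esub> h1 \<in> carrier G" using h by simp
  then obtain x where x: "x \<in> lists A" "cl w \<otimes>\<^bsub>G\<^esub> h1 = cl x"
    unfolding carrier_presented_group by (elim imageE) simp
  obtain y where y: "y \<in> lang M" "cl y = cl x" using M_represents[OF x(1)] by blast
  have "w \<in> lang H \<longleftrightarrow> y \<in> lang H" by (rule eng(3)) (use eng x y in auto)
  also have "\<dots> \<longleftrightarrow> u \<in> lang H"
  proof (rule eng(4))
    show "cl y \<otimes>\<^bsub>G\<^esub> h2 = cl u" unfolding y(2) x(2)[symmetric] using eng(7) w h by (simp add: G.m_assoc)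
  qed (use y eng in auto)
  finally show ?case .
qed

lemma lang_H: "lang H = {w \<in> lang M. cl w \<in> generate G (cl ` set vs)}"
proof (intro equalityI subsetI)
  fix w assume w: "w \<in> lang H"
  have sub: "cl ` set vs \<subseteq> carrier G" using vs by (intro image_subsetI cl_in) blast
  have "cl w \<in> generate G (cl ` set vs)"
  proof (rule language_in_subgroup[OF G.generate_is_subgroup[OF sub] _ _ w])
    show "lang H \<subseteq> lists A" by (rule lang_subset_lists[OF passes_letters(3)])
    fix u assume u: "u \<in> lang H" "length u \<le> 2 * run_bound H + 1"
    then have "product_of_generators vs u"
      using passes H_words[OF u(1)] unfolding passes_def set_all_words set_letters by blast
    then show "cl u \<in> generate G (cl ` set vs)" by (simp add: product_of_generators_iff[OF vs])
  qed
  with H_subset[OF w] show "w \<in> {w \<in> lang M. cl w \<in> generate G (cl ` set vs)}" by blast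
next
  fix w assume w: "w \<in> {w \<in> lang M. cl w \<in> generate G (cl ` set vs)}"
  obtain w1 where w1: "w1 \<in> lang H" "cl w1 = \<one>\<^bsub>G\<^esub>" by (rule identity_word)
  have "cl w1 \<otimes>\<^bsub>G\<^esub> cl w = cl w" using w w1 cl_in[OF M_words] by simp
  then show "w \<in> lang H" using coset_invariance[of "cl w" w1 w] w w1 H_subset by blast
qed

end

text \<open>Correct structures pass because every tested instance is true, whatever the bounds on the
  length of the tested words.\<close>

lemma standard_passes:
  assumes std: "standard (lang M) k" and M: "letters_in M A" and vs: "set vs \<subseteq> lists A"
    and H: "lang H = {w \<in> lang M. cl w \<in> generate G (cl ` set vs)}" "letters_in H A"
    and Meq: "lang Meq = {pad w w | w. w \<in> lang M}" "letters_in Meq PA"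
    and Mult: "\<And>a. a \<in> A \<Longrightarrow> lang (Mult a) = multiplication_pairs (lang M) a \<and> letters_in (Mult a) PA"
  shows "passes vs M Meq Mult H k"
proof -
  note L = standardD(1)[OF std] and uniq = standardD(2)[OF std] and rep = standardD(3)[OF std]
  let ?K = "generate G (cl ` set vs)"
  have sub: "cl ` set vs \<subseteq> carrier G" using vs by (intro image_subsetI cl_in) blast
  interpret K: subgroup ?K G by (rule G.generate_is_subgroup[OF sub])
  have lt: "language_test r vs M Meq H z" if "z \<in> lists PA" for r z
  proof -
    have pad: "valid z \<Longrightarrow> pad (tape1 z) (tape2 z) = z" by (simp add: valid_def)
    have eq: "valid z \<Longrightarrow> diagonal z \<longleftrightarrow> tape1 z = tape2 z"
      using diagonal_pad[of "tape1 z" "tape2 z"] pad by simp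
    have 1: "z \<in> lang Meq \<longleftrightarrow> valid z \<and> diagonal z \<and> tape1 z \<in> lang M"
    proof
      assume "z \<in> lang Meq"
      then show "valid z \<and> diagonal z \<and> tape1 z \<in> lang M" unfolding Meq by (auto simp: diagonal_pad)
    next
      assume *: "valid z \<and> diagonal z \<and> tape1 z \<in> lang M"
      then have "z = pad (tape1 z) (tape1 z)" using eq pad by simp
      then show "z \<in> lang Meq" unfolding Meq using * by blast
    qed
    have 2: "weq (tape1 z) (tape2 z) \<Longrightarrow> tape1 z \<in> lang M \<Longrightarrow> tape2 z \<in> lang M \<Longrightarrow> valid z \<Longrightarrow> diagonal z"
      using uniq eq by (auto simp: weq_def)
    have 3: "tape1 z \<in> lang H \<longleftrightarrow> tape2 z \<in> lang H"
      if v: "v \<in> set vs" and M: "tape1 z \<in> lang M" "tape2 z \<in> lang M" and w: "weq (tape1 z @ v) (tape2 z)" for v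
    proof -
      have A: "tape1 z \<in> lists A" "v \<in> lists A" using M L v vs by blast+
      have cv: "cl v \<in> ?K" using v by (intro generate.incl) simp
      have eq: "cl (tape2 z) = cl (tape1 z) \<otimes>\<^bsub>G\<^esub> cl v" using w A by (simp add: weq_def cl_append)
      have "cl (tape1 z) = cl (tape2 z) \<otimes>\<^bsub>G\<^esub> inv\<^bsub>G\<^esub> (cl v)"
        unfolding eq using A[THEN cl_in] by (simp add: G.m_assoc)
      then have "cl (tape2 z) \<in> ?K \<Longrightarrow> cl (tape1 z) \<in> ?K" using cv by simp
      moreover have "cl (tape1 z) \<in> ?K \<Longrightarrow> cl (tape2 z) \<in> ?K" unfolding eq using cv by simp
      ultimately show ?thesis unfolding H using M by blast
    qed
    show ?thesis unfolding language_test_def using 1 2 3 H(1) by blast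
  qed
  have mt: "multiplier_test k M (Mult a) a z" if z: "z \<in> lists PA" and a: "a \<in> A" for a z
  proof -
    have tapes: "tape1 z @ [a] \<in> lists A" "tape2 z \<in> lists A" using tape_in_lists[OF z] a by simp_all
    show ?thesis
      using multiplication_pairs_close[OF std a, of z, unfolded in_multiplication_pairs_iff]
      unfolding multiplier_test_def close_test_eq[OF z] weq_cl[OF tapes] conjunct1[OF Mult[OF a]]
        in_multiplication_pairs_iff
      by argo
  qed
  have partner: "\<exists>u. pad w u \<in> lang (Mult a)" if "a \<in> A" "w \<in> lang M" for a w
  proof -
    have "w @ [a] \<in> lists A" using that L by auto
    then obtain u where "u \<in> lang M" "cl u = cl (w @ [a])" using rep by blast
    then have "pad w u \<in> lang (Mult a)"
      using Mult[OF that(1)] that(2) by (simp add: pad_in_multiplication_pairs)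
    then show ?thesis ..
  qed
  have prod: "product_of_generators vs w" if "w \<in> lang H" for w
    unfolding product_of_generators_iff[OF vs] using that L H(1) by blast
  obtain w1 where w1: "w1 \<in> lang M" "cl w1 = cl []" using rep[of "[]"] by auto
  have one: "w1 \<in> lang H \<and> weq w1 []"
    using w1 L unfolding H weq_def by (auto simp: cl_Nil simp del: in_lists_conv_set)
  show ?thesis
    unfolding passes_def
    using M Meq(2) H(2) Mult lt mt partner prod one by (auto simp: set_all_words)
qed

end


section \<open>Renaming the letters of a structure\<close>

text \<open>Rationality for some structure refers to alphabets of natural numbers, while the candidates use letters
  as symbols; an injective renaming carries one to the other.\<close>

definition rename :: "('a \<Rightarrow> 'b) \<Rightarrow> 'a fsa \<Rightarrow> 'b fsa" where
  "rename c M = \<lparr>initial = initial M, final = final M,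
     table = map (\<lambda>e. ((fst (fst e), c (snd (fst e))), snd e)) (table M)\<rparr>"

lemma run_rename:
  assumes "inj c"
  shows "run (rename c M) s (map c w) = run M s w"
proof -
  have "map_of (map (\<lambda>e. ((fst (fst e), c (snd (fst e))), snd e)) t) (s, c a) = map_of t (s, a)" for t s a
    by (induction t) (auto simp: inj_eq[OF assms])
  then have key: "map_of (table (rename c M)) (s, c a) = map_of (table M) (s, a)" for s a
    by (simp add: rename_def)
  show ?thesis
    by (induction w arbitrary: s) (simp_all add: key split: option.split)
qed

lemma lang_rename:
  assumes c: "inj c"
  shows "lang (rename c M) = map c ` lang M"
proof (intro equalityI subsetI)
  fix v assume v: "v \<in> lang (rename c M)"
  then obtain s where "state_after (rename c M) v = Some s" by (auto simp: in_lang_iff)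
  then have "set v \<subseteq> (snd \<circ> fst) ` set (table (rename c M))" by (rule run_letters)
  then have "set v \<subseteq> range c" by (auto simp: rename_def)
  then have "v \<in> lists (range c)" by (auto simp: in_lists_conv_set)
  then obtain w where w: "v = map c w" unfolding lists_image by blast
  have "w \<in> lang M" using v run_rename[OF c, of M] by (simp add: w in_lang_iff rename_def)
  with w show "v \<in> map c ` lang M" by blast
next
  fix v assume "v \<in> map c ` lang M"
  then show "v \<in> lang (rename c M)" using run_rename[OF c, of M] by (auto simp: in_lang_iff rename_def)
qed

definition rename_padded :: "('a \<Rightarrow> 'b) \<Rightarrow> 'a padded \<Rightarrow> 'b padded" where
  "rename_padded c p = (map_option c (fst p), map_option c (snd p))"

lemma map_rename_pad: "map (rename_padded c) (pad w u) = pad (map c w) (map c u)"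
  by (induction w u rule: pad.induct) (auto simp: rename_padded_def)

lemma inj_rename_padded: "inj c \<Longrightarrow> inj (rename_padded c)"
  by (rule injI) (auto simp: rename_padded_def prod_eq_iff dest: injD[OF option.inj_map])

lemma automatic_structure_rename:
  assumes aut: "automatic_structure G A \<mu> M Meq Mm" and c: "inj c" and \<mu>': "\<And>a. \<mu>' (c a) = \<mu> a"
  shows "automatic_structure G (c ` A) \<mu>' (rename c M) (rename (rename_padded c) Meq)
    (\<lambda>b. rename (rename_padded c) (Mm (inv_into UNIV c b)))"
    and "preimage_in G \<mu>' (lang (rename c M)) K = map c ` preimage_in G \<mu> (lang M) K"
proof -
  have ev: "eval_word G \<mu>' (map c w) = eval_word G \<mu> w" for w
    by (induction w) (simp_all add: eval_word_def \<mu>')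
  have ev': "eval_word G \<mu>' (map c w @ [c a]) = eval_word G \<mu> (w @ [a])" for w a
    using ev[of "w @ [a]"] by simp
  note facts = aut[unfolded automatic_structure_def generating_alphabet_def]
  have pads: "map (rename_padded c) ` {pad w u | w u. w \<in> L \<and> u \<in> L \<and> Q w u} =
      {pad w u | w u. w \<in> map c ` L \<and> u \<in> map c ` L \<and> Q' w u}"
    if "\<And>w u. Q' (map c w) (map c u) \<longleftrightarrow> Q w u" for L Q Q'
  proof (intro equalityI subsetI)
    fix z assume "z \<in> map (rename_padded c) ` {pad w u | w u. w \<in> L \<and> u \<in> L \<and> Q w u}"
    then obtain w u where z: "z = pad (map c w) (map c u)" "w \<in> L" "u \<in> L" "Q w u"
      using map_rename_pad by blast
    then show "z \<in> {pad w u | w u. w \<in> map c ` L \<and> u \<in> map c ` L \<and> Q' w u}"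
      using that[of w u] by blast
  next
    fix z assume "z \<in> {pad w u | w u. w \<in> map c ` L \<and> u \<in> map c ` L \<and> Q' w u}"
    then obtain w u where "z = pad (map c w) (map c u)" "w \<in> L" "u \<in> L" "Q' (map c w) (map c u)"
      by blast
    moreover from this(1) have "z = map (rename_padded c) (pad w u)" by (simp only: map_rename_pad)
    ultimately show "z \<in> map (rename_padded c) ` {pad w u | w u. w \<in> L \<and> u \<in> L \<and> Q w u}"
      using that[of w u] by blast
  qed
  have im: "\<mu>' ` c ` A = \<mu> ` A" by (simp add: image_image \<mu>')
  have gen: "generating_alphabet G (c ` A) \<mu>'"
    using facts unfolding generating_alphabet_def im by (simp add: \<mu>')
  have words: "lang (rename c M) \<subseteq> lists (c ` A)" "eval_word G \<mu>' ` lang (rename c M) = carrier G"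
    unfolding lang_rename[OF c] using facts by (auto simp: image_image ev lists_image)
  have eq: "lang (rename (rename_padded c) Meq) = {pad w u | w u. w \<in> lang (rename c M) \<and>
      u \<in> lang (rename c M) \<and> eval_word G \<mu>' w = eval_word G \<mu>' u}"
    unfolding lang_rename[OF c] lang_rename[OF inj_rename_padded[OF c]] using facts
    by (simp add: pads ev)
  have mult: "lang (rename (rename_padded c) (Mm (inv_into UNIV c b))) = {pad w u | w u.
      w \<in> lang (rename c M) \<and> u \<in> lang (rename c M) \<and> eval_word G \<mu>' (w @ [b]) = eval_word G \<mu>' u}"
    if "b \<in> c ` A" for b
  proof -
    obtain a where a: "a \<in> A" "b = c a" using \<open>b \<in> c ` A\<close> by blast
    have "lang (Mm a) = {pad w u | w u. w \<in> lang M \<and> u \<in> lang M \<and> eval_word G \<mu> (w @ [a]) = eval_word G \<mu> u}"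
      using facts a(1) by blast
    then show ?thesis
      unfolding a(2) inv_into_f_f[OF c UNIV_I] lang_rename[OF c] lang_rename[OF inj_rename_padded[OF c]]
      by (simp only:) (rule pads, simp add: ev ev')
  qed
  show "automatic_structure G (c ` A) \<mu>' (rename c M) (rename (rename_padded c) Meq)
    (\<lambda>b. rename (rename_padded c) (Mm (inv_into UNIV c b)))"
    unfolding automatic_structure_def
    by (intro conjI ballI conjunct1[OF facts] gen words eq mult)
  show "preimage_in G \<mu>' (lang (rename c M)) K = map c ` preimage_in G \<mu> (lang M) K"
    unfolding lang_rename[OF c] preimage_in_def using ev by auto
qed


section \<open>The algorithm\<close>

type_synonym candidate = "letter machine \<times> letter padded machine \<times> letter padded machine list \<times>
  letter machine \<times> nat"

text \<open>The multipliers are listed in the order of the letter codes; a default makes the function total.\<close>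

definition select :: "letter padded machine list \<Rightarrow> letter \<Rightarrow> letter padded machine" where
  "select Ms a = (case drop (enc a) Ms of [] \<Rightarrow> (0, [], []) | P # _ \<Rightarrow> P)"

lemma select_nth: "enc a < length Ms \<Longrightarrow> select Ms a = Ms ! enc a"
  by (simp add: select_def split: list.split) (metis hd_drop_conv_nth list.sel(1))

definition language_machine :: "candidate \<Rightarrow> letter machine" where
  "language_machine y = fst y"
definition equality_machine :: "candidate \<Rightarrow> letter padded machine" where
  "equality_machine y = fst (snd y)"
definition multiplier_machines :: "candidate \<Rightarrow> letter padded machine list" where
  "multiplier_machines y = fst (snd (snd y))"
definition subgroup_machine :: "candidate \<Rightarrow> letter machine" where
  "subgroup_machine y = fst (snd (snd (snd y)))"
definition fellow_constant :: "candidate \<Rightarrow> nat" where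
  "fellow_constant y = snd (snd (snd (snd y)))"

lemmas candidate_defs = language_machine_def equality_machine_def multiplier_machines_def
  subgroup_machine_def fellow_constant_def

lemma computable_candidate [computable_intros]:
  assumes "computable f"
  shows "computable (\<lambda>x. language_machine (f x))" "computable (\<lambda>x. equality_machine (f x))"
    "computable (\<lambda>x. multiplier_machines (f x))" "computable (\<lambda>x. subgroup_machine (f x))"
    "computable (\<lambda>x. fellow_constant (f x))"
  unfolding candidate_defs by (intro computable_intros assms)+

lemma computable_select [computable_intros]:
  assumes "computable f" "computable g"
  shows "computable (\<lambda>x. select (f x) (g x))"
  unfolding select_def by (intro computable_intros assms)

definition output_of :: "candidate \<Rightarrow> nat list" where
  "output_of y = [enc (language_machine y), enc (equality_machine y)] @
     map enc (multiplier_machines y) @ [enc (subgroup_machine y)]"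

lemma computable_output_of: "computable output_of"
  unfolding output_of_def by (intro computable_intros)

lemma enc_output_of:
  "enc (output_of y) = output_code (fsa_of (language_machine y)) (fsa_of (equality_machine y))
     (map fsa_of (multiplier_machines y)) (fsa_of (subgroup_machine y))"
proof -
  have 1: "map (enc :: nat \<Rightarrow> nat) xs = xs" for xs by (simp add: map_idI)
  show ?thesis
    unfolding output_code_def output_of_def enc_list_def[of "_ @ _"] 1
      letter_code_enc padded_code_enc fsa_code_enc map_map o_def ..
qed

context presentation
begin

definition good_candidate :: "word list \<Rightarrow> candidate \<Rightarrow> bool" where
  "good_candidate vs y \<longleftrightarrow> length (multiplier_machines y) = 2 * n \<and>
     passes vs (fsa_of (language_machine y)) (fsa_of (equality_machine y))
       (\<lambda>a. fsa_of (select (multiplier_machines y) a)) (fsa_of (subgroup_machine y)) (fellow_constant y)"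

context
  assumes word_problem: "decidable (\<lambda>p. weq (fst p) (snd p))"
begin

lemma decidable_weq:
  assumes "computable f" "computable g"
  shows "decidable (\<lambda>x. weq (f x) (g x))"
  using decidable_comp[OF word_problem computable_Pair[OF assms]] by simp

lemma decidable_close_test:
  assumes "computable r" "computable z"
  shows "decidable (\<lambda>x. close_test (r x) (z x))"
proof -
  have "decidable (\<lambda>q. close_test (fst q) (snd q))"
    unfolding close_test_def by (intro decidable_weq computable_intros)
  from decidable_comp[OF this computable_Pair[OF assms]] show ?thesis by simp
qed

lemma computable_radius:
  assumes "computable vs" "computable m" "computable k"
  shows "computable (\<lambda>x. radius (vs x) (fsa_of (m x)) (k x))"
  unfolding radius_def by (intro computable_intros assms)

lemma computable_track_bound:
  fixes p :: "'a::coded \<Rightarrow> letter padded machine" and m h :: "'a \<Rightarrow> letter machine"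
  assumes "computable r" "computable p" "computable m" "computable h"
  shows "computable (\<lambda>x. track_bound (r x) (fsa_of (p x)) (fsa_of (m x)) (fsa_of (h x)))"
  unfolding track_bound_def by (intro computable_intros assms)

lemma decidable_language_test:
  fixes r :: "'a::coded \<Rightarrow> nat"
  assumes "computable r" "computable vs" "computable m" "computable p" "computable h" "computable z"
  shows "decidable (\<lambda>x. language_test (r x) (vs x) (fsa_of (m x)) (fsa_of (p x)) (fsa_of (h x)) (z x))"
proof -
  have "decidable (\<lambda>q. language_test (fst q) (fst (snd q)) (fsa_of (fst (snd (snd q))))
      (fsa_of (fst (snd (snd (snd q))))) (fsa_of (fst (snd (snd (snd (snd q))))))
      (snd (snd (snd (snd (snd q))))))"
    unfolding language_test_def by (intro decidable_close_test decidable_weq computable_intros)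
  from decidable_comp[OF this, of "\<lambda>x. (r x, vs x, m x, p x, h x, z x)"] show ?thesis
    using assms by (simp add: computable_intros)
qed

lemma decidable_multiplier_test:
  fixes k :: "'a::coded \<Rightarrow> nat"
  assumes "computable k" "computable m" "computable p" "computable a" "computable z"
  shows "decidable (\<lambda>x. multiplier_test (k x) (fsa_of (m x)) (fsa_of (p x)) (a x) (z x))"
  unfolding multiplier_test_def
  by (intro decidable_close_test decidable_weq computable_intros assms)

lemma semidecidable_product_of_generators:
  "semidecidable (\<lambda>p. product_of_generators (fst p) (snd p))"
  unfolding product_of_generators_def
  by (rule semidecidable_ex, rule semidecidable_if_decidable)
     (intro decidable_weq computable_intros)

theorem semidecidable_good_candidate: "semidecidable (\<lambda>p. good_candidate (fst p) (snd p))"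
proof -
  define finite_part where "finite_part p \<longleftrightarrow>
      length (multiplier_machines (snd p)) = 2 * n \<and>
      letters_in (fsa_of (language_machine (snd p))) (set (letters n)) \<and>
      letters_in (fsa_of (equality_machine (snd p))) (set padded_letters) \<and>
      letters_in (fsa_of (subgroup_machine (snd p))) (set (letters n)) \<and>
      (\<forall>z\<in>set (all_words padded_letters (track_bound
            (radius (fst p) (fsa_of (language_machine (snd p))) (fellow_constant (snd p)))
            (fsa_of (equality_machine (snd p))) (fsa_of (language_machine (snd p))) (fsa_of (subgroup_machine (snd p))))).
        language_test (radius (fst p) (fsa_of (language_machine (snd p))) (fellow_constant (snd p))) (fst p)
          (fsa_of (language_machine (snd p))) (fsa_of (equality_machine (snd p))) (fsa_of (subgroup_machine (snd p))) z) \<and>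
      (\<forall>a\<in>set (letters n). letters_in (fsa_of (select (multiplier_machines (snd p)) a)) (set padded_letters) \<and>
        (\<forall>z\<in>set (all_words padded_letters (track_bound (fellow_constant (snd p))
            (fsa_of (select (multiplier_machines (snd p)) a)) (fsa_of (language_machine (snd p))) (fsa_of (subgroup_machine (snd p))))).
          multiplier_test (fellow_constant (snd p)) (fsa_of (language_machine (snd p)))
            (fsa_of (select (multiplier_machines (snd p)) a)) a z))" for p
  define partner_part where "partner_part p \<longleftrightarrow>
      (\<forall>a\<in>set (letters n). \<forall>w\<in>set (all_words (letters n) (run_bound (fsa_of (language_machine (snd p))) *
          2 ^ run_bound (fsa_of (select (multiplier_machines (snd p)) a)))).
        w \<in> lang (fsa_of (language_machine (snd p))) \<longrightarrow>
          (\<exists>u. pad w u \<in> lang (fsa_of (select (multiplier_machines (snd p)) a))))" for p :: "word list \<times> candidate"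
  define subgroup_part where "subgroup_part p \<longleftrightarrow>
      (\<forall>w\<in>set (all_words (letters n) (2 * run_bound (fsa_of (subgroup_machine (snd p))) + 1)).
        w \<in> lang (fsa_of (subgroup_machine (snd p))) \<longrightarrow> product_of_generators (fst p) w)" for p
  define identity_part where "identity_part p \<longleftrightarrow>
      (\<exists>w. w \<in> lang (fsa_of (subgroup_machine (snd p))) \<and> weq w [])" for p :: "word list \<times> candidate"
  have parts: "good_candidate (fst p) (snd p) \<longleftrightarrow>
      finite_part p \<and> partner_part p \<and> subgroup_part p \<and> identity_part p" for p
    unfolding good_candidate_def passes_def finite_part_def partner_part_def subgroup_part_def
      identity_part_def set_letters set_padded_letters by (simp only: conj_assoc)
  have 1: "semidecidable finite_part"
    unfolding finite_part_def
    by (rule semidecidable_if_decidable)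
       (intro decidable_language_test decidable_multiplier_test computable_track_bound computable_radius
         computable_intros)
  have 2: "semidecidable partner_part"
    unfolding partner_part_def
  proof (rule semidecidable_ball, rule semidecidable_ball, rule semidecidable_imp)
    show "decidable (\<lambda>q :: ((word list \<times> candidate) \<times> letter) \<times> word.
        snd q \<in> lang (fsa_of (language_machine (snd (fst (fst q))))))"
      by (intro computable_intros)
    show "semidecidable (\<lambda>q :: ((word list \<times> candidate) \<times> letter) \<times> word.
        \<exists>u. pad (snd q) u \<in> lang (fsa_of (select (multiplier_machines (snd (fst (fst q)))) (snd (fst q)))))"
      by (rule semidecidable_ex, rule semidecidable_if_decidable) (intro computable_intros)
  qed (intro computable_intros)+
  have 3: "semidecidable subgroup_part"
    unfolding subgroup_part_def
  proof (rule semidecidable_ball, rule semidecidable_imp)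
    show "decidable (\<lambda>q :: (word list \<times> candidate) \<times> word.
        snd q \<in> lang (fsa_of (subgroup_machine (snd (fst q)))))"
      by (intro computable_intros)
    have "computable (\<lambda>q :: (word list \<times> candidate) \<times> word. (fst (fst q), snd q))"
      by (intro computable_intros)
    from semidecidable_comp[OF semidecidable_product_of_generators this]
    show "semidecidable (\<lambda>q :: (word list \<times> candidate) \<times> word. product_of_generators (fst (fst q)) (snd q))"
      by simp
  qed (intro computable_intros)
  have 4: "semidecidable identity_part"
    unfolding identity_part_def
  proof (rule semidecidable_ex, rule semidecidable_if_decidable)
    show "decidable (\<lambda>q :: (word list \<times> candidate) \<times> word.
        snd q \<in> lang (fsa_of (subgroup_machine (snd (fst q)))) \<and> weq (snd q) [])"
      by (intro decidable_weq computable_intros)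
  qed
  have all: "semidecidable (\<lambda>p. finite_part p \<and> partner_part p \<and> subgroup_part p \<and> identity_part p)"
    by (rule semidecidable_conj[OF 1 semidecidable_conj[OF 2 semidecidable_conj[OF 3 4]]])
  have "(\<lambda>p. good_candidate (fst p) (snd p)) =
      (\<lambda>p. finite_part p \<and> partner_part p \<and> subgroup_part p \<and> identity_part p)"
    by (rule ext) (rule parts)
  from iffD2[OF arg_cong[OF this, of semidecidable] all] show ?thesis .
qed

end

lemma good_candidate_sound:
  assumes vs: "set vs \<subseteq> lists A" and good: "good_candidate vs y"
  defines "K \<equiv> generate G (cl ` set vs)" and "\<mu> \<equiv> letter_class n (set rs)"
    and "Ms \<equiv> map fsa_of (multiplier_machines y)"
  shows "length Ms = 2 * n"
    "automatic_structure_with_uniqueness G A \<mu> (fsa_of (language_machine y)) (fsa_of (equality_machine y))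
      (\<lambda>a. Ms ! letter_code a)"
    "lang (fsa_of (subgroup_machine y)) = preimage_in G \<mu> (lang (fsa_of (language_machine y))) K"
proof -
  let ?M = "fsa_of (language_machine y)"
  show len: "length Ms = 2 * n" using good by (simp add: good_candidate_def Ms_def)
  have passes: "passes vs ?M (fsa_of (equality_machine y))
       (\<lambda>a. fsa_of (select (multiplier_machines y) a)) (fsa_of (subgroup_machine y)) (fellow_constant y)"
    using good by (simp add: good_candidate_def)
  note M = M_words[OF vs passes] and unique = M_unique[OF vs passes]
    and represents = M_represents[OF vs passes]
  have ev: "eval_word G \<mu> w = cl w" if "w \<in> lists A" for w
    unfolding \<mu>_def by (rule eval_word_presented_group[OF relators that])
  have nth: "Ms ! letter_code a = fsa_of (select (multiplier_machines y) a)" if "a \<in> A" for a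
  proof -
    have "enc a < 2 * n" using that by (auto simp: alphabet_def enc_letter_def)
    then show ?thesis using len by (simp add: Ms_def letter_code_enc select_nth)
  qed
  have gens: "\<mu> a = cl [a]" for a by (simp add: \<mu>_def letter_class_def)
  have sub: "\<mu> ` A \<subseteq> carrier G" unfolding gens by (intro image_subsetI cl_in) simp
  have "carrier G \<subseteq> generate G (\<mu> ` A)"
  proof
    interpret S: subgroup "generate G (\<mu> ` A)" G by (rule G.generate_is_subgroup[OF sub])
    have "cl w \<in> generate G (\<mu> ` A)" if "w \<in> lists A" for w
      using that
    proof (induction w)
      case (Cons a w)
      then have "a \<in> A" "w \<in> lists A" "cl w \<in> generate G (\<mu> ` A)" by auto
      moreover have "cl [a] \<in> generate G (\<mu> ` A)"
        using \<open>a \<in> A\<close> by (intro generate.incl) (auto simp flip: gens)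
      ultimately show ?case using cl_append[of "[a]" w] by simp
    qed (simp add: cl_Nil)
    moreover fix g assume "g \<in> carrier G"
    ultimately show "g \<in> generate G (\<mu> ` A)" unfolding carrier_presented_group by blast
  qed
  then have generates: "generate G (\<mu> ` A) = carrier G"
    using G.generate_incl[OF sub] by blast
  have inverse: "\<exists>b\<in>A. \<mu> b = inv\<^bsub>G\<^esub> (\<mu> a)" if "a \<in> A" for a
    using that cl_winv[of "[a]"] by (intro bexI[of _ "inv_letter a"]) (simp_all add: gens winv_def)
  have gen: "generating_alphabet G A \<mu>"
    unfolding generating_alphabet_def using sub generates inverse by simp
  have ev_M: "eval_word G \<mu> w = cl w" if "w \<in> lang ?M" for w
    by (rule ev[OF M[OF that]])
  have image: "eval_word G \<mu> ` lang ?M = carrier G"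
  proof (intro equalityI subsetI)
    fix g assume "g \<in> eval_word G \<mu> ` lang ?M"
    then obtain w where w: "w \<in> lang ?M" "g = eval_word G \<mu> w" by (rule imageE)
    then show "g \<in> carrier G" using cl_in[OF M[OF w(1)]] by (simp add: ev_M)
  next
    fix g assume "g \<in> carrier G"
    then obtain w where w: "w \<in> lists A" "g = cl w" unfolding carrier_presented_group by (elim imageE)
    obtain u where u: "u \<in> lang ?M" "cl u = cl w" using represents[OF w(1)] by (elim bexE)
    have "g = eval_word G \<mu> u" using w u by (simp add: ev_M)
    then show "g \<in> eval_word G \<mu> ` lang ?M" using u(1) by (rule image_eqI)
  qed
  have eq: "lang (fsa_of (equality_machine y)) =
      {pad w u | w u. w \<in> lang ?M \<and> u \<in> lang ?M \<and> eval_word G \<mu> w = eval_word G \<mu> u}"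
  proof -
    have "w \<in> lang ?M \<and> u \<in> lang ?M \<and> eval_word G \<mu> w = eval_word G \<mu> u \<longleftrightarrow> w \<in> lang ?M \<and> w = u" for w u
    proof
      assume *: "w \<in> lang ?M \<and> u \<in> lang ?M \<and> eval_word G \<mu> w = eval_word G \<mu> u"
      then have "cl w = cl u" using ev_M[of w] ev_M[of u] by simp
      with * show "w \<in> lang ?M \<and> w = u" using unique[of w u] by simp
    qed auto
    then show ?thesis unfolding lang_Meq[OF vs passes] by simp
  qed
  have mult: "lang (Ms ! letter_code a) =
      {pad w u | w u. w \<in> lang ?M \<and> u \<in> lang ?M \<and> eval_word G \<mu> (w @ [a]) = eval_word G \<mu> u}"
    if a: "a \<in> A" for a
  proof -
    have "eval_word G \<mu> (w @ [a]) = cl (w @ [a])" if "w \<in> lang ?M" for w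
      by (rule ev) (use M[OF that] a in simp)
    then have "w \<in> lang ?M \<and> u \<in> lang ?M \<and> eval_word G \<mu> (w @ [a]) = eval_word G \<mu> u \<longleftrightarrow>
        w \<in> lang ?M \<and> u \<in> lang ?M \<and> cl (w @ [a]) = cl u" for w u
      using ev_M by (intro conj_cong HOL.refl) simp_all
    then show ?thesis
      unfolding nth[OF a] lang_Mult[OF vs passes a] multiplication_pairs_def by simp
  qed
  have aut: "automatic_structure G A \<mu> ?M (fsa_of (equality_machine y)) (\<lambda>a. Ms ! letter_code a)"
    unfolding automatic_structure_def
    by (intro conjI ballI G.group_axioms gen M_lists[OF vs passes] image eq mult)
  have "\<exists>!w. w \<in> lang ?M \<and> eval_word G \<mu> w = g" if "g \<in> carrier G" for g
  proof -
    have "g \<in> eval_word G \<mu> ` lang ?M" using that unfolding image .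
    then obtain w where w: "w \<in> lang ?M" "g = eval_word G \<mu> w" by (elim imageE)
    show ?thesis
    proof (rule ex1I[of _ w])
      show "w \<in> lang ?M \<and> eval_word G \<mu> w = g" using w by simp
      fix u assume "u \<in> lang ?M \<and> eval_word G \<mu> u = g"
      then show "u = w" using w unique[of u w] ev_M[of u] ev_M[of w] by simp
    qed
  qed
  with aut show "automatic_structure_with_uniqueness G A \<mu> ?M (fsa_of (equality_machine y))
      (\<lambda>a. Ms ! letter_code a)"
    unfolding automatic_structure_with_uniqueness_def by (intro conjI ballI)
  show "lang (fsa_of (subgroup_machine y)) = preimage_in G \<mu> (lang ?M) K"
    unfolding lang_H[OF vs passes] preimage_in_def K_def using ev_M by auto
qed

text \<open>Conversely the search cannot stop for other subgroups: what it finds is itself a structure for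
  which the subgroup is rational.\<close>

lemma good_candidate_rational:
  assumes vs: "set vs \<subseteq> lists A" and good: "good_candidate vs y"
  shows "rational_for_some_structure G (generate G (cl ` set vs))"
proof -
  let ?\<mu> = "letter_class n (set rs)" and ?M = "fsa_of (language_machine y)"
  let ?K = "generate G (cl ` set vs)" and ?H = "fsa_of (subgroup_machine y)"
  have sub: "cl ` set vs \<subseteq> carrier G" using vs by (intro image_subsetI cl_in) blast
  note sound = good_candidate_sound[OF assms]
  have inj: "inj (enc :: letter \<Rightarrow> nat)" by (rule bij_is_inj[OF bij_enc])
  have dec: "\<And>a. ?\<mu> (dec (enc a)) = ?\<mu> a" by simp
  note aut = conjunct1[OF sound(2)[unfolded automatic_structure_with_uniqueness_def]]
  note renamed = automatic_structure_rename[OF aut inj, of "\<lambda>i. ?\<mu> (dec i)", OF dec]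
  have "lang (rename enc ?H) = preimage_in G (\<lambda>i. ?\<mu> (dec i)) (lang (rename enc ?M)) ?K"
    unfolding renamed(2) lang_rename[OF inj, of ?H] sound(3) ..
  then have "regular (preimage_in G (\<lambda>i. ?\<mu> (dec i)) (lang (rename enc ?M)) ?K)"
    unfolding regular_def by blast
  with renamed(1) G.generate_is_subgroup[OF sub] show ?thesis
    unfolding rational_for_some_structure_def by blast
qed

lemma rational_good_candidate:
  assumes vs: "set vs \<subseteq> lists A" and "rational_for_some_structure G (generate G (cl ` set vs))"
  shows "\<exists>y. good_candidate vs y"
proof -
  let ?K = "generate G (cl ` set vs)"
  obtain B :: "nat set" and \<mu> M0 Meq0 Mm where aut: "automatic_structure G B \<mu> M0 Meq0 Mm"
    and reg: "regular (preimage_in G \<mu> (lang M0) ?K)"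
    using assms(2) unfolding rational_for_some_structure_def by blast
  obtain N k where N: "standard (lang N) k" "letters_in N A"
    and NK: "\<And>K. regular (preimage_in G \<mu> (lang M0) K) \<Longrightarrow>
       \<exists>NK. lang NK = {w \<in> lang N. cl w \<in> K} \<and> letters_in NK A"
    by (rule standard_structure[OF aut]) blast
  obtain H where H: "lang H = {w \<in> lang N. cl w \<in> ?K}" "letters_in H A" using NK[OF reg] by blast
  have "\<forall>a\<in>A. \<exists>P. lang P = multiplication_pairs (lang N) a \<and> letters_in P PA"
    using regular_multiplier[OF N(1)] by (rule ballI)
  from bchoice[OF this] obtain P where P: "\<forall>a\<in>A. lang (P a) = multiplication_pairs (lang N) a \<and> letters_in (P a) PA" ..
  have sub: "{pad w w | w. w \<in> lang N} \<subseteq> lists PA"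
  proof
    fix z assume "z \<in> {pad w w | w. w \<in> lang N}"
    then obtain w where "z = pad w w" "w \<in> lists A" using standardD(1)[OF N(1)] by blast
    then show "z \<in> lists PA" using pad_in_lists_iff[of w w A] by simp
  qed
  have "\<exists>Q. lang Q = {pad w w | w. w \<in> lang N} \<and> letters_in Q PA"
  proof (rule regular_tracked[OF sub, of 0 "\<lparr>initial = 0, final = [], table = []\<rparr>" N N])
    have mem: "z \<in> {pad w w | w. w \<in> lang N} \<longleftrightarrow> valid z \<and> diagonal z \<and> tape1 z \<in> lang N" for z
    proof
      assume "z \<in> {pad w w | w. w \<in> lang N}"
      then show "valid z \<and> diagonal z \<and> tape1 z \<in> lang N" by (auto simp: diagonal_pad)
    next
      assume *: "valid z \<and> diagonal z \<and> tape1 z \<in> lang N"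
      then have z: "pad (tape1 z) (tape2 z) = z" by (simp add: valid_def)
      then have "tape1 z = tape2 z" using * diagonal_pad[of "tape1 z" "tape2 z"] by simp
      with z have "z = pad (tape1 z) (tape1 z)" by simp
      with * show "z \<in> {pad w w | w. w \<in> lang N}" by blast
    qed
    fix x y assume eq: "track 0 \<lparr>initial = 0, final = [], table = []\<rparr> N N x =
        track 0 \<lparr>initial = 0, final = [], table = []\<rparr> N N y"
      and "x \<in> {pad w w | w. w \<in> lang N}"
    then show "y \<in> {pad w w | w. w \<in> lang N}" unfolding mem using track_eqD(2,6,7)[OF eq] by simp
  qed blast
  then obtain Q where Q: "lang Q = {pad w w | w. w \<in> lang N}" "letters_in Q PA" by blast
  obtain mN where mN: "fsa_of mN = N" by (rule fsa_of_surj)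
  obtain mQ where mQ: "fsa_of mQ = Q" by (rule fsa_of_surj)
  obtain mH where mH: "fsa_of mH = H" by (rule fsa_of_surj)
  define mP where "mP a = (initial (P a), final (P a), table (P a))" for a
  define Ms where "Ms = map (\<lambda>i. mP (dec i)) [0..<2 * n]"
  have select: "fsa_of (select Ms a) = P a" if "a \<in> A" for a
  proof -
    have "enc a < 2 * n" using that by (auto simp: alphabet_def enc_letter_def)
    then have "select Ms a = mP a" by (simp add: select_nth Ms_def)
    then show ?thesis by (simp add: mP_def fsa_of_def)
  qed
  have "passes vs (fsa_of mN) (fsa_of mQ) (\<lambda>a. fsa_of (select Ms a)) (fsa_of mH) k"
    unfolding mN mQ mH
  proof (rule standard_passes[OF N vs H Q])
    fix a assume a: "a \<in> A"
    show "lang (fsa_of (select Ms a)) = multiplication_pairs (lang N) a \<and> letters_in (fsa_of (select Ms a)) PA"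
      unfolding select[OF a] by (rule bspec[OF P a])
  qed
  then have "good_candidate vs (mN, mQ, Ms, mH, k)"
    unfolding good_candidate_def candidate_defs by (simp add: Ms_def)
  then show ?thesis ..
qed

end


section \<open>Detecting rational subgroups\<close>

theorem proposition2:
  fixes n :: nat and rs :: "word list"
  assumes "set rs \<subseteq> lists (alphabet n)"
  defines "G \<equiv> presented_group n (set rs)"
  defines "A \<equiv> alphabet n"
  defines "\<mu> \<equiv> letter_class n (set rs)"
  shows "\<exists>alg. partial_recursive alg \<and>
    (\<forall>vs :: word list. set vs \<subseteq> lists A \<longrightarrow>
      (let H = generate G (eval_word G \<mu> ` set vs) in
        (rational_for_some_structure G H \<longrightarrow>
          (\<exists>M M_eq Ms M_H.
             alg (words_code vs) = Some (output_code M M_eq Ms M_H) \<and>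
             length Ms = 2 * n \<and>
             automatic_structure_with_uniqueness G A \<mu> M M_eq (\<lambda>a. Ms ! letter_code a) \<and>
             lang M_H = preimage_in G \<mu> (lang M) H)) \<and>
        (\<not> rational_for_some_structure G H \<longrightarrow> alg (words_code vs) = None)))"
proof -
  interpret presentation n rs by unfold_locales (rule assms(1))
  have gens: "eval_word (presented_group n (set rs)) (letter_class n (set rs)) ` set vs = cl ` set vs"
    if "set vs \<subseteq> lists (alphabet n)" for vs
    by (rule image_cong[OF HOL.refl], rule eval_word_presented_group[OF assms(1)]) (use that in blast)
  show ?thesis
  proof (cases "\<exists>(B :: nat set) \<nu> M Meq Mm. automatic_structure (presented_group n (set rs)) B \<nu> M Meq Mm")
    case False
    then have "\<not> rational_for_some_structure (presented_group n (set rs)) K" for K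
      unfolding rational_for_some_structure_def by blast
    moreover have "partial_recursive (\<lambda>x. None)"
      using mu_search_decidable[OF decidable_const[of False]] by simp
    ultimately show ?thesis
      unfolding G_def Let_def by (intro exI[of _ "\<lambda>x. None"]) simp
  next
    case True
    then obtain B :: "nat set" and \<nu> M0 Meq0 Mm
      where aut: "automatic_structure (presented_group n (set rs)) B \<nu> M0 Meq0 Mm" by blast
    obtain N k where "standard (lang N) k" by (rule standard_structure[OF aut]) blast
    then have "decidable (\<lambda>p. weq (fst p) (snd p))" by (rule word_problem_decidable)
    then have semi: "semidecidable (\<lambda>p. good_candidate (fst p) (snd p))" by (rule semidecidable_good_candidate)
    obtain alg where alg: "partial_recursive alg"
      "\<forall>vs y. good_candidate vs y \<longrightarrow> (\<exists>y. good_candidate vs y \<and> alg (enc vs) = Some (enc (output_of y)))"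
      "\<forall>vs. (\<forall>y. \<not> good_candidate vs y) \<longrightarrow> alg (enc vs) = None"
      by (rule semidecidable_uniformization[where P=good_candidate, OF semi computable_output_of])
    show ?thesis
    proof (intro exI[of _ alg] conjI alg(1) allI impI, unfold Let_def, intro conjI impI)
      fix vs :: "word list" assume vs: "set vs \<subseteq> lists A"
      note vs' = vs[unfolded A_def]
      let ?H = "generate G (eval_word G \<mu> ` set vs)"
      have H: "?H = generate (presented_group n (set rs)) (cl ` set vs)"
        unfolding G_def \<mu>_def gens[OF vs'] ..
      have rational_iff: "rational_for_some_structure G ?H \<longleftrightarrow> rational_for_some_structure (presented_group n (set rs))
          (generate (presented_group n (set rs)) (cl ` set vs))"
        unfolding H unfolding G_def ..
      {
        assume "rational_for_some_structure G ?H"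
        then have "\<exists>y. good_candidate vs y" unfolding rational_iff by (rule rational_good_candidate[OF vs'])
        then obtain y0 where "good_candidate vs y0" ..
        then obtain y where y: "good_candidate vs y" "alg (enc vs) = Some (enc (output_of y))"
          using alg(2) by blast
        note sound = good_candidate_sound[OF vs' y(1)]
        show "\<exists>M M_eq Ms M_H.
             alg (words_code vs) = Some (output_code M M_eq Ms M_H) \<and>
             length Ms = 2 * n \<and>
             automatic_structure_with_uniqueness G A \<mu> M M_eq (\<lambda>a. Ms ! letter_code a) \<and>
             lang M_H = preimage_in G \<mu> (lang M) ?H"
          unfolding H unfolding G_def A_def \<mu>_def words_code_enc
          by (intro exI conjI, rule y(2)[unfolded enc_output_of]) (rule sound)+
      next
        assume "\<not> rational_for_some_structure G ?H"
        then have "\<not> good_candidate vs y" for y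
          using good_candidate_rational[OF vs'] unfolding rational_iff by blast
        then show "alg (words_code vs) = None" unfolding words_code_enc by (intro alg(3)[rule_format])
      }
    qed
  qed
qed

end
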